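(* Let $\mathcal H$ be an infinite-dimensional complex Hilbert space and let $\mathbf A=(A_1,\dots,A_m)$ be an $m$-tuple of compact operators on $\mathcal H$. Then for every $k\in\mathbb N$, $$\operatorname{cl}W_k(\mathbf A)=W_k(\mathbf A\oplus\mathbf 0_k)=W_k(\mathbf A\oplus\mathbf 0_\infty),$$ and hence $$\operatorname{cl}(\operatorname{conv}W_k(\mathbf A))=\operatorname{conv}W_k(\mathbf A\oplus\mathbf 0_k)=\operatorname{conv}W_k(\mathbf A\oplus\mathbf 0_\infty).$$ Consequently, the following conditions are equivalent. (a) For every $k\in\mathbb N$, $\operatorname{cl}W_k(\mathbf A)$ is polyhedral. (b) For every $k\in\mathbb N$, $\operatorname{cl}(\operatorname{conv}W_k(\mathbf A))$ is polyhedral. (c) The set $\{A_1,\dots,A_m\}$ is a commuting family of normal operators, and $\operatorname{conv}\Sigma_k(\mathbf A\oplus\mathbf 0_\infty)$ is polyhedral for every $k\in\mathbb N$.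
   Context: $\mathbb N$ is the set of positive integers. For an $m$-tuple $\mathbf A=(A_1,\dots,A_m)$ of bounded operators on a complex Hilbert space $\mathcal H$ and a positive integer $k\le\dim\mathcal H$, the joint $k$-numerical range is $$W_k(\mathbf A)=\Big\{\Big(\sum_{\ell=1}^k\langle A_1x_\ell,x_\ell\rangle,\dots,\sum_{\ell=1}^k\langle A_mx_\ell,x_\ell\rangle\Big):\{x_1,\dots,x_k\}\subseteq\mathcal H\text{ orthonormal}\Big\}\subseteq\mathbb C^m.$$ $\mathbf A\oplus\mathbf 0_\ell=(A_1\oplus0_\ell,\dots,A_m\oplus0_\ell)$, where $0_\ell$ is the $\ell\times\ell$ zero matrix for $\ell\in\mathbb N$ and $0_\infty$ is the zero operator on some infinite-dimensional Hilbert space. A point $\mu=(\mu_1,\dots,\mu_m)\in\mathbb C^m$ is a joint eigenvalue of an $m$-tuple $\mathbf B$ if there is a nonzero $x$ (a common eigenvector corresponding to $\mu$) with $B_jx=\mu_jx$ for all $j$. $\Sigma_k(\mathbf B)$ is the set of all sums $\mu^{(1)}+\cdots+\mu^{(k)}$, where $\mu^{(1)},\dots,\mu^{(k)}$ are joint eigenvalues of $\mathbf B$ (not necessarily distinct) corresponding to $k$ linearly independent common eigenvectors. A set is polyhedral if it is the convex hull of a finite set; $\operatorname{cl}$ and $\operatorname{conv}$ denote closure and convex hull. *)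

theory Defs
  imports "HOL-Analysis.Analysis"
begin

text \<open>
  Complex inner product spaces are layered on top of the real ones: the library's norm, metric and
  topology come from the real inner product, which is required to be the real part of the complex
  one. The complex inner product is linear in its first argument; its positive definiteness
  follows from that of \<^term>\<open>inner\<close> (see \<open>cinner_self\<close> below).
\<close>

class complex_inner = real_inner +
  fixes scaleC :: "complex \<Rightarrow> 'a \<Rightarrow> 'a" (infixr "*\<^sub>C" 75)
    and cinner :: "'a \<Rightarrow> 'a \<Rightarrow> complex"
  assumes scaleC_add_right: "c *\<^sub>C (x + y) = c *\<^sub>C x + c *\<^sub>C y"
    and scaleC_add_left: "(c + d) *\<^sub>C x = c *\<^sub>C x + d *\<^sub>C x"
    and scaleC_scaleC: "c *\<^sub>C d *\<^sub>C x = (c * d) *\<^sub>C x"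
    and scaleC_of_real: "complex_of_real r *\<^sub>C x = r *\<^sub>R x"
    and cinner_commute: "cinner x y = cnj (cinner y x)"
    and cinner_add_left: "cinner (x + y) z = cinner x z + cinner y z"
    and cinner_scaleC_left: "cinner (c *\<^sub>C x) y = c * cinner x y"
    and Re_cinner: "Re (cinner x y) = inner x y"

class chilbert_space = complex_inner + complete_space

lemma cinner_self: "cinner x x = complex_of_real ((norm x)\<^sup>2)"
proof -
  have "cinner x x = cnj (cinner x x)"
    by (rule cinner_commute)
  then have "Im (cinner x x) = 0"
    by (simp add: complex_eq_iff)
  then show ?thesis
    by (simp add: complex_eq_iff Re_cinner dot_square_norm)
qed

global_interpretation cvec: vector_space "scaleC :: complex \<Rightarrow> 'a \<Rightarrow> 'a::complex_inner"
proof
  show "1 *\<^sub>C x = x" for x :: 'a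
    using scaleC_of_real[of 1 x] by simp
qed (simp_all add: scaleC_add_right scaleC_add_left scaleC_scaleC)

instantiation complex :: complex_inner
begin
definition "scaleC (c::complex) (x::complex) = c * x"
definition "cinner (x::complex) (y::complex) = x * cnj y"
instance
  by standard
    (simp_all add: scaleC_complex_def cinner_complex_def algebra_simps scaleR_conv_of_real
      inner_complex_def)
end

instance complex :: chilbert_space ..

instantiation prod :: (complex_inner, complex_inner) complex_inner
begin
definition "scaleC c p = (c *\<^sub>C fst p, c *\<^sub>C snd p)"
definition "cinner p q = cinner (fst p) (fst q) + cinner (snd p) (snd q)"
instance
proof
  show "cinner p q = cnj (cinner q p)" for p q :: "'a \<times> 'b"
    unfolding cinner_prod_def
    by (simp add: cinner_commute[of "fst q" "fst p"] cinner_commute[of "snd q" "snd p"])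
qed (simp_all add: scaleC_prod_def cinner_prod_def scaleC_add_right scaleC_add_left scaleC_scaleC
      scaleC_of_real cinner_add_left cinner_scaleC_left Re_cinner inner_prod_def scaleR_prod_def
      distrib_left)
end

instance prod :: (chilbert_space, chilbert_space) chilbert_space ..

instantiation vec :: (complex_inner, finite) complex_inner
begin
definition "scaleC c (x::'a^'b) = (\<chi> i. c *\<^sub>C x $ i)"
definition "cinner (x::'a^'b) y = (\<Sum>i\<in>UNIV. cinner (x $ i) (y $ i))"
instance
proof
  show "cinner x y = cnj (cinner y x)" for x y :: "'a^'b"
    unfolding cinner_vec_def cnj_sum
    by (rule sum.cong[OF refl cinner_commute])
qed (simp_all add: scaleC_vec_def cinner_vec_def scaleC_add_right scaleC_add_left scaleC_scaleC
      scaleC_of_real cinner_add_left cinner_scaleC_left Re_cinner inner_vec_def vec_eq_iff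
      sum.distrib sum_distrib_left)
end

instance vec :: (chilbert_space, finite) chilbert_space ..

definition compact_operator :: "('a::complex_inner \<Rightarrow> 'b::complex_inner) \<Rightarrow> bool" where
  "compact_operator T \<longleftrightarrow>
     Vector_Spaces.linear scaleC scaleC T \<and> compact (closure (T ` cball 0 1))"

text \<open>
  The description is unique (\<open>cadjoint_eqI\<close>); for bounded linear operators on Hilbert spaces it is
  satisfiable by the Riesz representation theorem. \<open>normal_operator\<close> is intended for such operators
  only.
\<close>

definition cadjoint :: "('a::complex_inner \<Rightarrow> 'b::complex_inner) \<Rightarrow> 'b \<Rightarrow> 'a" where
  "cadjoint T = (THE S. \<forall>x y. cinner (T x) y = cinner x (S y))"

lemma cadjoint_eqI:
  assumes "\<And>x y. cinner (T x) y = cinner x (S y)"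
  shows "cadjoint T = S"
  unfolding cadjoint_def
proof (rule the_equality)
  fix S' assume S': "\<forall>x y. cinner (T x) y = cinner x (S' y)"
  show "S' = S"
  proof
    fix y
    have "cinner x (S' y) = cinner x (S y)" for x
      using S'[rule_format, of x y] assms[of x y] by simp
    then have "inner x (S' y) = inner x (S y)" for x
      by (simp flip: Re_cinner)
    then show "S' y = S y"
      by (metis vector_eq_ldot)
  qed
qed (use assms in simp)

definition normal_operator :: "('a::complex_inner \<Rightarrow> 'a) \<Rightarrow> bool" where
  "normal_operator T \<longleftrightarrow> T \<circ> cadjoint T = cadjoint T \<circ> T"

definition orthonormal_family :: "nat \<Rightarrow> (nat \<Rightarrow> 'a::complex_inner) \<Rightarrow> bool" where
  "orthonormal_family k x \<longleftrightarrow>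
     (\<forall>l\<in>{1..k}. \<forall>l'\<in>{1..k}. cinner (x l) (x l') = (if l = l' then 1 else 0))"

text \<open>An \<open>m\<close>-tuple of operators is a family indexed by a finite type with \<open>m\<close> elements.\<close>

definition joint_numerical_range ::
    "nat \<Rightarrow> ('m::finite \<Rightarrow> 'a::complex_inner \<Rightarrow> 'a) \<Rightarrow> (complex^'m) set" where
  "joint_numerical_range k A =
     {(\<chi> j. \<Sum>l=1..k. cinner (A j (x l)) (x l)) | x. orthonormal_family k x}"

definition tuple_dsum ::
    "('m \<Rightarrow> 'a \<Rightarrow> 'a) \<Rightarrow> ('m \<Rightarrow> 'b \<Rightarrow> 'b) \<Rightarrow> 'm \<Rightarrow> 'a \<times> 'b \<Rightarrow> 'a \<times> 'b" (infixr "\<oplus>" 65) where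
  "A \<oplus> B = (\<lambda>j. map_prod (A j) (B j))"

definition zero_tuple :: "'b::complex_inner itself \<Rightarrow> 'm \<Rightarrow> 'b \<Rightarrow> 'b" where
  "zero_tuple _ = (\<lambda>j y. 0)"

definition common_eigenvector ::
    "('m::finite \<Rightarrow> 'a::complex_inner \<Rightarrow> 'a) \<Rightarrow> complex^'m \<Rightarrow> 'a \<Rightarrow> bool" where
  "common_eigenvector B \<mu> x \<longleftrightarrow> x \<noteq> 0 \<and> (\<forall>j. B j x = (\<mu> $ j) *\<^sub>C x)"

definition eigenvalue_sums ::
    "nat \<Rightarrow> ('m::finite \<Rightarrow> 'a::complex_inner \<Rightarrow> 'a) \<Rightarrow> (complex^'m) set" where
  "eigenvalue_sums k B =
     {(\<Sum>l=1..k. \<mu> l) | \<mu> x. (\<forall>l\<in>{1..k}. common_eigenvector B (\<mu> l) (x l)) \<and>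
        inj_on x {1..k} \<and> cvec.independent (x ` {1..k})}"

end

theory Submission
  imports Defs
begin

text \<open>
  A weak limit of orthonormal \<open>k\<close>-families is a family whose Gram matrix is at most the identity.
  Compact operators turn weak into norm convergence, so the points of the closure of \<open>W\<^sub>k(\<^bold>A)\<close> are
  the values at such families, and factoring the defect of the Gram matrix from the identity dilates them to
  orthonormal families of \<open>\<^bold>A \<oplus> \<^bold>0\<close>. Conversely an orthonormal sequence of the infinite-dimensional
  space, on which compact operators tend to zero, imitates the zero summand.

  Let \<open>\<^bold>B = \<^bold>A \<oplus> \<^bold>0\<close> and suppose that the convex hulls of all \<open>W\<^sub>k(\<^bold>B)\<close> are polytopes. The support
  function of \<open>W\<^sub>k(\<^bold>B)\<close> in direction \<open>a\<close> is the sum of the \<open>k\<close> largest eigenvalues of the real part of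
  \<open>a \<bullet> \<^bold>B\<close>, and it is linear in \<open>a\<close> on some open subset of any given open set. Linearity forces a
  top eigenvector for one \<open>a\<close> to be one for all nearby \<open>a\<close>, hence to be a common eigenvector of the
  \<open>B\<^sub>j\<close> and their adjoints. If these vectors did not span a dense subspace, then this would produce,
  for every \<open>k\<close>, an orthonormal \<open>k\<close>-family of common eigenvectors with eigenvalues bounded away
  from zero, contradicting compactness. So \<open>\<^bold>B\<close> is a commuting family of normal operators.

  For commuting normal \<open>\<^bold>B\<close>, each linear functional attains its maximum over \<open>W\<^sub>k(\<^bold>B)\<close> at an
  orthonormal family of common eigenvectors (Ky Fan), so that \<open>W\<^sub>k\<close> and \<open>\<Sigma>\<^sub>k\<close> have the same support
  function, while the Schur-Horn theorem for projections realizes every convex combination of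
  elements of \<open>\<Sigma>\<^sub>k\<close> in \<open>W\<^sub>k\<close>.
\<close>

section \<open>Complex inner products, Riesz representation, adjoints\<close>

text \<open>Weak limits keep upper bounds on norms but may lose norm, so the quadratic form of a
  compact operator has a maximizer over the unit ball and possibly none over the unit sphere. This
  obstacle shapes both halves: it makes contractive families the right description of the closure,
  and it is why the eigenvalue arguments run for the direct sum, whose null vectors pad a short
  maximizer to norm 1.

  The Hilbert spaces may be nonseparable, so filters replace subsequences, and weak compactness is
  compactness of a product. Instead of a spectral theorem, first-order conditions at maximizers of
  quadratic forms produce all eigenvectors.

  Support functions determine only closed convex hulls, whereas (a) speaks of the closed range
  itself, and a joint range need not be convex. Hence the way from (c) to (a) has to realize convex
  combinations by explicit orthonormal families. The equivalences are proved as the cycle (a), (b),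
  (c), (a).\<close>

lemma norm_scaleC: "norm (c *\<^sub>C x) = cmod c * norm (x::'a::complex_inner)"
proof -
  have "complex_of_real ((norm (c *\<^sub>C x))\<^sup>2) = c * cnj (c * cinner x x)"
    by (metis cinner_self cinner_commute cinner_scaleC_left)
  also have "\<dots> = complex_of_real ((cmod c * norm x)\<^sup>2)"
    by (simp add: cinner_self complex_norm_square power_mult_distrib del: of_real_power)
  finally have "(norm (c *\<^sub>C x))\<^sup>2 = (cmod c * norm x)\<^sup>2"
    using of_real_eq_iff by blast
  then show ?thesis
    by (simp add: power2_eq_iff_nonneg)
qed

lemma cinner_scaleC_right: "cinner x (c *\<^sub>C y) = cnj c * cinner x (y::'a::complex_inner)"
  by (metis cinner_commute cinner_scaleC_left complex_cnj_mult)

lemma cinner_add_right: "cinner x (y + z) = cinner x y + cinner x (z::'a::complex_inner)"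
  by (metis cinner_commute cinner_add_left complex_cnj_add)

lemma cinner_cauchy_schwarz: "cmod (cinner x y) \<le> norm x * norm (y::'a::complex_inner)"
proof (cases "cinner x y = 0")
  case False
  \<comment> \<open>Multiplying \<open>x\<close> by this phase turns the complex inner product into
    its own modulus, so that the real inequality applies.\<close>
  define c where "c = cnj (sgn (cinner x y))"
  have "c * cinner x y = complex_of_real (cmod (cinner x y))"
    using False by (simp add: c_def sgn_eq complex_norm_square[symmetric] mult.commute
        power2_eq_square field_simps)
  then have "cmod (cinner x y) = Re (cinner (c *\<^sub>C x) y)"
    by (simp add: cinner_scaleC_left)
  also have "\<dots> \<le> norm (c *\<^sub>C x) * norm y"
    by (simp add: Re_cinner norm_cauchy_schwarz)
  also have "norm (c *\<^sub>C x) = norm x"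
    using False by (simp add: norm_scaleC c_def norm_sgn)
  finally show ?thesis .
qed simp

interpretation cinner: bounded_bilinear "cinner :: 'a::complex_inner \<Rightarrow> 'a \<Rightarrow> complex"
proof
  show "\<exists>K. \<forall>x y::'a. norm (cinner x y) \<le> norm x * norm y * K"
    by (rule exI[of _ 1]) (simp add: cinner_cauchy_schwarz)
  show "cinner (r *\<^sub>R x) y = r *\<^sub>R cinner x y" for r and x y :: 'a
    by (simp add: cinner_scaleC_left scaleR_conv_of_real flip: scaleC_of_real[where 'a='a])
  show "cinner x (r *\<^sub>R y) = r *\<^sub>R cinner x y" for r and x y :: 'a
    by (simp add: cinner_scaleC_right scaleR_conv_of_real flip: scaleC_of_real[where 'a='a])
qed (simp_all add: cinner_add_left cinner_add_right)

lemmas cinner_simps = cinner.add_left cinner.add_right cinner.diff_left cinner.diff_right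
  cinner.minus_left cinner.minus_right cinner_scaleC_left cinner_scaleC_right
  cinner.scaleR_left cinner.scaleR_right cinner.zero_left cinner.zero_right

lemma cinner_eq_zero_commute: "cinner x y = 0 \<longleftrightarrow> cinner y (x::'a::complex_inner) = 0"
  by (metis cinner_commute complex_cnj_zero)

lemma norm_power2_cinner: "(norm (x::'a::complex_inner))\<^sup>2 = Re (cinner x x)"
  by (simp add: cinner_self)

lemma cinner_eqI: "(\<And>y. cinner x y = cinner x' y) \<Longrightarrow> x = (x'::'a::complex_inner)"
  by (metis Re_cinner vector_eq_rdot)

lemma cinner_ext: "(\<And>y. cinner x y = 0) \<Longrightarrow> x = (0::'a::complex_inner)"
  by (metis cinner_eqI cinner.zero_left)

lemma cinner_self_eq_0 [simp]: "cinner x x = 0 \<longleftrightarrow> x = (0::'a::complex_inner)"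
  by (simp add: cinner_self)

abbreviation clinear :: "('a::complex_inner \<Rightarrow> 'b::complex_inner) \<Rightarrow> bool" where
  "clinear \<equiv> Vector_Spaces.linear scaleC scaleC"

lemma clinear_add: "clinear T \<Longrightarrow> T (x + y) = T x + T y"
  by (rule module_hom.add[OF Vector_Spaces.linear.axioms(3)])

lemma clinear_scaleC: "clinear T \<Longrightarrow> T (c *\<^sub>C x) = c *\<^sub>C T x"
  by (rule module_hom.scale[OF Vector_Spaces.linear.axioms(3)])

lemma clinear_imp_linear: "clinear T \<Longrightarrow> linear T"
  by (rule linearI) (simp_all add: clinear_add clinear_scaleC flip: scaleC_of_real)

lemma clinearI:
  assumes "\<And>x y. T (x + y) = T x + T y" "\<And>c x. T (c *\<^sub>C x) = c *\<^sub>C T x"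
  shows "clinear T"
  using assms by unfold_locales (auto simp: scaleC_add_left scaleC_add_right scaleC_scaleC)

text \<open>A minimizer of \<open>\<parallel>y\<parallel>\<^sup>2 - 2 \<rho> y\<close> represents \<open>\<rho>\<close>; minimizing sequences are Cauchy by the
  parallelogram law.\<close>

lemma riesz_real:
  fixes \<rho> :: "'a::{real_inner, complete_space} \<Rightarrow> real"
  assumes "bounded_linear \<rho>"
  shows "\<exists>x. \<forall>y. \<rho> y = inner x y"
proof -
  interpret \<rho>: bounded_linear \<rho> by fact
  obtain K where K: "\<And>y. norm (\<rho> y) \<le> norm y * K"
    using \<rho>.bounded by blast
  define J where "J y = (norm y)\<^sup>2 - 2 * \<rho> y" for y
  have Jlow: "- K\<^sup>2 \<le> J y" for y
  proof -
    have "\<rho> y \<le> norm y * K" using K[of y] by simp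
    moreover have "0 \<le> (norm y - K)\<^sup>2" by simp
    ultimately show ?thesis unfolding J_def by (simp add: power2_diff)
  qed
  define I where "I = Inf (range J)"
  have bdd: "bdd_below (range J)" using Jlow by (auto intro!: bdd_belowI)
  have I: "I \<le> J y" for y unfolding I_def by (rule cInf_lower) (use bdd in auto)
  have "\<exists>y. J y < I + 1 / Suc n" for n
  proof -
    have "Inf (range J) < I + 1 / Suc n" by (simp add: I_def)
    then show ?thesis by (subst (asm) cInf_less_iff) (use bdd in auto)
  qed
  then obtain y where y: "\<And>n. J (y n) < I + 1 / Suc n" by metis
  have par: "(norm (u - v))\<^sup>2 = 2 * J u + 2 * J v - 4 * J ((1/2) *\<^sub>R (u + v))" for u v
  proof -
    have n: "norm ((1/2) *\<^sub>R (u + v)) = norm (u + v) / 2" by simp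
    show ?thesis
      using dot_norm[of u v] dot_norm_neg[of u v]
      unfolding J_def n by (simp add: \<rho>.add \<rho>.scaleR power_divide field_simps)
  qed
  have close: "(norm (y m - y n))\<^sup>2 \<le> 4 / Suc N" if "N \<le> m" "N \<le> n" for m n N
  proof -
    have "1 / real (Suc m) \<le> 1 / Suc N" "1 / real (Suc n) \<le> 1 / Suc N"
      using that by (auto intro!: divide_left_mono)
    then show ?thesis
      using par[of "y m" "y n"] y[of m] y[of n] I[of "(1/2) *\<^sub>R (y m + y n)"] by simp
  qed
  have "Cauchy y"
  proof (rule metric_CauchyI)
    fix e :: real assume "e > 0"
    obtain N where N: "inverse (real (Suc N)) < e\<^sup>2 / 4"
      using reals_Archimedean \<open>e > 0\<close> by (metis zero_less_divide_iff zero_less_numeral zero_less_power)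
    have "dist (y m) (y n) < e" if "m \<ge> N" "n \<ge> N" for m n
    proof -
      have "(norm (y m - y n))\<^sup>2 < e\<^sup>2"
      proof -
        have "4 / real (Suc N) < e\<^sup>2" using N by (simp add: field_simps)
        with close[OF that] show ?thesis by linarith
      qed
      then show ?thesis using \<open>e > 0\<close> by (simp add: dist_norm power_less_imp_less_base)
    qed
    then show "\<exists>M. \<forall>m\<ge>M. \<forall>n\<ge>M. dist (y m) (y n) < e" by blast
  qed
  then obtain x where x: "y \<longlonglongrightarrow> x" using Cauchy_convergent convergent_def by blast
  have "J x \<le> I"
  proof (rule LIMSEQ_le)
    show "(\<lambda>n. J (y n)) \<longlonglongrightarrow> J x" unfolding J_def
      by (intro tendsto_intros x \<rho>.tendsto)
    show "(\<lambda>n. I + 1 / Suc n) \<longlonglongrightarrow> I"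
      using tendsto_add[OF tendsto_const LIMSEQ_inverse_real_of_nat]
      by (simp add: inverse_eq_divide)
    show "\<exists>N. \<forall>n\<ge>N. J (y n) \<le> I + 1 / Suc n" using y less_imp_le by blast
  qed
  then have min: "J x \<le> J z" for z using I order_trans by blast
  have "\<rho> z = inner x z" for z
  proof (rule ccontr)
    assume ne: "\<rho> z \<noteq> inner x z"
    define D where "D = \<rho> z - inner x z"
    \<comment> \<open>Moving by \<open>t\<close> along \<open>z\<close> changes \<open>J\<close> by
      \<open>- 2 * t * D + t\<^sup>2 * (norm z)\<^sup>2\<close>, which is least at
      \<open>D / (norm z)\<^sup>2\<close>. The added 1 keeps the denominator positive and still
      gives a strict decrease.\<close>
    define t where "t = D / ((norm z)\<^sup>2 + 1)"
    have "J (x + t *\<^sub>R z) = J x - 2 * t * D + t\<^sup>2 * (norm z)\<^sup>2"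
      using dot_norm[of x "t *\<^sub>R z"]
      unfolding J_def D_def by (simp add: \<rho>.add \<rho>.scaleR power_mult_distrib algebra_simps)
    also have "t\<^sup>2 * (norm z)\<^sup>2 \<le> t * D"
    proof -
      have "t\<^sup>2 * (norm z)\<^sup>2 \<le> t\<^sup>2 * ((norm z)\<^sup>2 + 1)" by (simp add: mult_left_mono)
      also have "\<dots> = t * D"
        unfolding t_def power2_eq_square by (simp add: add_nonneg_eq_0_iff field_simps)
      finally show ?thesis .
    qed
    finally have "t * D \<le> 0" using min[of "x + t *\<^sub>R z"] by (simp add: mult.commute)
    moreover have "t * D > 0" using ne unfolding t_def D_def
      by (simp add: zero_less_mult_iff zero_less_divide_iff add_nonneg_pos divide_less_0_iff)
         (smt (verit) zero_le_power2)
    ultimately show False by simp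
  qed
  then show ?thesis by blast
qed

lemma riesz:
  fixes \<phi> :: "'a::chilbert_space \<Rightarrow> complex"
  assumes "bounded_linear \<phi>" "\<And>c x. \<phi> (c *\<^sub>C x) = c * \<phi> x"
  shows "\<exists>x. \<forall>y. \<phi> y = cinner y x"
proof -
  have "bounded_linear (\<lambda>y. Re (\<phi> y))"
    by (rule bounded_linear_compose[OF bounded_linear_Re assms(1)])
  then obtain x where x: "\<And>y. Re (\<phi> y) = inner x y" using riesz_real by blast
  have R: "Re (\<phi> y) = Re (cinner y x)" for y
    using x[of y] by (simp add: Re_cinner inner_commute)
  \<comment> \<open>The imaginary part at \<open>y\<close> is the real part at
    \<open>(-\<i>) *\<^sub>C y\<close>.\<close>
  have "Im (\<phi> y) = Im (cinner y x)" for y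
    using R[of "(-\<i>) *\<^sub>C y"] by (simp only: assms(2) cinner_scaleC_left) simp
  then show ?thesis using R complex_eq_iff by blast
qed

lemma cinner_cadjoint:
  fixes T :: "'a::chilbert_space \<Rightarrow> 'b::complex_inner"
  assumes "bounded_linear T" "clinear T"
  shows "cinner (T x) y = cinner x (cadjoint T y)"
proof -
  have "\<exists>z. \<forall>x. cinner (T x) y = cinner x z" for y
  proof (rule riesz)
    show "bounded_linear (\<lambda>x. cinner (T x) y)"
      by (rule bounded_linear_compose[OF cinner.bounded_linear_left assms(1)])
  qed (simp add: clinear_scaleC[OF assms(2)] cinner_scaleC_left)
  then obtain S where S: "\<And>x y. cinner (T x) y = cinner x (S y)" by metis
  then show ?thesis using cadjoint_eqI[of T S] by simp
qed

lemma compact_operator_clinear: "compact_operator T \<Longrightarrow> clinear T"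
  by (simp add: compact_operator_def)

text \<open>\<open>compact_operator\<close> asks only for linearity; the bound comes from the
  compact closure of the image of the unit ball.\<close>

lemma compact_operator_bounded_linear:
  assumes "compact_operator T"
  shows "bounded_linear T"
proof -
  have "bounded (T ` cball 0 1)"
    using assms unfolding compact_operator_def
    by (meson bounded_subset closure_subset compact_imp_bounded)
  then obtain K where K: "\<And>x. norm x \<le> 1 \<Longrightarrow> norm (T x) \<le> K"
    unfolding bounded_iff by (metis imageI mem_cball_0)
  interpret T: linear T by (rule clinear_imp_linear[OF compact_operator_clinear[OF assms]])
  show ?thesis
  proof (unfold_locales, rule exI[of _ K], rule allI)
    fix x
    show "norm (T x) \<le> norm x * K"
    proof (cases "x = 0")
      case False
      then have "norm (T (inverse (norm x) *\<^sub>R x)) \<le> K" by (intro K) simp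
      then show ?thesis using False by (simp add: T.scaleR field_simps)
    qed (simp add: T.zero)
  qed
qed

section \<open>Orthogonal complements and weak compactness\<close>

text \<open>Closed subspaces appear throughout in the form \<open>perp S\<close>: the condition
  passes to weak limits directly, and restricting to a smaller subspace amounts to enlarging
  \<open>S\<close>.\<close>

definition perp :: "'a::complex_inner set \<Rightarrow> 'a set" where
  "perp S = {x. \<forall>s\<in>S. cinner x s = 0}"

lemma perpD: "x \<in> perp S \<Longrightarrow> s \<in> S \<Longrightarrow> cinner x s = 0"
  by (simp add: perp_def)

lemma perp_add: "x \<in> perp S \<Longrightarrow> y \<in> perp S \<Longrightarrow> x + y \<in> perp S"
  and perp_diff: "x \<in> perp S \<Longrightarrow> y \<in> perp S \<Longrightarrow> x - y \<in> perp S"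
  and perp_scaleC: "x \<in> perp S \<Longrightarrow> c *\<^sub>C x \<in> perp S"
  and perp_scaleR: "x \<in> perp S \<Longrightarrow> r *\<^sub>R x \<in> perp S"
  and perp_0: "0 \<in> perp S"
  by (simp_all add: perp_def cinner_simps)

lemma perp_Un: "perp (S \<union> T) = perp S \<inter> perp T"
  by (auto simp: perp_def)

lemma perp_span:
  assumes "x \<in> perp S" "y \<in> cvec.span S"
  shows "cinner x y = 0"
  using assms(2)
proof (induction rule: cvec.span_induct)
  case base
  then show ?case unfolding cvec.subspace_def by (auto simp: cinner_simps)
next
  case (step y)
  then show ?case using assms(1) by (simp add: perpD)
qed

text \<open>Gram-Schmidt without normalization: the new vector \<open>g\<close> is first replaced by
  its component \<open>h\<close> orthogonal to \<open>F\<close>.\<close>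

lemma finite_projection:
  assumes "finite F"
  shows "\<exists>p\<in>cvec.span F. x - p \<in> perp F"
  using assms
proof (induction arbitrary: x)
  case empty
  then show ?case by (auto simp: perp_def intro: cvec.span_zero)
next
  case (insert g F)
  obtain p0 where p0: "p0 \<in> cvec.span F" "x - p0 \<in> perp F" using insert.IH by blast
  obtain q where q: "q \<in> cvec.span F" "g - q \<in> perp F" using insert.IH by blast
  define h where "h = g - q"
  \<comment> \<open>If \<open>g\<close> lies in the span of \<open>F\<close>, then
    \<open>h = 0\<close>, and division by zero makes \<open>p = p0\<close>, the right
    choice.\<close>
  define p where "p = p0 + (cinner (x - p0) h / cinner h h) *\<^sub>C h"
  have spF: "cvec.span F \<subseteq> cvec.span (insert g F)" by (rule cvec.span_mono) auto
  have h: "h \<in> cvec.span (insert g F)"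
    unfolding h_def using q spF by (auto intro: cvec.span_diff cvec.span_base)
  have perpF: "x - p \<in> perp F"
    using perp_diff[OF p0(2) perp_scaleC[OF q(2)]] unfolding p_def h_def by (simp add: algebra_simps)
  have "cinner (x - p) h = 0"
    unfolding p_def by (cases "h = 0") (simp_all add: cinner_simps)
  moreover have "cinner (x - p) q = 0" using perp_span[OF perpF q(1)] .
  ultimately have "cinner (x - p) g = 0" unfolding h_def by (simp add: cinner_simps)
  then have "x - p \<in> perp (insert g F)" using perpF by (simp add: perp_def)
  moreover have "p \<in> cvec.span (insert g F)"
    unfolding p_def using p0(1) spF h by (auto intro!: cvec.span_add cvec.span_scale)
  ultimately show ?case by blast
qed

text \<open>That \<open>z\<close> stays in the span allows a later orthonormalization to remain
  inside one joint eigenspace.\<close>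

lemma exists_unit_perp_in_span:
  assumes "finite F" "x \<notin> cvec.span F"
  shows "\<exists>z\<in>cvec.span (insert x F). norm z = 1 \<and> z \<in> perp F"
proof -
  obtain p where p: "p \<in> cvec.span F" "x - p \<in> perp F" using finite_projection[OF assms(1)] by blast
  have ne: "x - p \<noteq> 0" using p assms(2) by auto
  have "p \<in> cvec.span (insert x F)" using p(1) cvec.span_mono[of F "insert x F"] by blast
  then have "x - p \<in> cvec.span (insert x F)" by (auto intro: cvec.span_diff cvec.span_base)
  then have "inverse (norm (x - p)) *\<^sub>R (x - p) \<in> cvec.span (insert x F)"
    unfolding scaleC_of_real[symmetric] by (rule cvec.span_scale)
  moreover have "norm (inverse (norm (x - p)) *\<^sub>R (x - p)) = 1" using ne by simp
  ultimately show ?thesis using perp_scaleR[OF p(2)] by blast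
qed

lemma infinite_dim_unit_perp:
  assumes "\<nexists>S :: 'a::complex_inner set. finite S \<and> cvec.span S = UNIV" "finite F"
  shows "\<exists>z::'a. norm z = 1 \<and> z \<in> perp F"
proof -
  obtain x where "x \<notin> cvec.span F" using assms by blast
  then show ?thesis using exists_unit_perp_in_span[OF assms(2)] by blast
qed

section \<open>Weak compactness by way of product topologies and filters\<close>

lemma compact_PiE_UNIV:
  fixes S :: "'i \<Rightarrow> 'b::topological_space set"
  assumes "\<And>i. compact (S i)"
  shows "compact (PiE UNIV S)"
proof -
  have "compactin (product_topology (\<lambda>i. euclidean) UNIV) (PiE UNIV S)"
    unfolding compactin_PiE using assms by simp
  then show ?thesis by (simp add: euclidean_product_topology)
qed

text \<open>The finer filter \<open>G\<close> plays the role of a convergent subsequence, which an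
  uncountable product of compact spaces need not provide.\<close>

lemma compact_cluster_filter:
  assumes "compact K" "F \<noteq> bot" "\<forall>\<^sub>F i in F. g i \<in> K"
  shows "\<exists>G \<xi>. G \<le> F \<and> G \<noteq> bot \<and> \<xi> \<in> K \<and> (g \<longlongrightarrow> \<xi>) G"
proof -
  have "filtermap g F \<noteq> bot" using assms(2) by (simp add: filtermap_bot_iff)
  moreover have "eventually (\<lambda>x. x \<in> K) (filtermap g F)" using assms(3) by (simp add: eventually_filtermap)
  ultimately obtain \<xi> where \<xi>: "\<xi> \<in> K" "inf (nhds \<xi>) (filtermap g F) \<noteq> bot"
    using assms(1) unfolding compact_filter by blast
  define G where "G = inf F (filtercomap g (nhds \<xi>))"
  have "G \<noteq> bot"
  proof
    assume "G = bot"
    then obtain Q R where "eventually Q F" "eventually R (nhds \<xi>)" "\<And>i. Q i \<Longrightarrow> \<not> R (g i)"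
      unfolding G_def trivial_limit_def eventually_inf eventually_filtercomap by blast
    then have "eventually (\<lambda>_. False) (inf (nhds \<xi>) (filtermap g F))"
      unfolding eventually_inf eventually_filtermap
      by (intro exI[of _ R] exI[of _ "\<lambda>y. \<not> R y"]) (auto elim: eventually_mono)
    then show False using \<xi>(2) by (simp add: trivial_limit_def)
  qed
  moreover have "(g \<longlongrightarrow> \<xi>) G" unfolding filterlim_iff_le_filtercomap G_def by simp
  ultimately show ?thesis using \<xi>(1) unfolding G_def by (metis inf_le1)
qed

text \<open>All inner products \<open>cinner (f i l) y\<close> and all images
  \<open>B j (f i l)\<close> are coordinates of one point in a compact product, so a single filter
  serves every \<open>l\<close>, \<open>y\<close> and \<open>j\<close>. The limits of the inner
  products are represented by vectors through Riesz.\<close>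

lemma weak_cluster_point:
  fixes f :: "'i \<Rightarrow> nat \<Rightarrow> 'h::chilbert_space" and B :: "'m \<Rightarrow> 'h \<Rightarrow> 'h"
  assumes cpt: "\<And>j. compact_operator (B j)" and F: "F \<noteq> bot" and f: "\<And>i l. norm (f i l) \<le> 1"
  shows "\<exists>G x. G \<le> F \<and> G \<noteq> bot \<and> (\<forall>l y. ((\<lambda>i. cinner (f i l) y) \<longlongrightarrow> cinner (x l) y) G)
     \<and> (\<forall>l j. ((\<lambda>i. B j (f i l)) \<longlongrightarrow> B j (x l)) G)"
proof -
  define K1 where "K1 = PiE UNIV (\<lambda>p::nat \<times> 'h. cball (0::complex) (norm (snd p)))"
  define K2 where "K2 = PiE UNIV (\<lambda>p::nat \<times> 'm. closure (B (snd p) ` cball 0 1))"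
  define g where "g i = ((\<lambda>p. cinner (f i (fst p)) (snd p)), (\<lambda>p. B (snd p) (f i (fst p))))" for i
  have "compact (K1 \<times> K2)"
    unfolding K1_def K2_def using cpt
    by (intro compact_Times compact_PiE_UNIV) (auto simp: compact_operator_def)
  moreover have "g i \<in> K1 \<times> K2" for i
  proof -
    have "cmod (cinner (f i l) y) \<le> norm y" for l y
      using cinner_cauchy_schwarz[of "f i l" y] f[of i l]
      by (metis mult_right_mono mult_1 norm_ge_zero order_trans)
    moreover have "B j (f i l) \<in> closure (B j ` cball 0 1)" for l j
      using f[of i l] by (intro closure_subset[THEN subsetD]) auto
    ultimately show ?thesis unfolding g_def K1_def K2_def by auto
  qed
  ultimately obtain G \<xi> where G: "G \<le> F" "G \<noteq> bot" and \<xi>: "\<xi> \<in> K1 \<times> K2" "(g \<longlongrightarrow> \<xi>) G"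
    using compact_cluster_filter[OF _ F, of "K1 \<times> K2" g] by (metis eventually_True always_eventually)
  have 1: "((\<lambda>i. cinner (f i l) y) \<longlongrightarrow> fst \<xi> (l, y)) G" for l y
    using continuous_on_tendsto_compose[OF continuous_on_product_coordinates[of "(l,y)"] tendsto_fst[OF \<xi>(2)], simplified]
    by (simp add: g_def)
  have 2: "((\<lambda>i. B j (f i l)) \<longlongrightarrow> snd \<xi> (l, j)) G" for l j
    using continuous_on_tendsto_compose[OF continuous_on_product_coordinates[of "(l,j)"] tendsto_snd[OF \<xi>(2)], simplified]
    by (simp add: g_def)
  have "\<exists>x. \<forall>y. fst \<xi> (l, y) = cinner x y" for l
  proof -
    \<comment> \<open>The limit is antilinear in \<open>y\<close>; conjugation yields the linear
      functional that \<open>riesz\<close> expects.\<close>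
    define \<phi> where "\<phi> y = cnj (fst \<xi> (l, y))" for y
    have lim: "((\<lambda>i. cinner y (f i l)) \<longlongrightarrow> \<phi> y) G" for y
      using tendsto_cnj[OF 1[of l y]] by (simp add: \<phi>_def cinner_commute[of y])
    have add: "\<phi> (x + y) = \<phi> x + \<phi> y" for x y
    proof (rule tendsto_unique[OF G(2) lim])
      show "((\<lambda>i. cinner (x + y) (f i l)) \<longlongrightarrow> \<phi> x + \<phi> y) G"
        unfolding cinner.add_left by (intro tendsto_add lim)
    qed
    have sc: "\<phi> (c *\<^sub>C x) = c * \<phi> x" for c x
    proof (rule tendsto_unique[OF G(2) lim])
      show "((\<lambda>i. cinner (c *\<^sub>C x) (f i l)) \<longlongrightarrow> c * \<phi> x) G"
        unfolding cinner_scaleC_left by (intro tendsto_mult tendsto_const lim)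
    qed
    have "bounded_linear \<phi>"
    proof (rule bounded_linear_intro[of _ 1])
      show "\<phi> (r *\<^sub>R x) = r *\<^sub>R \<phi> x" for r x
        using sc[of "of_real r" x] by (simp add: scaleC_of_real scaleR_conv_of_real)
      show "norm (\<phi> y) \<le> norm y * 1" for y
        using \<xi>(1) unfolding K1_def \<phi>_def by (auto simp: mem_Times_iff PiE_iff)
    qed (rule add)
    then obtain x where "\<And>y. \<phi> y = cinner y x" using riesz sc by blast
    then have "fst \<xi> (l, y) = cinner x y" for y
      unfolding \<phi>_def by (metis cinner_commute complex_cnj_cnj)
    then show ?thesis by blast
  qed
  then obtain x where x: "\<And>l y. fst \<xi> (l, y) = cinner (x l) y" by metis
  \<comment> \<open>The norm limit of the images is identified by testing against \<open>y\<close>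
    and moving \<open>B j\<close> to its adjoint, where weak convergence suffices.\<close>
  have 3: "snd \<xi> (l, j) = B j (x l)" for l j
  proof (rule cinner_eqI)
    fix y
    have adj: "cinner (B j z) y = cinner z (cadjoint (B j) y)" for z
      by (intro cinner_cadjoint compact_operator_bounded_linear compact_operator_clinear cpt)
    have "((\<lambda>i. cinner (B j (f i l)) y) \<longlongrightarrow> cinner (snd \<xi> (l, j)) y) G"
      by (intro cinner.tendsto 2 tendsto_const)
    moreover have "((\<lambda>i. cinner (B j (f i l)) y) \<longlongrightarrow> cinner (B j (x l)) y) G"
      unfolding adj using 1[of l "cadjoint (B j) y"] by (simp add: x)
    ultimately show "cinner (snd \<xi> (l, j)) y = cinner (B j (x l)) y"
      using tendsto_unique[OF G(2)] by blast
  qed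
  show ?thesis
    using G 1 2 unfolding x 3 by blast
qed

text \<open>One step of the Cholesky decomposition: the last row of the kernel is split off.\<close>

lemma psd_kernel_gram:
  fixes P :: "nat \<Rightarrow> nat \<Rightarrow> complex"
  assumes "\<And>l l'. P l' l = cnj (P l l')"
    and "\<And>a. 0 \<le> Re (\<Sum>l=1..k. \<Sum>l'=1..k. a l * cnj (a l') * P l l')"
  shows "\<exists>b. \<forall>l\<in>{1..k}. \<forall>l'\<in>{1..k}. P l l' = (\<Sum>i=1..k. b l i * cnj (b l' i))"
  using assms
proof (induction k arbitrary: P)
  case 0
  show ?case by simp
next
  case (Suc k)
  note herm = Suc.prems(1) and psd = Suc.prems(2)
  define N where "N = Suc k"
  have split: "(\<Sum>l=1..N. \<Sum>l'=1..N. a l * cnj (a l') * Q l l')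
      = (\<Sum>l=1..k. \<Sum>l'=1..k. a l * cnj (a l') * Q l l') + (\<Sum>l=1..k. a l * cnj (a N) * Q l N)
        + (\<Sum>l=1..k. a N * cnj (a l) * Q N l) + a N * cnj (a N) * Q N N" for Q :: "nat \<Rightarrow> nat \<Rightarrow> complex" and a
    unfolding N_def by (simp add: sum.distrib)
  define p where "p = Re (P N N)"
  have pN: "P N N = of_real p" using herm[of N N] by (simp add: p_def complex_eq_iff)
  define s where "s a = (\<Sum>l=1..k. a l * P l N)" for a
  define Q where "Q a = Re (\<Sum>l=1..k. \<Sum>l'=1..k. a l * cnj (a l') * P l l')" for a
  have quad: "0 \<le> Q a + 2 * Re (cnj t * s a) + (cmod t)\<^sup>2 * p" for a t
  proof -
    define a' where "a' = a(N := t)"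
    have eq: "a' l = a l" if "l \<in> {1..k}" for l using that by (auto simp: a'_def N_def)
    have "0 \<le> Re (\<Sum>l=1..N. \<Sum>l'=1..N. a' l * cnj (a' l') * P l l')"
      using psd unfolding N_def by blast
    also have "(\<Sum>l=1..k. \<Sum>l'=1..k. a' l * cnj (a' l') * P l l') = (\<Sum>l=1..k. \<Sum>l'=1..k. a l * cnj (a l') * P l l')"
      by (intro sum.cong refl) (simp add: eq)
    hence "Re (\<Sum>l=1..N. \<Sum>l'=1..N. a' l * cnj (a' l') * P l l') = Q a + Re (cnj t * s a) + Re (t * cnj (s a)) + Re (t * cnj t * P N N)"
    proof -
      assume A: "(\<Sum>l=1..k. \<Sum>l'=1..k. a' l * cnj (a' l') * P l l') = (\<Sum>l=1..k. \<Sum>l'=1..k. a l * cnj (a l') * P l l')"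
      have B: "(\<Sum>l=1..k. a' l * cnj (a' N) * P l N) = cnj t * s a"
        unfolding s_def sum_distrib_left by (intro sum.cong refl) (simp add: eq, simp add: a'_def)
      have C: "(\<Sum>l=1..k. a' N * cnj (a' l) * P N l) = t * cnj (s a)"
        unfolding s_def sum_distrib_left cnj_sum
        by (intro sum.cong refl) (simp add: eq herm[of N], simp add: a'_def)
      have D: "a' N = t" by (simp add: a'_def)
      show ?thesis unfolding split A B C unfolding D Q_def by (simp only: plus_complex.simps)
    qed
    also have "Re (t * cnj (s a)) = Re (cnj t * s a)" by simp
    also have "Re (t * cnj t * P N N) = (cmod t)\<^sup>2 * p"
      unfolding complex_norm_square[symmetric] pN by (simp add: cmod_power2)
    finally show ?thesis by simp
  qed
  have p0: "0 \<le> p" using quad[of "\<lambda>_. 0" 1] by (simp add: Q_def s_def)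
  have szero: "s a = 0" if "p = 0" for a
  proof (rule ccontr)
    assume ne: "s a \<noteq> 0"
    \<comment> \<open>Chosen so that \<open>t = - r * s a\<close> makes the cross term
      \<open>- 2 * (\<bar>Q a\<bar> + 1)\<close>, which outweighs \<open>Q a\<close>; the term in
      \<open>p\<close> is absent here.\<close>
    define r where "r = (\<bar>Q a\<bar> + 1) / (cmod (s a))\<^sup>2"
    have "cnj (- of_real r * s a) * s a = - of_real (r * (cmod (s a))\<^sup>2)"
      using complex_norm_square[of "s a"] by (simp add: mult.commute mult.left_commute)
    then have "Re (cnj (- of_real r * s a) * s a) = - (\<bar>Q a\<bar> + 1)"
      using ne by (simp add: r_def)
    then show False using quad[of a "- of_real r * s a"] that by simp
  qed
  \<comment> \<open>The value 0 for \<open>p = 0\<close> is correct: by \<open>szero\<close>, a zero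
    diagonal entry of a positive semidefinite matrix makes its whole row zero.\<close>
  define c where "c l = (if p = 0 then 0 else P l N / of_real (sqrt p))" for l
  have PlN: "P l N = c l * of_real (sqrt p)" if "l \<in> {1..N}" for l
  proof (cases "p = 0")
    case True
    show ?thesis
    proof (cases "l = N")
      case False
      then have l: "l \<in> {1..k}" using that by (auto simp: N_def)
      have "s (\<lambda>i. if i = l then 1 else 0) = P l N"
        unfolding s_def using l by (simp add: if_distrib[of "\<lambda>z. z * _"] sum.delta cong: if_cong)
      then show ?thesis using szero[OF True] True by (simp add: c_def)
    qed (use True pN in \<open>simp add: c_def\<close>)
  qed (simp add: c_def)
  have cN: "c N = of_real (sqrt p)"
    using real_div_sqrt[OF p0] by (simp add: c_def pN of_real_divide[symmetric] del: of_real_divide)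
  define P' where "P' l l' = P l l' - c l * cnj (c l')" for l l'
  have "\<exists>b. \<forall>l\<in>{1..k}. \<forall>l'\<in>{1..k}. P' l l' = (\<Sum>i=1..k. b l i * cnj (b l' i))"
  proof (rule Suc.IH)
    show "P' l' l = cnj (P' l l')" for l l' by (simp add: P'_def herm[of l' l])
    fix a :: "nat \<Rightarrow> complex"
    define u where "u = (\<Sum>l=1..k. a l * c l)"
    have su: "s a = u * of_real (sqrt p)"
      unfolding s_def u_def sum_distrib_right by (intro sum.cong refl) (use PlN in \<open>auto simp: N_def\<close>)
    have "(\<Sum>l=1..k. \<Sum>l'=1..k. a l * cnj (a l') * (c l * cnj (c l'))) = u * cnj u"
      unfolding u_def cnj_sum sum_product by (intro sum.cong refl) simp
    then have "(\<Sum>l=1..k. \<Sum>l'=1..k. a l * cnj (a l') * P' l l')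
       = (\<Sum>l=1..k. \<Sum>l'=1..k. a l * cnj (a l') * P l l') - u * cnj u"
      unfolding P'_def right_diff_distrib sum_subtractf by simp
    then have e: "Re (\<Sum>l=1..k. \<Sum>l'=1..k. a l * cnj (a l') * P' l l') = Q a - (cmod u)\<^sup>2"
      by (simp only: Q_def minus_complex.simps complex_norm_square[symmetric] Re_complex_of_real)
    show "0 \<le> Re (\<Sum>l=1..k. \<Sum>l'=1..k. a l * cnj (a l') * P' l l')"
    proof (cases "p = 0")
      case True
      then have "u = 0" by (simp add: u_def c_def)
      then show ?thesis unfolding e using quad[of a 0] by simp
    next
      case False
      \<comment> \<open>The minimizer of the form in its last coordinate. The minimum is
        \<open>Q a - (cmod u)\<^sup>2\<close>, the form of the Schur complement
        \<open>P'\<close>.\<close>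
      define t where "t = - u / of_real (sqrt p)"
      have "cnj t * s a = - of_real ((cmod u)\<^sup>2)"
        unfolding t_def su using False complex_norm_square[of u] by (simp add: mult.commute)
      moreover have "(cmod t)\<^sup>2 * p = (cmod u)\<^sup>2"
        using False p0 by (simp add: t_def norm_divide power_divide)
      ultimately show ?thesis unfolding e using quad[of a t] by simp
    qed
  qed
  then obtain b where b: "\<And>l l'. l \<in> {1..k} \<Longrightarrow> l' \<in> {1..k} \<Longrightarrow> P' l l' = (\<Sum>i=1..k. b l i * cnj (b l' i))"
    by blast
  \<comment> \<open>Column \<open>N\<close> carries the split-off factor \<open>c\<close>; row
    \<open>N\<close> has no other entry because \<open>P'\<close> vanishes there.\<close>
  define b' where "b' l i = (if i = N then c l else if l = N then 0 else b l i)" for l i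
  have zero: "P' l N = 0" "P' N l = 0" if "l \<in> {1..N}" for l
    using PlN[OF that] herm[of N l] by (simp_all add: P'_def cN)
  have "P l l' = (\<Sum>i=1..N. b' l i * cnj (b' l' i))" if l: "l \<in> {1..N}" "l' \<in> {1..N}" for l l'
  proof -
    have "(\<Sum>i=1..N. b' l i * cnj (b' l' i)) = (\<Sum>i=1..k. b' l i * cnj (b' l' i)) + c l * cnj (c l')"
      by (simp add: N_def b'_def)
    also have "(\<Sum>i=1..k. b' l i * cnj (b' l' i)) = P' l l'"
    proof (cases "l = N \<or> l' = N")
      case True
      then have "(\<Sum>i=1..k. b' l i * cnj (b' l' i)) = 0"
        by (intro sum.neutral) (auto simp: b'_def N_def)
      then show ?thesis using zero l True by auto
    next
      case False
      then have "l \<in> {1..k}" "l' \<in> {1..k}" using l by (auto simp: N_def)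
      then show ?thesis unfolding b[OF \<open>l \<in> {1..k}\<close> \<open>l' \<in> {1..k}\<close>]
        by (intro sum.cong refl) (auto simp: b'_def N_def)
    qed
    finally show ?thesis by (simp add: P'_def)
  qed
  then show ?case unfolding N_def by blast
qed

section \<open>The closure of the joint numerical range\<close>

text \<open>Keeps index ranges in the form \<open>{1..k}\<close> in which the rewrite rules below are stated.\<close>

declare One_nat_def [simp del]

section \<open>Orthonormal families, projections and Bessel's inequality\<close>

lemma orthonormal_familyD:
  "orthonormal_family k x \<Longrightarrow> l \<in> {1..k} \<Longrightarrow> l' \<in> {1..k} \<Longrightarrow> cinner (x l) (x l') = (if l = l' then 1 else 0)"
  by (simp add: orthonormal_family_def)

lemma orthonormal_family_norm: "orthonormal_family k x \<Longrightarrow> l \<in> {1..k} \<Longrightarrow> norm (x l) = 1"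
  using orthonormal_familyD[of k x l l] by (simp add: norm_eq_sqrt_inner flip: Re_cinner)

lemma cinner_orthonormal_sum:
  assumes "orthonormal_family k e" "l \<in> {1..k}"
  shows "cinner (\<Sum>i=1..k. a i *\<^sub>C e i) (e l) = a l"
proof -
  have "cinner (\<Sum>i=1..k. a i *\<^sub>C e i) (e l) = (\<Sum>i=1..k. if i = l then a i else 0)"
    unfolding cinner.sum_left
    by (intro sum.cong refl) (use assms in \<open>auto simp: cinner_scaleC_left orthonormal_familyD\<close>)
  also have "\<dots> = a l" using assms(2) by simp
  finally show ?thesis .
qed

lemma cinner_orthonormal_sums:
  assumes "orthonormal_family k e"
  shows "cinner (\<Sum>i=1..k. a i *\<^sub>C e i) (\<Sum>i=1..k. b i *\<^sub>C e i) = (\<Sum>i=1..k. a i * cnj (b i))"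
  unfolding cinner.sum_right
  by (intro sum.cong refl) (simp add: cinner_scaleC_right cinner_orthonormal_sum[OF assms])

lemma norm_orthonormal_sum:
  assumes "orthonormal_family k e"
  shows "(norm (\<Sum>i=1..k. a i *\<^sub>C e i))\<^sup>2 = (\<Sum>i=1..k. (cmod (a i))\<^sup>2)"
  unfolding norm_power2_cinner[of "\<Sum>i=1..k. a i *\<^sub>C e i"] cinner_orthonormal_sums[OF assms] Re_sum
  by (simp add: complex_norm_square[symmetric] del: of_real_power)

lemma orthonormal_decomposition:
  fixes y :: "'a::complex_inner"
  assumes "orthonormal_family k e"
  defines "r \<equiv> y - (\<Sum>i=1..k. cinner y (e i) *\<^sub>C e i)"
  shows "r \<in> perp (e ` {1..k})"
    and "(norm y)\<^sup>2 = (\<Sum>i=1..k. (cmod (cinner y (e i)))\<^sup>2) + (norm r)\<^sup>2"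
proof -
  show perp: "r \<in> perp (e ` {1..k})"
    unfolding perp_def r_def
    by (auto simp: cinner.diff_left cinner_orthonormal_sum[OF assms(1)] simp del: atLeastAtMost_iff)
  define p where "p = (\<Sum>i=1..k. cinner y (e i) *\<^sub>C e i)"
  have "cinner r p = 0"
    unfolding p_def using perp by (auto simp: cinner.sum_right cinner_simps perp_def intro!: sum.neutral)
  then have "inner r p = 0" by (simp flip: Re_cinner)
  moreover have "y = r + p" by (simp add: r_def p_def)
  ultimately have "(norm y)\<^sup>2 = (norm r)\<^sup>2 + (norm p)\<^sup>2"
    by (simp add: norm_add_Pythagorean orthogonal_def)
  then show "(norm y)\<^sup>2 = (\<Sum>i=1..k. (cmod (cinner y (e i)))\<^sup>2) + (norm r)\<^sup>2"
    unfolding p_def norm_orthonormal_sum[OF assms(1)] by simp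
qed

lemma bessel:
  assumes "orthonormal_family k e"
  shows "(\<Sum>i=1..k. (cmod (cinner y (e i)))\<^sup>2) \<le> (norm y)\<^sup>2"
  using orthonormal_decomposition(2)[OF assms, of y] by simp

lemma orthonormal_family_Suc:
  assumes "orthonormal_family k e" "norm z = 1" "z \<in> perp (e ` {1..k})"
  shows "orthonormal_family (Suc k) (e(Suc k := z))"
proof -
  have "cinner z (e l) = 0" "cinner (e l) z = 0" if "l \<in> {1..k}" for l
    using assms(3) that by (auto simp: perp_def cinner_eq_zero_commute[of "e l"])
  moreover have "cinner z z = 1" using assms(2) by (simp add: cinner_self)
  ultimately show ?thesis
    using assms(1) unfolding orthonormal_family_def by (auto simp: le_Suc_eq)
qed

lemma orthonormal_sequence_exists:
  assumes "\<nexists>S :: 'a::complex_inner set. finite S \<and> cvec.span S = UNIV" "finite F"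
  shows "\<exists>u :: nat \<Rightarrow> 'a. (\<forall>n m. cinner (u n) (u m) = (if n = m then 1 else 0)) \<and> (\<forall>n. u n \<in> perp F)"
proof -
  have "\<exists>z::'a. finite G \<longrightarrow> norm z = 1 \<and> z \<in> perp G" for G
    using infinite_dim_unit_perp[OF assms(1)] by blast
  then obtain sel :: "'a set \<Rightarrow> 'a" where sel: "\<And>G. finite G \<Longrightarrow> norm (sel G) = 1 \<and> sel G \<in> perp G"
    by metis
  \<comment> \<open>\<open>T n\<close> collects \<open>F\<close> and all vectors chosen so far, so
    one orthogonality condition covers both requirements.\<close>
  define T where "T = rec_nat F (\<lambda>_ S. insert (sel S) S)"
  have T0: "T 0 = F" and TS: "\<And>n. T (Suc n) = insert (sel (T n)) (T n)" by (simp_all add: T_def)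
  have fin: "finite (T n)" for n by (induction n) (simp_all add: T0 TS assms(2))
  have mono: "T m \<subseteq> T n" if "m \<le> n" for m n using that by (rule lift_Suc_mono_le[rotated]) (auto simp: TS)
  define u where "u n = sel (T n)" for n
  have F: "u n \<in> perp F" for n
    using sel[OF fin, of n] mono[of 0 n] by (auto simp: u_def perp_def T0)
  have less: "cinner (u n) (u m) = 0" if "m < n" for m n
    using sel[OF fin, of n] mono[of "Suc m" n] that by (auto simp: u_def perp_def TS)
  have "cinner (u n) (u m) = (if n = m then 1 else 0)" for n m
    using less[of m n] less[of n m] sel[OF fin, of n]
    by (auto simp: cinner_self u_def cinner_eq_zero_commute[of "sel (T n)" "sel (T m)"] neq_iff)
  with F show ?thesis by blast
qed

text \<open>For \<open>a\<close> in \<open>complex^'m\<close>, the number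
  \<open>a \<bullet> qform A x\<close> is the real part of the quadratic form of the sum of the
  operators \<open>cnj (a $ j) *\<^sub>C A j\<close>. Real linear functionals on the range are thus
  quadratic forms.\<close>

definition qform :: "('m::finite \<Rightarrow> 'a::complex_inner \<Rightarrow> 'a) \<Rightarrow> 'a \<Rightarrow> complex^'m" where
  "qform A x = (\<chi> j. cinner (A j x) x)"

lemma joint_numerical_range_altdef:
  "joint_numerical_range k A = {\<Sum>l=1..k. qform A (x l) | x. orthonormal_family k x}"
  unfolding joint_numerical_range_def qform_def
  by (rule Collect_cong) (simp add: vec_eq_iff sum_component)

lemma joint_numerical_rangeI:
  "orthonormal_family k x \<Longrightarrow> (\<Sum>l=1..k. qform A (x l)) \<in> joint_numerical_range k A"
  unfolding joint_numerical_range_altdef by (intro CollectI exI conjI) (rule refl)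

text \<open>The Gram matrix is at most the identity, written as contractivity of the map from
  coefficients to linear combinations. In this form the property passes to weak limits by
  semicontinuity of the norm.\<close>

definition contractive_family :: "nat \<Rightarrow> (nat \<Rightarrow> 'a::complex_inner) \<Rightarrow> bool" where
  "contractive_family k x \<longleftrightarrow>
     (\<forall>a. (norm (\<Sum>l=1..k. a l *\<^sub>C x l))\<^sup>2 \<le> (\<Sum>l=1..k. (cmod (a l))\<^sup>2))"

lemma contractive_family_fst:
  assumes "orthonormal_family k w"
  shows "contractive_family k (\<lambda>l. fst (w l))"
  unfolding contractive_family_def
proof
  fix a
  have "fst (\<Sum>l=1..k. a l *\<^sub>C w l) = (\<Sum>l=1..k. a l *\<^sub>C fst (w l))"
    by (simp add: fst_sum scaleC_prod_def)
  then have "norm (\<Sum>l=1..k. a l *\<^sub>C fst (w l)) \<le> norm (\<Sum>l=1..k. a l *\<^sub>C w l)"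
    by (metis norm_fst_le prod.collapse)
  then have "(norm (\<Sum>l=1..k. a l *\<^sub>C fst (w l)))\<^sup>2 \<le> (norm (\<Sum>l=1..k. a l *\<^sub>C w l))\<^sup>2"
    by (simp add: power_mono)
  then show "(norm (\<Sum>l=1..k. a l *\<^sub>C fst (w l)))\<^sup>2 \<le> (\<Sum>l=1..k. (cmod (a l))\<^sup>2)"
    by (simp only: norm_orthonormal_sum[OF assms])
qed

text \<open>The rows of \<open>b\<close> are vectors whose Gram matrix is the defect of that of
  \<open>x\<close>. Both inclusions use them: in the zero summand to dilate \<open>x\<close>, and
  far out along an orthonormal sequence to imitate the zero summand.\<close>

lemma contractive_family_gram_complement:
  assumes "contractive_family k x"
  shows "\<exists>b. \<forall>l\<in>{1..k}. \<forall>l'\<in>{1..k}.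
    cinner (x l) (x l') + (\<Sum>i=1..k. b l i * cnj (b l' i)) = (if l = l' then 1 else 0)"
proof -
  define P where "P l l' = (if l = l' then 1 else 0) - cinner (x l) (x l')" for l l'
  have "\<exists>b. \<forall>l\<in>{1..k}. \<forall>l'\<in>{1..k}. P l l' = (\<Sum>i=1..k. b l i * cnj (b l' i))"
  proof (rule psd_kernel_gram)
    show "P l' l = cnj (P l l')" for l l'
      using cinner_commute[of "x l'" "x l"] by (simp add: P_def)
    fix a
    have "(\<Sum>l=1..k. \<Sum>l'=1..k. a l * cnj (a l') * cinner (x l) (x l')) =
        cinner (\<Sum>l=1..k. a l *\<^sub>C x l) (\<Sum>l=1..k. a l *\<^sub>C x l)"
      unfolding cinner.sum_left unfolding cinner.sum_right
      by (intro sum.cong refl) (simp add: cinner_simps)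
    moreover have "(\<Sum>l=1..k. \<Sum>l'=1..k. a l * cnj (a l') * (if l = l' then 1 else 0)) =
        (\<Sum>l=1..k. complex_of_real ((cmod (a l))\<^sup>2))"
      unfolding complex_norm_square
      by (intro sum.cong refl) (simp add: if_distrib[of "\<lambda>z. _ * z"] cong: if_cong)
    ultimately have "(\<Sum>l=1..k. \<Sum>l'=1..k. a l * cnj (a l') * P l l') =
        complex_of_real ((\<Sum>l=1..k. (cmod (a l))\<^sup>2) - (norm (\<Sum>l=1..k. a l *\<^sub>C x l))\<^sup>2)"
      unfolding P_def right_diff_distrib sum_subtractf cinner_self by simp
    then show "0 \<le> Re (\<Sum>l=1..k. \<Sum>l'=1..k. a l * cnj (a l') * P l l')"
      using assms unfolding contractive_family_def by simp
  qed
  then obtain b where b: "\<And>l l'. l \<in> {1..k} \<Longrightarrow> l' \<in> {1..k} \<Longrightarrow> P l l' = (\<Sum>i=1..k. b l i * cnj (b l' i))"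
    by blast
  show ?thesis
    by (intro exI[of _ b] ballI) (simp add: P_def flip: b)
qed

text \<open>The complementary rows have \<open>k\<close> entries each, so a second summand with
  \<open>k\<close> orthonormal vectors has room for them; hence \<open>0_k\<close> already gives the
  closure.\<close>

lemma contractive_family_dilation:
  fixes x :: "nat \<Rightarrow> 'a::complex_inner" and v :: "nat \<Rightarrow> 'c::complex_inner"
  assumes "contractive_family k x" "orthonormal_family k v"
  shows "\<exists>y. orthonormal_family k (\<lambda>l. (x l, y l :: 'c))"
proof -
  obtain b where b: "\<And>l l'. l \<in> {1..k} \<Longrightarrow> l' \<in> {1..k} \<Longrightarrow>
    cinner (x l) (x l') + (\<Sum>i=1..k. b l i * cnj (b l' i)) = (if l = l' then 1 else 0)"
    using contractive_family_gram_complement[OF assms(1)] by blast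
  have "orthonormal_family k (\<lambda>l. (x l, \<Sum>i=1..k. b l i *\<^sub>C v i))"
    unfolding orthonormal_family_def cinner_prod_def fst_conv snd_conv cinner_orthonormal_sums[OF assms(2)]
    using b by blast
  then show ?thesis by (rule exI[of _ "\<lambda>l. \<Sum>i=1..k. b l i *\<^sub>C v i"])
qed

text \<open>Lower semicontinuity of the norm: a linear combination is paired with its own weak limit
  \<open>z\<close>, and Cauchy-Schwarz bounds \<open>(norm z)\<^sup>2\<close> by
  \<open>sqrt s * norm z\<close>.\<close>

lemma contractive_family_weak_limit:
  assumes lim: "\<And>l y. ((\<lambda>i. cinner (f i l) y) \<longlongrightarrow> cinner (x l) y) G" and "G \<noteq> bot"
    and con: "\<And>i. contractive_family k (f i)"
  shows "contractive_family k x"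
  unfolding contractive_family_def
proof
  fix a
  define z where "z = (\<Sum>l=1..k. a l *\<^sub>C x l)"
  define s where "s = (\<Sum>l=1..k. (cmod (a l))\<^sup>2)"
  have s0: "0 \<le> s" by (simp add: s_def sum_nonneg)
  have "((\<lambda>i. cinner (\<Sum>l=1..k. a l *\<^sub>C f i l) z) \<longlongrightarrow> cinner z z) G"
    unfolding z_def cinner.sum_left cinner_scaleC_left by (intro tendsto_sum tendsto_mult tendsto_const lim)
  then have "((\<lambda>i. cmod (cinner (\<Sum>l=1..k. a l *\<^sub>C f i l) z)) \<longlongrightarrow> (norm z)\<^sup>2) G"
    using tendsto_norm[of _ "cinner z z"] by (simp add: cinner_self norm_power)
  moreover have "cmod (cinner (\<Sum>l=1..k. a l *\<^sub>C f i l) z) \<le> sqrt s * norm z" for i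
  proof -
    have "norm (\<Sum>l=1..k. a l *\<^sub>C f i l) \<le> sqrt s"
      using con[of i] unfolding contractive_family_def s_def by (simp add: real_le_rsqrt)
    then show ?thesis
      using cinner_cauchy_schwarz mult_right_mono norm_ge_zero order_trans by blast
  qed
  ultimately have "(norm z)\<^sup>2 \<le> sqrt s * norm z"
    using tendsto_upperbound[OF _ always_eventually \<open>G \<noteq> bot\<close>] by blast
  then have "norm z \<le> sqrt s"
    by (cases "z = 0") (auto simp: power2_eq_square s0)
  then have "(norm z)\<^sup>2 \<le> (sqrt s)\<^sup>2" by (simp add: power_mono)
  then show "(norm (\<Sum>l=1..k. a l *\<^sub>C x l))\<^sup>2 \<le> (\<Sum>l=1..k. (cmod (a l))\<^sup>2)"
    using s0 by (simp add: z_def s_def)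
qed

text \<open>In \<open>cinner (B j (f i)) (f i)\<close> the first argument converges in norm, so weak
  convergence of the bounded second argument is enough.\<close>

lemma tendsto_qform:
  fixes f :: "'i \<Rightarrow> 'h::complex_inner" and B :: "'m::finite \<Rightarrow> 'h \<Rightarrow> 'h"
  assumes lim: "\<And>y. ((\<lambda>i. cinner (f i) y) \<longlongrightarrow> cinner x y) G"
    and B: "\<And>j. ((\<lambda>i. B j (f i)) \<longlongrightarrow> B j x) G" and f: "\<And>i. norm (f i) \<le> 1"
  shows "((\<lambda>i. qform B (f i)) \<longlongrightarrow> qform B x) G"
  unfolding qform_def
proof (rule tendsto_vec_lambda)
  fix j
  have "((\<lambda>i. cinner (B j (f i) - B j x) (f i)) \<longlongrightarrow> 0) G"
  proof (rule Lim_null_comparison)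
    show "\<forall>\<^sub>F i in G. norm (cinner (B j (f i) - B j x) (f i)) \<le> norm (B j (f i) - B j x)"
    proof (intro always_eventually allI)
      fix i
      have "norm (cinner (B j (f i) - B j x) (f i)) \<le> norm (B j (f i) - B j x) * norm (f i)"
        by (rule cinner_cauchy_schwarz)
      also have "\<dots> \<le> norm (B j (f i) - B j x)" by (simp add: f mult_left_le)
      finally show "norm (cinner (B j (f i) - B j x) (f i)) \<le> norm (B j (f i) - B j x)" .
    qed
    show "((\<lambda>i. norm (B j (f i) - B j x)) \<longlongrightarrow> 0) G"
      using B[of j] tendsto_norm_zero LIM_zero by blast
  qed
  moreover have "((\<lambda>i. cinner (B j x) (f i)) \<longlongrightarrow> cinner (B j x) x) G"
    using tendsto_cnj[OF lim[of "B j x"]] by (simp flip: cinner_commute)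
  ultimately have "((\<lambda>i. cinner (B j (f i) - B j x) (f i) + cinner (B j x) (f i)) \<longlongrightarrow> 0 + cinner (B j x) x) G"
    by (rule tendsto_add)
  then show "((\<lambda>i. cinner (B j (f i)) (f i)) \<longlongrightarrow> cinner (B j x) x) G"
    by (simp add: cinner_simps)
qed

lemma orthonormal_imp_contractive: "orthonormal_family k x \<Longrightarrow> contractive_family k x"
  unfolding contractive_family_def by (simp add: norm_orthonormal_sum)

lemma contractive_family_cong:
  "(\<And>l. l \<in> {1..k} \<Longrightarrow> x l = y l) \<Longrightarrow> contractive_family k x = contractive_family k y"
  unfolding contractive_family_def by simp

lemma closure_joint_numerical_range_contractive:
  fixes A :: "'m::finite \<Rightarrow> 'a::chilbert_space \<Rightarrow> 'a"
  assumes cpt: "\<And>j. compact_operator (A j)" and p: "p \<in> closure (joint_numerical_range k A)"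
  shows "\<exists>x. contractive_family k x \<and> p = (\<Sum>l=1..k. qform A (x l))"
proof -
  obtain q where q: "\<And>n. q n \<in> joint_numerical_range k A" "q \<longlonglongrightarrow> p"
    using p unfolding closure_sequential by blast
  have "\<exists>x. orthonormal_family k x \<and> q n = (\<Sum>l=1..k. qform A (x l))" for n
    using q(1)[of n] unfolding joint_numerical_range_altdef by blast
  then obtain e where e: "\<And>n. orthonormal_family k (e n)" "\<And>n. q n = (\<Sum>l=1..k. qform A (e n l))" by metis
  \<comment> \<open>An orthonormal family is arbitrary outside \<open>{1..k}\<close>; zeros there
    give the uniform bound over all indices that \<open>weak_cluster_point\<close> requires.\<close>
  define f where "f n l = (if l \<in> {1..k} then e n l else 0)" for n l
  have f: "norm (f n l) \<le> 1" for n l using orthonormal_family_norm[OF e(1)] by (simp add: f_def)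
  obtain G x where G: "G \<le> sequentially" "G \<noteq> bot"
    and lim: "\<And>l y. ((\<lambda>i. cinner (f i l) y) \<longlongrightarrow> cinner (x l) y) G"
    and limA: "\<And>l j. ((\<lambda>i. A j (f i l)) \<longlongrightarrow> A j (x l)) G"
    using weak_cluster_point[where B=A and f=f, OF cpt sequentially_bot f] by blast
  have "contractive_family k (f n)" for n
    using orthonormal_imp_contractive[OF e(1), of n] by (subst contractive_family_cong[of k _ "e n"]) (simp_all add: f_def)
  then have "contractive_family k x" by (rule contractive_family_weak_limit[OF lim G(2)])
  moreover have "((\<lambda>n. \<Sum>l=1..k. qform A (f n l)) \<longlongrightarrow> (\<Sum>l=1..k. qform A (x l))) G"
    by (intro tendsto_sum tendsto_qform lim limA f)
  then have "(q \<longlongrightarrow> (\<Sum>l=1..k. qform A (x l))) G"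
    by (rule tendsto_cong[THEN iffD1, rotated]) (simp add: e(2) f_def)
  moreover have "(q \<longlongrightarrow> p) G" using q(2) G(1) by (rule tendsto_mono[rotated])
  ultimately show ?thesis using tendsto_unique[OF G(2)] by blast
qed

lemma qform_dsum_zero: "qform (A \<oplus> zero_tuple TYPE('c::complex_inner)) w = qform A (fst w)"
  by (simp add: qform_def tuple_dsum_def zero_tuple_def cinner_prod_def map_prod_def case_prod_beta cinner.zero_left)

lemma closure_joint_numerical_range_subset_dsum:
  fixes A :: "'m::finite \<Rightarrow> 'a::chilbert_space \<Rightarrow> 'a" and v :: "nat \<Rightarrow> 'c::complex_inner"
  assumes "\<And>j. compact_operator (A j)" "orthonormal_family k v"
  shows "closure (joint_numerical_range k A) \<subseteq> joint_numerical_range k (A \<oplus> zero_tuple TYPE('c))"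
proof
  fix p assume "p \<in> closure (joint_numerical_range k A)"
  then obtain x where x: "contractive_family k x" "p = (\<Sum>l=1..k. qform A (x l))"
    using closure_joint_numerical_range_contractive assms(1) by blast
  obtain y where "orthonormal_family k (\<lambda>l. (x l, y l :: 'c))"
    using contractive_family_dilation[OF x(1) assms(2)] by blast
  then show "p \<in> joint_numerical_range k (A \<oplus> zero_tuple TYPE('c))"
    unfolding joint_numerical_range_altdef qform_dsum_zero x(2)
    by (intro CollectI exI[of _ "\<lambda>l. (x l, y l)"]) simp
qed

section \<open>Weakly null sequences and the inclusion into the closure\<close>

lemma orthonormal_sequence_weakly_null:
  assumes "\<And>n m::nat. cinner (u n) (u m) = (if n = m then 1 else 0)"
  shows "(\<lambda>n. cinner (u n) y) \<longlonglongrightarrow> 0"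
proof -
  have on: "orthonormal_family k u" for k using assms by (simp add: orthonormal_family_def)
  have "summable (\<lambda>n. (cmod (cinner y (u (Suc n))))\<^sup>2)"
  proof (rule summableI_nonneg_bounded)
    fix n
    have "(\<Sum>i<n. (cmod (cinner y (u (Suc i))))\<^sup>2) = (\<Sum>i=1..n. (cmod (cinner y (u i)))\<^sup>2)"
      by (rule sum.reindex_bij_witness[of _ "\<lambda>i. i - 1" Suc]) auto
    then show "(\<Sum>i<n. (cmod (cinner y (u (Suc i))))\<^sup>2) \<le> (norm y)\<^sup>2" using bessel[OF on] by simp
  qed simp
  then have "(\<lambda>n. (cmod (cinner y (u (Suc n))))\<^sup>2) \<longlonglongrightarrow> 0" by (rule summable_LIMSEQ_zero)
  then have "(\<lambda>n. sqrt ((cmod (cinner y (u (Suc n))))\<^sup>2)) \<longlonglongrightarrow> 0"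
    using tendsto_real_sqrt by fastforce
  then have "(\<lambda>n. cinner y (u (Suc n))) \<longlonglongrightarrow> 0" by (simp add: tendsto_norm_zero_iff)
  then have "(\<lambda>n. cinner y (u n)) \<longlonglongrightarrow> 0" by (rule LIMSEQ_imp_Suc)
  then show ?thesis using tendsto_cnj by (force simp: cinner_commute[of "u _" y])
qed

lemma compact_operator_weakly_null:
  fixes T :: "'h::chilbert_space \<Rightarrow> 'h"
  assumes "compact_operator T" and u: "\<And>n::nat. norm (u n) \<le> 1" "\<And>y. (\<lambda>n. cinner (u n) y) \<longlonglongrightarrow> 0"
  shows "(\<lambda>n. T (u n)) \<longlonglongrightarrow> 0"
proof (rule ccontr)
  assume "\<not> ?thesis"
  then obtain d where d: "d > 0" "\<not> (\<forall>\<^sub>F n in sequentially. dist (T (u n)) 0 < d)"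
    unfolding tendsto_iff by blast
  \<comment> \<open>Restricted to the indices where the image stays at distance at least
    \<open>d\<close> from 0. A finer filter cannot leave them, although along \<open>G\<close> the
    images tend to 0.\<close>
  define F where "F = inf sequentially (principal {n. \<not> dist (T (u n)) 0 < d})"
  have "F \<noteq> bot"
    using d(2) unfolding F_def trivial_limit_def eventually_inf_principal by simp
  then obtain G x where G: "G \<le> F" "G \<noteq> bot"
    and lim: "\<And>y. ((\<lambda>n. cinner (u n) y) \<longlongrightarrow> cinner (x 0) y) G" and limT: "((\<lambda>n. T (u n)) \<longlongrightarrow> T (x 0)) G"
    using weak_cluster_point[where B="\<lambda>_::unit. T" and f="\<lambda>n _. u n" and F=F] assms(1) u(1) by blast
  have "G \<le> sequentially" using G(1) unfolding F_def by simp
  then have "((\<lambda>n. cinner (u n) y) \<longlongrightarrow> 0) G" for y using u(2) tendsto_mono by blast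
  then have "cinner (x 0) y = 0" for y using tendsto_unique[OF G(2) lim] by blast
  then have "x 0 = 0" by (rule cinner_ext)
  then have "T (x 0) = 0"
    using assms(1) by (simp add: compact_operator_clinear clinear_imp_linear linear_0)
  then have "\<forall>\<^sub>F n in G. dist (T (u n)) 0 < d" using limT d(1) unfolding tendsto_iff by auto
  moreover have "\<forall>\<^sub>F n in F. \<not> dist (T (u n)) 0 < d"
    unfolding F_def eventually_inf_principal by simp
  then have "\<forall>\<^sub>F n in G. \<not> dist (T (u n)) 0 < d" using G(1) unfolding le_filter_def by blast
  ultimately have "\<forall>\<^sub>F n in G. False" by eventually_elim blast
  then show False using G(2) by (simp add: trivial_limit_def)
qed

lemma clinear_sum_scaleC:
  assumes "clinear T"
  shows "T (\<Sum>i\<in>S. a i *\<^sub>C u i) = (\<Sum>i\<in>S. a i *\<^sub>C T (u i))"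
  by (simp add: linear_sum[OF clinear_imp_linear[OF assms]] clinear_scaleC[OF assms])

lemma tendsto_scaleC_zero:
  fixes f :: "'i \<Rightarrow> 'a::complex_inner"
  assumes "(f \<longlongrightarrow> 0) F"
  shows "((\<lambda>i. c *\<^sub>C f i) \<longlongrightarrow> 0) F"
proof -
  have "((\<lambda>i. cmod c * norm (f i)) \<longlongrightarrow> 0) F"
    using tendsto_mult_right_zero[OF tendsto_norm_zero[OF assms]] .
  then have "((\<lambda>i. norm (c *\<^sub>C f i)) \<longlongrightarrow> 0) F" by (simp add: norm_scaleC)
  then show ?thesis by (rule tendsto_norm_zero_cancel)
qed

text \<open>The second components of \<open>w\<close> are replaced by vectors \<open>v N l\<close>
  of the space itself with the complementary Gram matrix, taken orthogonal to all \<open>x l\<close>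
  along an orthonormal sequence. Shifting by \<open>N\<close> preserves orthonormality and sends
  their images to 0, so the zero summand is recovered in the limit.\<close>

lemma joint_numerical_range_dsum_subset_closure:
  fixes A :: "'m::finite \<Rightarrow> 'a::chilbert_space \<Rightarrow> 'a"
  assumes inf: "\<nexists>S :: 'a set. finite S \<and> cvec.span S = UNIV"
    and cpt: "\<And>j. compact_operator (A j)"
  shows "joint_numerical_range k (A \<oplus> zero_tuple TYPE('c::complex_inner)) \<subseteq> closure (joint_numerical_range k A)"
proof
  fix p assume "p \<in> joint_numerical_range k (A \<oplus> zero_tuple TYPE('c))"
  then obtain w :: "nat \<Rightarrow> 'a \<times> 'c" where w: "orthonormal_family k w" "p = (\<Sum>l=1..k. qform A (fst (w l)))"
    unfolding joint_numerical_range_altdef qform_dsum_zero by blast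
  define x where "x l = fst (w l)" for l
  obtain b where b: "\<And>l l'. l \<in> {1..k} \<Longrightarrow> l' \<in> {1..k} \<Longrightarrow>
    cinner (x l) (x l') + (\<Sum>i=1..k. b l i * cnj (b l' i)) = (if l = l' then 1 else 0)"
    using contractive_family_gram_complement[OF contractive_family_fst[OF w(1)]] unfolding x_def by blast
  obtain u :: "nat \<Rightarrow> 'a" where u: "\<And>n m. cinner (u n) (u m) = (if n = m then 1 else 0)" "\<And>n. u n \<in> perp (x ` {1..k})"
    using orthonormal_sequence_exists[OF inf finite_imageI[OF finite_atLeastAtMost], of x 1 k] by blast
  define v where "v N l = (\<Sum>i=1..k. b l i *\<^sub>C u (N + i))" for N l
  have onu: "orthonormal_family k (\<lambda>i. u (N + i))" for N using u(1) by (simp add: orthonormal_family_def)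
  have xv: "cinner (v N l') (x l) = 0" "cinner (x l) (v N l') = 0" if "l \<in> {1..k}" for l l' N
  proof -
    have "cinner (u (N + i)) (x l) = 0" for i using u(2) that by (simp add: perp_def)
    then show "cinner (v N l') (x l) = 0" by (simp add: v_def cinner.sum_left cinner_scaleC_left)
    then show "cinner (x l) (v N l') = 0" by (simp add: cinner_eq_zero_commute)
  qed
  have on: "orthonormal_family k (\<lambda>l. x l + v N l)" for N
    unfolding orthonormal_family_def
  proof (intro ballI)
    fix l l' assume l: "l \<in> {1..k}" "l' \<in> {1..k}"
    have "cinner (v N l) (v N l') = (\<Sum>i=1..k. b l i * cnj (b l' i))"
      unfolding v_def by (rule cinner_orthonormal_sums[OF onu])
    then show "cinner (x l + v N l) (x l' + v N l') = (if l = l' then 1 else 0)"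
      using b[OF l] xv[OF l(1)] xv[OF l(2)] by (simp add: cinner_simps)
  qed
  have wnull: "(\<lambda>n. cinner (u n) y) \<longlonglongrightarrow> 0" for y
    by (rule orthonormal_sequence_weakly_null[OF u(1)])
  have vnull: "(\<lambda>N. cinner (v N l) y) \<longlonglongrightarrow> 0" for l y
    unfolding v_def cinner.sum_left cinner_scaleC_left
    by (intro tendsto_null_sum tendsto_mult_right_zero LIMSEQ_ignore_initial_segment wnull)
  have "norm (u n) = 1" for n using u(1)[of n n] by (simp add: norm_eq_sqrt_inner flip: Re_cinner)
  then have Au: "(\<lambda>n. A j (u n)) \<longlonglongrightarrow> 0" for j
    by (intro compact_operator_weakly_null[OF cpt _ wnull]) simp
  have Av: "(\<lambda>N. A j (v N l)) \<longlonglongrightarrow> 0" for j l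
    unfolding v_def clinear_sum_scaleC[OF compact_operator_clinear[OF cpt]]
    by (intro tendsto_null_sum tendsto_scaleC_zero LIMSEQ_ignore_initial_segment Au)
  have "(\<lambda>N. qform A (x l + v N l)) \<longlonglongrightarrow> qform A (x l)" if l: "l \<in> {1..k}" for l
  proof (rule tendsto_qform)
    show "norm (x l + v N l) \<le> 1" for N using orthonormal_family_norm[OF on l] by simp
    show "(\<lambda>N. cinner (x l + v N l) y) \<longlonglongrightarrow> cinner (x l) y" for y
      using tendsto_add[OF tendsto_const vnull] by (simp add: cinner_simps)
    show "(\<lambda>N. A j (x l + v N l)) \<longlonglongrightarrow> A j (x l)" for j
      using tendsto_add[OF tendsto_const Av] by (simp add: clinear_add[OF compact_operator_clinear[OF cpt]])
  qed
  then have "(\<lambda>N. \<Sum>l=1..k. qform A (x l + v N l)) \<longlonglongrightarrow> (\<Sum>l=1..k. qform A (x l))"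
    by (intro tendsto_sum)
  moreover have "(\<Sum>l=1..k. qform A (x l + v N l)) \<in> joint_numerical_range k A" for N
    by (rule joint_numerical_rangeI[OF on])
  ultimately show "p \<in> closure (joint_numerical_range k A)"
    unfolding closure_sequential w(2) x_def[symmetric]
    by (intro exI[of _ "\<lambda>N. \<Sum>l=1..k. qform A (x l + v N l)"]) simp
qed

theorem closure_joint_numerical_range_eq_dsum:
  fixes A :: "'m::finite \<Rightarrow> 'a::chilbert_space \<Rightarrow> 'a" and v :: "nat \<Rightarrow> 'c::complex_inner"
  assumes "\<nexists>S :: 'a set. finite S \<and> cvec.span S = UNIV" "\<And>j. compact_operator (A j)"
    and "orthonormal_family k v"
  shows "closure (joint_numerical_range k A) = joint_numerical_range k (A \<oplus> zero_tuple TYPE('c))"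
  by (intro equalityI closure_joint_numerical_range_subset_dsum[where A=A, OF assms(2,3)]
    joint_numerical_range_dsum_subset_closure[where A=A, OF assms(1,2)])

lemma infinite_dim_orthonormal_family:
  assumes "\<nexists>S :: 'a::complex_inner set. finite S \<and> cvec.span S = UNIV"
  shows "\<exists>v :: nat \<Rightarrow> 'a. orthonormal_family k v"
proof -
  obtain v :: "nat \<Rightarrow> 'a" where "\<And>n m. cinner (v n) (v m) = (if n = m then 1 else 0)"
    using orthonormal_sequence_exists[OF assms finite.emptyI] by blast
  then have "orthonormal_family k v" unfolding orthonormal_family_def by blast
  then show ?thesis by blast
qed

lemma vec_orthonormal_family:
  "\<exists>v :: nat \<Rightarrow> complex^'k. orthonormal_family CARD('k) v"
proof -
  obtain h where h: "bij_betw h {1..CARD('k)} (UNIV :: 'k set)"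
    using ex_bij_betw_nat_finite_1[of "UNIV :: 'k set"] by auto
  have "cinner (axis i 1 :: complex^'k) (axis i' 1) = (if i = i' then 1 else 0)" for i i'
  proof -
    have "cinner (axis i 1 :: complex^'k) (axis i' 1) = (\<Sum>j\<in>UNIV. if j = i then (if i = i' then 1 else 0) else 0)"
      unfolding cinner_vec_def by (intro sum.cong refl) (auto simp: axis_def cinner_complex_def)
    then show ?thesis by simp
  qed
  then have "orthonormal_family CARD('k) (\<lambda>l. axis (h l) 1 :: complex^'k)"
    using inj_on_eq_iff[OF bij_betw_imp_inj_on[OF h]] by (simp add: orthonormal_family_def del: atLeastAtMost_iff)
  then show ?thesis by blast
qed

section \<open>Ky Fan's maximum principle\<close>

lemma qform_scaleC:
  assumes "\<And>j. clinear (B j)"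
  shows "qform B (c *\<^sub>C z) = (cmod c)\<^sup>2 *\<^sub>R qform B z"
proof -
  have "cnj c * (c * w) = (cmod c)\<^sup>2 *\<^sub>R w" for w
    using complex_norm_square[of c] by (simp add: scaleR_conv_of_real mult.assoc mult.commute mult.left_commute)
  then show ?thesis
    by (simp add: qform_def vec_eq_iff clinear_scaleC[OF assms] cinner_simps)
qed

lemma qform_scaleR:
  assumes "\<And>j. clinear (B j)"
  shows "qform B (r *\<^sub>R z) = r\<^sup>2 *\<^sub>R qform B z"
  using qform_scaleC[where c = "of_real r", OF assms] by (simp add: scaleC_of_real)

lemma norm_vec_le_sum: "norm (x :: 'a::real_normed_vector^'n) \<le> (\<Sum>i\<in>UNIV. norm (x $ i))"
  by (simp add: norm_vec_def L2_set_le_sum)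

lemma qform_bounded:
  fixes B :: "'m::finite \<Rightarrow> 'h::complex_inner \<Rightarrow> 'h"
  assumes "\<And>j. compact_operator (B j)"
  shows "\<exists>K. \<forall>z. norm z \<le> 1 \<longrightarrow> norm (qform B z) \<le> K"
proof -
  have "\<exists>K. \<forall>z. norm (B j z) \<le> norm z * K" for j
    using bounded_linear.bounded[OF compact_operator_bounded_linear[OF assms]] .
  then obtain K where K: "\<And>j z. norm (B j z) \<le> norm z * K j" by metis
  have "norm (qform B z) \<le> (\<Sum>j\<in>UNIV. \<bar>K j\<bar>)" if z: "norm z \<le> 1" for z
  proof -
    have "norm (qform B z $ j) \<le> \<bar>K j\<bar>" for j
    proof -
      have "norm (qform B z $ j) \<le> norm (B j z) * norm z"
        unfolding qform_def by (simp add: cinner_cauchy_schwarz)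
      also have "\<dots> \<le> norm (B j z)" using z by (simp add: mult_left_le)
      also have "\<dots> \<le> norm z * \<bar>K j\<bar>"
        using K[of j z] by (metis abs_ge_self mult_left_mono norm_ge_zero order_trans)
      also have "\<dots> \<le> \<bar>K j\<bar>" using z by (simp add: mult_left_le_one_le)
      finally show ?thesis .
    qed
    then have "(\<Sum>j\<in>UNIV. norm (qform B z $ j)) \<le> (\<Sum>j\<in>UNIV. \<bar>K j\<bar>)" by (rule sum_mono)
    then show ?thesis using norm_vec_le_sum[of "qform B z"] by linarith
  qed
  then show ?thesis by blast
qed

text \<open>The form is weakly continuous on bounded sets, so it has a maximizer on the unit ball of
  \<open>perp S\<close>, possibly of norm below 1. Homogeneity of degree 2 turns the bound on the
  ball into one for all \<open>z\<close>.\<close>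

lemma qform_max:
  fixes B :: "'m::finite \<Rightarrow> 'h::chilbert_space \<Rightarrow> 'h"
  assumes cpt: "\<And>j. compact_operator (B j)"
  shows "\<exists>x\<in>perp S. norm x \<le> 1 \<and> (\<forall>z\<in>perp S. a \<bullet> qform B z \<le> (a \<bullet> qform B x) * (norm z)\<^sup>2)"
proof -
  define V where "V = {a \<bullet> qform B z | z. z \<in> perp S \<and> norm z \<le> 1}"
  obtain K where K: "\<And>z. norm z \<le> 1 \<Longrightarrow> norm (qform B z) \<le> K" using qform_bounded[of B] cpt by blast
  have "a \<bullet> qform B z \<le> norm a * K" if "norm z \<le> 1" for z
    using norm_cauchy_schwarz[of a "qform B z"] K[OF that] by (meson mult_left_mono norm_ge_zero order_trans)
  then have bdd: "bdd_above V" unfolding V_def by (auto intro!: bdd_aboveI)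
  have ne: "V \<noteq> {}" unfolding V_def using perp_0[of S] by force
  define s where "s = Sup V"
  have "\<exists>z. z \<in> perp S \<and> norm z \<le> 1 \<and> s - 1 / Suc n < a \<bullet> qform B z" for n
  proof -
    have "s - 1 / Suc n < Sup V" by (simp add: s_def)
    then obtain v where "v \<in> V" "s - 1 / Suc n < v" using less_cSupD[OF ne] by blast
    then show ?thesis unfolding V_def by blast
  qed
  then obtain f where f: "\<And>n. f n \<in> perp S" "\<And>n. norm (f n) \<le> 1" "\<And>n. s - 1 / Suc n < a \<bullet> qform B (f n)"
    by metis
  obtain G and y :: "nat \<Rightarrow> 'h" where G: "G \<le> sequentially" "G \<noteq> bot"
    and lim: "\<And>l w. ((\<lambda>i. cinner (f i) w) \<longlongrightarrow> cinner (y l) w) G"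
    and limB: "\<And>l j. ((\<lambda>i. B j (f i)) \<longlongrightarrow> B j (y l)) G"
    using weak_cluster_point[where B=B and f="\<lambda>n _. f n", OF cpt sequentially_bot f(2)] by blast
  define x where "x = y 0"
  have limq: "((\<lambda>n. a \<bullet> qform B (f n)) \<longlongrightarrow> a \<bullet> qform B x) G"
    unfolding x_def by (intro tendsto_inner tendsto_const tendsto_qform lim limB f)
  have "((\<lambda>n. s - 1 / Suc n) \<longlongrightarrow> s - 0) G"
    using tendsto_mono[OF G(1) LIMSEQ_inverse_real_of_nat]
    by (intro tendsto_diff tendsto_const) (simp add: inverse_eq_divide)
  then have sx: "s \<le> a \<bullet> qform B x"
    using tendsto_le[OF G(2) limq] f(3) less_imp_le by (metis (no_types, lifting) diff_zero always_eventually)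
  have le: "a \<bullet> qform B z \<le> a \<bullet> qform B x" if "z \<in> perp S" "norm z \<le> 1" for z
  proof -
    have "a \<bullet> qform B z \<le> s" unfolding s_def by (rule cSup_upper) (use that bdd in \<open>auto simp: V_def\<close>)
    then show ?thesis using sx by simp
  qed
  have xS: "x \<in> perp S"
    unfolding perp_def
  proof safe
    fix v assume "v \<in> S"
    then have "(\<lambda>i. cinner (f i) v) = (\<lambda>i. 0)" using f(1) by (auto simp: perp_def)
    then show "cinner x v = 0" using tendsto_unique[OF G(2) lim[of v 0]] by (simp add: x_def)
  qed
  have x1: "norm x \<le> 1"
  proof -
    \<comment> \<open>A vector of norm at most 1 is a contractive family of size 1, so the result on
      weak limits of such families bounds \<open>norm x\<close>.\<close>
    have "contractive_family 1 (\<lambda>_. f n)" for n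
      unfolding contractive_family_def using f(2)[of n]
      by (simp add: norm_scaleC power_mult_distrib mult_left_le power_le_one)
    then have "contractive_family 1 (\<lambda>_. x)"
      using contractive_family_weak_limit[where f="\<lambda>n _. f n" and x="\<lambda>_. x", OF _ G(2)]
        lim[of _ 0] unfolding x_def by blast
    then have "(norm (\<Sum>l=1..(1::nat). (1::complex) *\<^sub>C x))\<^sup>2 \<le> (\<Sum>l=1..(1::nat). (cmod 1)\<^sup>2)"
      unfolding contractive_family_def by (rule spec[where x="\<lambda>_. 1"])
    then show ?thesis by (simp add: abs_square_le_1)
  qed
  have "a \<bullet> qform B z \<le> (a \<bullet> qform B x) * (norm z)\<^sup>2" if z: "z \<in> perp S" for z
  proof (cases "z = 0")
    case False
    have "a \<bullet> qform B (inverse (norm z) *\<^sub>R z) \<le> a \<bullet> qform B x"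
      by (rule le) (use z False in \<open>auto intro: perp_scaleR\<close>)
    also have "qform B (inverse (norm z) *\<^sub>R z) = (inverse (norm z))\<^sup>2 *\<^sub>R qform B z"
      by (intro qform_scaleR compact_operator_clinear cpt)
    finally show ?thesis using False by (simp add: field_simps power_divide)
  next
    case True
    have "qform B 0 = 0"
      using qform_scaleR[of B 0 0] compact_operator_clinear[OF cpt] by simp
    then show ?thesis using True by simp
  qed
  then show ?thesis using xS x1 by blast
qed

lemma linear_coeff_zero:
  fixes L M :: real
  assumes "\<And>t. 0 \<le> t * L + t\<^sup>2 * M"
  shows "L = 0"
proof (rule ccontr)
  assume ne: "L \<noteq> 0"
  \<comment> \<open>At \<open>t = - L / m\<close> the sum \<open>t * L + t\<^sup>2 * m\<close> is
    zero, and \<open>m\<close> exceeds \<open>\<bar>M\<bar>\<close> strictly.\<close>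
  define m where "m = \<bar>M\<bar> + 1"
  have m: "m > 0" by (simp add: m_def)
  define t where "t = - L / m"
  have "t * L + t\<^sup>2 * M \<le> t * L + t\<^sup>2 * \<bar>M\<bar>" by (simp add: mult_left_mono)
  also have "\<dots> < t * L + t\<^sup>2 * m" using ne m by (simp add: t_def m_def)
  also have "\<dots> = 0" using m by (simp add: t_def power2_eq_square)
  finally show False using assms[of t] by simp
qed

text \<open>First-order condition: the gap between \<open>r * (norm z)\<^sup>2\<close> and the form
  is nonnegative along \<open>x + t *\<^sub>R y\<close> and zero at \<open>t = 0\<close>, so its
  linear coefficient vanishes.\<close>

lemma qform_critical:
  fixes B :: "'m::finite \<Rightarrow> 'h::complex_inner \<Rightarrow> 'h"
  assumes B: "\<And>j. clinear (B j)" and x: "x \<in> perp S" and y: "y \<in> perp S"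
    and le: "\<And>z. z \<in> perp S \<Longrightarrow> a \<bullet> qform B z \<le> r * (norm z)\<^sup>2"
    and eq: "a \<bullet> qform B x = r * (norm x)\<^sup>2"
  shows "a \<bullet> (\<chi> j. cinner (B j x) y + cinner (B j y) x) = 2 * r * Re (cinner x y)"
proof -
  define P where "P = (\<chi> j. cinner (B j x) y + cinner (B j y) x)"
  have "0 \<le> t * (2 * r * Re (cinner x y) - a \<bullet> P) + t\<^sup>2 * (r * (norm y)\<^sup>2 - a \<bullet> qform B y)" for t
  proof -
    have "qform B (x + t *\<^sub>R y) = qform B x + t *\<^sub>R P + t\<^sup>2 *\<^sub>R qform B y"
      unfolding qform_def P_def vec_eq_iff
      by (simp add: clinear_add[OF B] linear_cmul[OF clinear_imp_linear[OF B]] cinner_simps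
          scaleR_conv_of_real[where 'a=complex] algebra_simps power2_eq_square)
    moreover have "(norm (x + t *\<^sub>R y))\<^sup>2 = (norm x)\<^sup>2 + 2 * t * Re (cinner x y) + t\<^sup>2 * (norm y)\<^sup>2"
      using dot_norm[of x "t *\<^sub>R y"] by (simp add: Re_cinner power_mult_distrib)
    moreover have "a \<bullet> qform B (x + t *\<^sub>R y) \<le> r * (norm (x + t *\<^sub>R y))\<^sup>2"
      using x y by (intro le perp_add perp_scaleR)
    ultimately show ?thesis using eq by (simp add: inner_simps algebra_simps)
  qed
  then show ?thesis using linear_coeff_zero unfolding P_def by fastforce
qed

text \<open>The second equation says that \<open>x\<close> is also an eigenvector of the adjoints, without presupposing
  that these exist; \<open>x = 0\<close> is allowed.\<close>

definition reducing_eigenvector ::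
    "('m::finite \<Rightarrow> 'a::complex_inner \<Rightarrow> 'a) \<Rightarrow> complex^'m \<Rightarrow> 'a \<Rightarrow> bool" where
  "reducing_eigenvector B \<mu> x \<longleftrightarrow>
     (\<forall>j y. cinner (B j x) y = \<mu> $ j * cinner x y \<and> cinner (B j y) x = \<mu> $ j * cinner y x)"

text \<open>This is all that the eigenvalue arguments use of the infinite-dimensional zero summand:
  orthogonally to any finite set there is a unit vector on which the operators and their quadratic
  forms vanish.\<close>

definition infinite_null :: "('m::finite \<Rightarrow> 'a::complex_inner \<Rightarrow> 'a) \<Rightarrow> bool" where
  "infinite_null B \<longleftrightarrow> (\<forall>F. finite F \<longrightarrow> (\<exists>z\<in>perp F. norm z = 1 \<and> reducing_eigenvector B 0 z))"

lemma qform_reducing: "reducing_eigenvector B \<mu> x \<Longrightarrow> qform B x = (norm x)\<^sup>2 *\<^sub>R \<mu>"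
  unfolding reducing_eigenvector_def qform_def vec_eq_iff by (simp add: cinner_self scaleR_conv_of_real[where 'a=complex])

text \<open>A maximizer on the ball is padded to norm 1 by a null vector orthogonal to it and to
  \<open>F\<close>. Since the null vector is reducing, no cross terms arise and the value is
  unchanged.\<close>

lemma qform_max_unit:
  fixes B :: "'m::finite \<Rightarrow> 'h::chilbert_space \<Rightarrow> 'h"
  assumes cpt: "\<And>j. compact_operator (B j)" and null: "infinite_null B" and F: "finite F"
  shows "\<exists>x\<in>perp F. norm x = 1 \<and> (\<forall>z\<in>perp F. a \<bullet> qform B z \<le> (a \<bullet> qform B x) * (norm z)\<^sup>2)"
proof -
  obtain x where x: "x \<in> perp F" "norm x \<le> 1"
    and max: "\<And>z. z \<in> perp F \<Longrightarrow> a \<bullet> qform B z \<le> (a \<bullet> qform B x) * (norm z)\<^sup>2"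
    using qform_max[of B F a] cpt by blast
  obtain z where z: "z \<in> perp (insert x F)" "norm z = 1" "reducing_eigenvector B 0 z"
    using null F unfolding infinite_null_def by (meson finite_insert)
  define s where "s = sqrt (1 - (norm x)\<^sup>2)"
  have s: "s\<^sup>2 = 1 - (norm x)\<^sup>2" using x(2) by (simp add: s_def abs_square_le_1)
  define x' where "x' = x + s *\<^sub>R z"
  have xz: "cinner z x = 0" "cinner x z = 0" using z(1) by (simp_all add: perp_def cinner_eq_zero_commute[of x])
  have "qform B x' = qform B x"
    using z(3) xz compact_operator_clinear[OF cpt] unfolding reducing_eigenvector_def qform_def vec_eq_iff x'_def
    by (simp add: clinear_add linear_cmul clinear_imp_linear cinner_simps)
  moreover have "(norm x')\<^sup>2 = 1"
  proof -
    have "inner x z = 0" using xz by (simp flip: Re_cinner)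
    then show ?thesis using dot_norm[of x "s *\<^sub>R z"] s z(2) by (simp add: x'_def power_mult_distrib)
  qed
  then have "norm x' = 1" by (simp add: power2_eq_1_iff) (smt (verit) norm_ge_zero)
  moreover have "x' \<in> perp F"
    unfolding x'_def using x(1) z(1) by (intro perp_add perp_scaleR) (auto simp: perp_def)
  ultimately show ?thesis using max by metis
qed

text \<open>Reducing eigenvectors decouple from their orthogonal complement, so the cross terms
  between projection and remainder are zero.\<close>

lemma qform_orthonormal_decomposition:
  fixes B :: "'m::finite \<Rightarrow> 'h::complex_inner \<Rightarrow> 'h"
  assumes B: "\<And>j. clinear (B j)" and e: "orthonormal_family n e"
    and red: "\<And>i. i \<in> {1..n} \<Longrightarrow> reducing_eigenvector B (\<mu> i) (e i)"
  shows "qform B x = (\<Sum>i=1..n. (cmod (cinner x (e i)))\<^sup>2 *\<^sub>R \<mu> i)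
    + qform B (x - (\<Sum>i=1..n. cinner x (e i) *\<^sub>C e i))"
  unfolding vec_eq_iff
proof
  fix j
  define p where "p = (\<Sum>i=1..n. cinner x (e i) *\<^sub>C e i)"
  define r where "r = x - p"
  have r: "r \<in> perp (e ` {1..n})"
    unfolding r_def p_def by (rule orthonormal_decomposition(1)[OF e])
  have "cinner (B j p) x = (\<Sum>i=1..n. (cmod (cinner x (e i)))\<^sup>2 *\<^sub>R (\<mu> i $ j))"
    unfolding p_def clinear_sum_scaleC[OF B] cinner.sum_left
  proof (intro sum.cong refl)
    fix i assume "i \<in> {1..n}"
    then have "cinner (B j (e i)) x = \<mu> i $ j * cnj (cinner x (e i))"
      using red unfolding reducing_eigenvector_def by (simp flip: cinner_commute)
    then show "cinner (cinner x (e i) *\<^sub>C B j (e i)) x = (cmod (cinner x (e i)))\<^sup>2 *\<^sub>R (\<mu> i $ j)"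
      using complex_norm_square[of "cinner x (e i)"]
      by (simp add: cinner_simps scaleR_conv_of_real mult.commute mult.left_commute)
  qed
  moreover have "cinner (B j r) p = 0"
    unfolding p_def cinner.sum_right
    by (intro sum.neutral ballI) (use r red in \<open>auto simp: perp_def cinner_simps reducing_eigenvector_def\<close>)
  moreover have "cinner (B j x) x = cinner (B j p) x + cinner (B j r) p + cinner (B j r) r"
    by (simp add: r_def cinner_simps linear_diff[OF clinear_imp_linear[OF B]])
  ultimately show "qform B x $ j = ((\<Sum>i=1..n. (cmod (cinner x (e i)))\<^sup>2 *\<^sub>R \<mu> i)
    + qform B (x - (\<Sum>i=1..n. cinner x (e i) *\<^sub>C e i))) $ j"
    unfolding p_def[symmetric] r_def[symmetric] by (simp add: qform_def sum_component)
qed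

lemma orthonormal_family_update:
  assumes "orthonormal_family k e" "norm z = 1" "z \<in> perp (e ` {1..k})"
  shows "orthonormal_family k (e(i := z))"
proof -
  have "cinner z (e l) = 0" "cinner (e l) z = 0" if "l \<in> {1..k}" for l
    using assms(3) that by (auto simp: perp_def cinner_eq_zero_commute[of "e l"])
  moreover have "cinner z z = 1" using assms(2) by (simp add: cinner_self)
  ultimately show ?thesis
    using assms(1) unfolding orthonormal_family_def by (simp del: atLeastAtMost_iff)
qed

lemma sum_fun_upd:
  fixes f :: "'a \<Rightarrow> 'b::ab_group_add" and k :: nat
  assumes "i \<in> {1..k}"
  shows "(\<Sum>l=1..k. f ((e(i := z)) l)) = (\<Sum>l=1..k. f (e l)) - f (e i) + f z"
  using sum.remove[of "{1..k}" i "\<lambda>l. f (e l)"] sum.remove[of "{1..k}" i "\<lambda>l. f ((e(i := z)) l)"] assms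
  by simp

text \<open>Exchange argument: \<open>v\<close> may replace \<open>e i\<close> in an optimal family,
  and the replacement cannot improve it.\<close>

lemma optimal_family_ge:
  fixes B :: "'m::finite \<Rightarrow> 'h::complex_inner \<Rightarrow> 'h"
  assumes e: "orthonormal_family n e"
    and red: "\<And>i. i \<in> {1..n} \<Longrightarrow> reducing_eigenvector B (\<mu> i) (e i)"
    and opt: "\<And>x. orthonormal_family n x \<Longrightarrow> a \<bullet> (\<Sum>l=1..n. qform B (x l)) \<le> a \<bullet> (\<Sum>i=1..n. \<mu> i)"
    and v: "v \<in> perp (e ` {1..n})" "norm v = 1" and i: "i \<in> {1..n}"
  shows "a \<bullet> qform B v \<le> a \<bullet> \<mu> i"
proof -
  have q: "qform B (e l) = \<mu> l" if "l \<in> {1..n}" for l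
    using qform_reducing[OF red[OF that]] orthonormal_family_norm[OF e that] by simp
  have "(\<Sum>l=1..n. qform B (e l)) = (\<Sum>l=1..n. \<mu> l)" by (intro sum.cong refl q)
  then have "a \<bullet> ((\<Sum>l=1..n. \<mu> l) - \<mu> i + qform B v) \<le> a \<bullet> (\<Sum>l=1..n. \<mu> l)"
    using opt[OF orthonormal_family_update[OF e v(2,1), of i]] sum_fun_upd[OF i, of "qform B" e v] q[OF i] by simp
  then show ?thesis by (simp add: inner_simps)
qed

text \<open>Greedy extension stays optimal. Each \<open>x l\<close> scores at most \<open>r\<close>
  plus the excesses \<open>a \<bullet> \<mu> i - r\<close> weighted by \<open>c l i\<close>. The
  excesses are nonnegative by the exchange argument, and by Bessel each one is collected at most
  once over all \<open>l\<close>.\<close>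

lemma optimal_family_step:
  fixes B :: "'m::finite \<Rightarrow> 'h::complex_inner \<Rightarrow> 'h"
  assumes B: "\<And>j. clinear (B j)" and e: "orthonormal_family n e"
    and red: "\<And>i. i \<in> {1..n} \<Longrightarrow> reducing_eigenvector B (\<mu> i) (e i)"
    and opt: "\<And>x. orthonormal_family n x \<Longrightarrow> a \<bullet> (\<Sum>l=1..n. qform B (x l)) \<le> a \<bullet> (\<Sum>i=1..n. \<mu> i)"
    and v: "v \<in> perp (e ` {1..n})" "norm v = 1"
    and top: "\<And>z. z \<in> perp (e ` {1..n}) \<Longrightarrow> a \<bullet> qform B z \<le> (a \<bullet> qform B v) * (norm z)\<^sup>2"
    and x: "orthonormal_family (Suc n) x"
  shows "a \<bullet> (\<Sum>l=1..Suc n. qform B (x l)) \<le> a \<bullet> ((\<Sum>i=1..n. \<mu> i) + qform B v)"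
proof -
  define r where "r = a \<bullet> qform B v"
  define c where "c l i = (cmod (cinner (x l) (e i)))\<^sup>2" for l i
  have "a \<bullet> qform B (x l) \<le> (\<Sum>i=1..n. c l i * (a \<bullet> \<mu> i - r)) + r" if l: "l \<in> {1..Suc n}" for l
  proof -
    define w where "w = x l - (\<Sum>i=1..n. cinner (x l) (e i) *\<^sub>C e i)"
    have w: "w \<in> perp (e ` {1..n})" "1 = (\<Sum>i=1..n. c l i) + (norm w)\<^sup>2"
      using orthonormal_decomposition[OF e, of "x l"] orthonormal_family_norm[OF x l] unfolding w_def c_def by auto
    have "qform B (x l) = (\<Sum>i=1..n. c l i *\<^sub>R \<mu> i) + qform B w"
      unfolding c_def w_def by (rule qform_orthonormal_decomposition[OF B e red])
    then have "a \<bullet> qform B (x l) = (\<Sum>i=1..n. c l i * (a \<bullet> \<mu> i)) + a \<bullet> qform B w"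
      by (simp add: inner_simps inner_sum_right)
    also have "a \<bullet> qform B w \<le> r * (norm w)\<^sup>2" unfolding r_def by (rule top[OF w(1)])
    also have "r * (norm w)\<^sup>2 = r - (\<Sum>i=1..n. c l i * r)"
    proof -
      have "(\<Sum>i=1..n. c l i) = 1 - (norm w)\<^sup>2" using w(2) by simp
      then have "(\<Sum>i=1..n. c l i * r) = (1 - (norm w)\<^sup>2) * r" by (simp only: sum_distrib_right[symmetric])
      then show ?thesis by (simp add: algebra_simps)
    qed
    finally show ?thesis by (simp add: sum_subtractf right_diff_distrib)
  qed
  then have "(\<Sum>l=1..Suc n. a \<bullet> qform B (x l)) \<le> (\<Sum>l=1..Suc n. (\<Sum>i=1..n. c l i * (a \<bullet> \<mu> i - r)) + r)"
    by (rule sum_mono)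
  also have "\<dots> = (\<Sum>i=1..n. (\<Sum>l=1..Suc n. c l i) * (a \<bullet> \<mu> i - r)) + Suc n * r"
    unfolding sum.distrib sum_distrib_right by (subst sum.swap) simp
  also have "(\<Sum>i=1..n. (\<Sum>l=1..Suc n. c l i) * (a \<bullet> \<mu> i - r)) \<le> (\<Sum>i=1..n. a \<bullet> \<mu> i - r)"
  proof (rule sum_mono)
    fix i assume i: "i \<in> {1..n}"
    have "(\<Sum>l=1..Suc n. c l i) \<le> 1"
      using bessel[OF x, of "e i"] orthonormal_family_norm[OF e i]
      unfolding c_def by (subst cinner_commute) simp
    moreover have "0 \<le> a \<bullet> \<mu> i - r" using optimal_family_ge[OF e red opt v i] by (simp add: r_def)
    ultimately show "(\<Sum>l=1..Suc n. c l i) * (a \<bullet> \<mu> i - r) \<le> a \<bullet> \<mu> i - r"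
      by (simp add: mult_left_le_one_le c_def sum_nonneg)
  qed
  also have "(\<Sum>i=1..n. a \<bullet> \<mu> i - r) + Suc n * r = (\<Sum>i=1..n. a \<bullet> \<mu> i) + r"
    by (simp add: sum_subtractf algebra_simps)
  finally show ?thesis unfolding r_def by (simp add: inner_sum_right inner_simps)
qed

section \<open>Polyhedral ranges force commuting normal operators\<close>

lemma inner_eq_zero_open:
  fixes d :: "'a::real_inner"
  assumes "open U" "U \<noteq> {}" "\<And>a. a \<in> U \<Longrightarrow> a \<bullet> d = 0"
  shows "d = 0"
proof -
  obtain a r where a: "a \<in> U" "r > 0" "\<And>b. dist b a < r \<Longrightarrow> b \<in> U"
    using assms(1,2) unfolding open_dist by (metis all_not_in_conv)
  show ?thesis
  proof (rule ccontr)
    assume "d \<noteq> 0"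
    define t where "t = r / (2 * norm d)"
    have "a + t *\<^sub>R d \<in> U" using a(2) \<open>d \<noteq> 0\<close> by (intro a(3)) (simp add: dist_norm t_def)
    then have "t * (d \<bullet> d) = 0" using assms(3) a(1) by (metis add_0 inner_add_left inner_scaleR_left)
    then show False using \<open>d \<noteq> 0\<close> a(2) by (simp add: t_def)
  qed
qed

text \<open>Locally the support function of a polytope is given by one vertex. The open set shrinks
  only when a new point is strictly better somewhere, and being strictly better is an open
  condition.\<close>

lemma finite_max_linear_open:
  fixes V :: "'a::real_inner set"
  assumes "finite V" "V \<noteq> {}" "open U" "U \<noteq> {}"
  shows "\<exists>v\<in>V. \<exists>U'\<subseteq>U. open U' \<and> U' \<noteq> {} \<and> (\<forall>a\<in>U'. \<forall>w\<in>V. a \<bullet> w \<le> a \<bullet> v)"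
  using assms(1,2)
proof (induction rule: finite_ne_induct)
  case (singleton v)
  then show ?case using assms(3,4) by auto
next
  case (insert w V)
  then obtain v U' where v: "v \<in> V" and U': "U' \<subseteq> U" "open U'" "U' \<noteq> {}" "\<And>a u. a \<in> U' \<Longrightarrow> u \<in> V \<Longrightarrow> a \<bullet> u \<le> a \<bullet> v"
    by blast
  show ?case
  proof (cases "\<exists>a\<in>U'. a \<bullet> v < a \<bullet> w")
    case True
    define U'' where "U'' = U' \<inter> {a. a \<bullet> v < a \<bullet> w}"
    have "open U''" unfolding U''_def by (intro open_Int U'(2) open_Collect_less continuous_intros)
    moreover have "\<forall>a\<in>U''. \<forall>u\<in>insert w V. a \<bullet> u \<le> a \<bullet> w"
      using U'(4) unfolding U''_def by fastforce
    moreover have "U'' \<noteq> {}" "U'' \<subseteq> U" using True U'(1) unfolding U''_def by auto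
    ultimately show ?thesis by blast
  next
    case False
    then have "\<forall>a\<in>U'. \<forall>u\<in>insert w V. a \<bullet> u \<le> a \<bullet> v" using U'(4) by force
    then show ?thesis using v U' by blast
  qed
qed

text \<open>For a single \<open>a\<close> the first-order condition is one real equation. Its
  validity on an open set of \<open>a\<close> makes it an equation between vectors, hence one for
  each operator \<open>B j\<close>.\<close>

lemma reducing_on_perp:
  fixes B :: "'m::finite \<Rightarrow> 'h::complex_inner \<Rightarrow> 'h"
  assumes B: "\<And>j. clinear (B j)" and x: "x \<in> perp S" and y: "y \<in> perp S" and U: "open U" "U \<noteq> {}"
    and le: "\<And>a z. a \<in> U \<Longrightarrow> z \<in> perp S \<Longrightarrow> a \<bullet> qform B z \<le> (a \<bullet> w) * (norm z)\<^sup>2"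
    and eq: "\<And>a. a \<in> U \<Longrightarrow> a \<bullet> qform B x = (a \<bullet> w) * (norm x)\<^sup>2"
  shows "cinner (B j x) y = w $ j * cinner x y \<and> cinner (B j y) x = w $ j * cinner y x"
proof -
  have key: "cinner (B j x) y + cinner (B j y) x = w $ j * (cinner x y + cinner y x)" if y: "y \<in> perp S" for y j
  proof -
    define d where "d = (\<chi> j. cinner (B j x) y + cinner (B j y) x) - (2 * Re (cinner x y)) *\<^sub>R w"
    have "a \<bullet> d = 0" if "a \<in> U" for a
      using qform_critical[OF B x y le[OF that] eq[OF that]] by (simp add: d_def inner_simps)
    then have "d = 0" by (rule inner_eq_zero_open[OF U])
    then have "d $ j = 0" by simp
    moreover have "complex_of_real (2 * Re (cinner x y)) = cinner x y + cinner y x"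
      using complex_add_cnj[of "cinner x y"] by (simp flip: cinner_commute)
    ultimately show ?thesis
      by (simp add: d_def scaleR_conv_of_real[where 'a=complex] mult.commute del: of_real_mult)
  qed
  \<comment> \<open>Replacing \<open>y\<close> by \<open>\<i> *\<^sub>C y\<close> flips the relative
    sign of the two terms, so their sum and their difference are both known.\<close>
  have "cinner (B j x) (\<i> *\<^sub>C y) + cinner (B j (\<i> *\<^sub>C y)) x = w $ j * (cinner x (\<i> *\<^sub>C y) + cinner (\<i> *\<^sub>C y) x)"
    by (rule key[OF perp_scaleC[OF y]])
  then have "\<i> * (cinner (B j y) x - cinner (B j x) y) = \<i> * (w $ j * (cinner y x - cinner x y))"
    by (simp add: clinear_scaleC[OF B] cinner_simps algebra_simps)
  then have "cinner (B j y) x - cinner (B j x) y = w $ j * (cinner y x - cinner x y)" by simp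
  with key[OF y, of j] show ?thesis by (auto simp: algebra_simps) (simp add: complex_eq_iff; linarith)+
qed

text \<open>The projection of \<open>y\<close> onto the span of the family pairs to zero with
  \<open>x\<close> and with its images, on either side, so testing on the complement
  suffices.\<close>

lemma reducing_extend:
  fixes B :: "'m::finite \<Rightarrow> 'h::complex_inner \<Rightarrow> 'h"
  assumes B: "\<And>j. clinear (B j)" and e: "orthonormal_family n e"
    and red: "\<And>i. i \<in> {1..n} \<Longrightarrow> reducing_eigenvector B (\<mu> i) (e i)"
    and x: "x \<in> perp (e ` {1..n})"
    and on: "\<And>j y. y \<in> perp (e ` {1..n}) \<Longrightarrow>
      cinner (B j x) y = w $ j * cinner x y \<and> cinner (B j y) x = w $ j * cinner y x"
  shows "reducing_eigenvector B w x"
  unfolding reducing_eigenvector_def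
proof (intro allI)
  fix j y
  define p where "p = (\<Sum>i=1..n. cinner y (e i) *\<^sub>C e i)"
  have r: "y - p \<in> perp (e ` {1..n})" unfolding p_def by (rule orthonormal_decomposition(1)[OF e])
  have xe: "cinner x (e i) = 0" "cinner (e i) x = 0" if "i \<in> {1..n}" for i
    using x that by (auto simp: perp_def cinner_eq_zero_commute[of "e i"])
  have "cinner (B j x) p = 0"
    unfolding p_def cinner.sum_right
    by (intro sum.neutral ballI) (use xe red in \<open>auto simp: cinner_simps reducing_eigenvector_def\<close>)
  moreover have "cinner (B j p) x = 0"
    unfolding p_def clinear_sum_scaleC[OF B] cinner.sum_left
    by (intro sum.neutral ballI) (use xe red in \<open>auto simp: cinner_simps reducing_eigenvector_def\<close>)
  moreover have "cinner x p = 0"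
    unfolding p_def cinner.sum_right by (intro sum.neutral ballI) (use xe in \<open>auto simp: cinner_simps\<close>)
  moreover have "cinner p x = 0"
    using \<open>cinner x p = 0\<close> by (simp add: cinner_eq_zero_commute)
  moreover have "B j (y - p) = B j y - B j p" by (simp add: linear_diff[OF clinear_imp_linear[OF B]])
  ultimately show "cinner (B j x) y = w $ j * cinner x y \<and> cinner (B j y) x = w $ j * cinner y x"
    using on[OF r, of j] by (simp add: cinner_simps)
qed

text \<open>The support function of a polytope is linear on a dense open set; there an eigenvector that is
  optimal for one functional is optimal for all functionals near it, and is therefore a common
  eigenvector.\<close>

lemma optimal_reducing_family_exists:
  fixes B :: "'m::finite \<Rightarrow> 'h::chilbert_space \<Rightarrow> 'h"
  assumes cpt: "\<And>j. compact_operator (B j)" and null: "infinite_null B"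
    and poly: "\<forall>k\<ge>1. polytope (convex hull joint_numerical_range k B)"
    and U: "open U" "U \<noteq> {}"
  shows "\<exists>U'\<subseteq>U. \<exists>e \<mu>. open U' \<and> U' \<noteq> {} \<and> orthonormal_family k e \<and>
    (\<forall>i\<in>{1..k}. reducing_eigenvector B (\<mu> i) (e i)) \<and>
    (\<forall>a\<in>U'. \<forall>x. orthonormal_family k x \<longrightarrow> a \<bullet> (\<Sum>l=1..k. qform B (x l)) \<le> a \<bullet> (\<Sum>i=1..k. \<mu> i))"
proof (induction k)
  case 0
  show ?case using U by (intro exI[of _ U]) (auto simp: orthonormal_family_def)
next
  case (Suc n)
  then obtain U' e \<mu> where U': "U' \<subseteq> U" "open U'" "U' \<noteq> {}" and e: "orthonormal_family n e"
    and red: "\<And>i. i \<in> {1..n} \<Longrightarrow> reducing_eigenvector B (\<mu> i) (e i)"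
    and opt: "\<And>a x. a \<in> U' \<Longrightarrow> orthonormal_family n x \<Longrightarrow> a \<bullet> (\<Sum>l=1..n. qform B (x l)) \<le> a \<bullet> (\<Sum>i=1..n. \<mu> i)"
    by (elim exE conjE) blast
  have B: "\<And>j. clinear (B j)" by (rule compact_operator_clinear[OF cpt])
  define E where "E = perp (e ` {1..n})"
  define W where "W = joint_numerical_range (Suc n) B"
  define m where "m = (\<Sum>i=1..n. \<mu> i)"
  have ext: "orthonormal_family (Suc n) (e(Suc n := z))" if "z \<in> E" "norm z = 1" for z
    using orthonormal_family_Suc[OF e] that unfolding E_def by blast
  have q: "qform B (e l) = \<mu> l" if "l \<in> {1..n}" for l
    using qform_reducing[OF red[OF that]] orthonormal_family_norm[OF e that] by simp
  have sum_ext: "(\<Sum>l=1..Suc n. qform B ((e(Suc n := z)) l)) = m + qform B z" for z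
  proof -
    have "(\<Sum>l=1..n. qform B ((e(Suc n := z)) l)) = m"
      unfolding m_def by (intro sum.cong refl) (use q in auto)
    then show ?thesis by simp
  qed
  have mem: "m + qform B z \<in> W" if "z \<in> E" "norm z = 1" for z
    using joint_numerical_rangeI[OF ext[OF that], of B] unfolding sum_ext W_def .
  obtain V where V: "finite V" "convex hull W = convex hull V"
    using poly[rule_format, of "Suc n"] unfolding polytope_def W_def by auto
  have maxE: "\<exists>x\<in>E. norm x = 1 \<and> (\<forall>z\<in>E. a \<bullet> qform B z \<le> (a \<bullet> qform B x) * (norm z)\<^sup>2)" for a
    unfolding E_def by (rule qform_max_unit[OF cpt null]) simp
  have "V \<noteq> {}"
  proof -
    obtain z where "z \<in> E" "norm z = 1" using maxE by blast
    then have "W \<noteq> {}" using mem by blast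
    then show ?thesis using V(2) by (metis convex_hull_eq_empty)
  qed
  then obtain v U'' where v: "v \<in> V" and U'': "U'' \<subseteq> U'" "open U''" "U'' \<noteq> {}"
    and vmax: "\<And>a u. a \<in> U'' \<Longrightarrow> u \<in> V \<Longrightarrow> a \<bullet> u \<le> a \<bullet> v"
    using finite_max_linear_open[OF V(1) _ U'(2,3)] by blast
  have hullV: "a \<bullet> p \<le> a \<bullet> v" if "a \<in> U''" "p \<in> W" for a p
  proof -
    have "convex hull V \<subseteq> {p. a \<bullet> p \<le> a \<bullet> v}"
      by (rule hull_minimal) (use vmax[OF that(1)] in \<open>auto simp: convex_halfspace_le\<close>)
    then show ?thesis using hull_inc[OF that(2), of convex] V(2) by auto
  qed
  have hullW: "a \<bullet> v \<le> c" if "\<And>p. p \<in> W \<Longrightarrow> a \<bullet> p \<le> c" for a c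
  proof -
    have "convex hull W \<subseteq> {p. a \<bullet> p \<le> c}"
      by (rule hull_minimal) (use that in \<open>auto simp: convex_halfspace_le\<close>)
    then show ?thesis using hull_inc[OF v, of convex] V(2) by auto
  qed
  \<comment> \<open>The candidate eigenvalue is read off from the polytopes: the vertex for
    \<open>Suc n\<close> minus the vertex sum for \<open>n\<close>.\<close>
  define w where "w = v - m"
  have le: "a \<bullet> qform B z \<le> (a \<bullet> w) * (norm z)\<^sup>2" if a: "a \<in> U''" and z: "z \<in> E" for a z
  proof -
    obtain x where x: "x \<in> E" "norm x = 1" "\<And>z. z \<in> E \<Longrightarrow> a \<bullet> qform B z \<le> (a \<bullet> qform B x) * (norm z)\<^sup>2"
      using maxE by blast
    have "a \<bullet> qform B x \<le> a \<bullet> w"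
      using hullV[OF a mem[OF x(1,2)]] by (simp add: w_def inner_simps)
    then have "(a \<bullet> qform B x) * (norm z)\<^sup>2 \<le> (a \<bullet> w) * (norm z)\<^sup>2" by (simp add: mult_right_mono)
    then show ?thesis using x(3)[OF z] by linarith
  qed
  obtain a0 where a0: "a0 \<in> U''" using U''(3) by blast
  obtain x where x: "x \<in> E" "norm x = 1" and top: "\<And>z. z \<in> E \<Longrightarrow> a0 \<bullet> qform B z \<le> (a0 \<bullet> qform B x) * (norm z)\<^sup>2"
    using maxE by blast
  \<comment> \<open>By Ky Fan the greedy family is optimal at \<open>a0\<close>, so the support
    function there does not exceed its value.\<close>
  have "a0 \<bullet> v \<le> a0 \<bullet> (m + qform B x)"
  proof (rule hullW)
    fix p assume "p \<in> W"
    then obtain y where y: "orthonormal_family (Suc n) y" "p = (\<Sum>l=1..Suc n. qform B (y l))"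
      unfolding W_def joint_numerical_range_altdef by blast
    have "a0 \<in> U'" using a0 U'' by blast
    show "a0 \<bullet> p \<le> a0 \<bullet> (m + qform B x)"
      unfolding y(2) m_def
      by (rule optimal_family_step[OF B e red opt[OF \<open>a0 \<in> U'\<close>] x(1)[unfolded E_def] x(2) top[unfolded E_def] y(1)])
  qed
  then have le0: "a0 \<bullet> w \<le> a0 \<bullet> qform B x" by (simp add: w_def inner_simps)
  \<comment> \<open>The functional sending \<open>a\<close> to
    \<open>a \<bullet> (w - qform B x)\<close> is nonnegative on the open set \<open>U''\<close> and
    at most 0 at \<open>a0\<close>; a linear functional with an interior minimum vanishes.\<close>
  have "w - qform B x = 0"
  proof (rule ccontr)
    assume ne: "w - qform B x \<noteq> 0"
    obtain r where r: "r > 0" "\<And>b. dist b a0 < r \<Longrightarrow> b \<in> U''"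
      using U''(2) a0 unfolding open_dist by blast
    define t where "t = r / (2 * norm (w - qform B x))"
    have "a0 - t *\<^sub>R (w - qform B x) \<in> U''"
      using r(1) ne by (intro r(2)) (simp add: dist_norm t_def)
    from le[OF this x(1)] have "0 \<le> (a0 - t *\<^sub>R (w - qform B x)) \<bullet> (w - qform B x)"
      by (simp add: x(2) inner_diff_right)
    then have "t * ((w - qform B x) \<bullet> (w - qform B x)) \<le> 0"
      using le0 by (simp add: inner_diff_left inner_diff_right algebra_simps)
    moreover have "t > 0" using r(1) ne by (simp add: t_def)
    moreover have "(w - qform B x) \<bullet> (w - qform B x) > 0" using ne by (simp only: inner_gt_zero_iff) simp
    ultimately show False by (meson mult_pos_pos not_less)
  qed
  then have wx: "w = qform B x" by simp
  have redx: "reducing_eigenvector B w x"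
  proof (rule reducing_extend[OF B e red])
    show "x \<in> perp (e ` {1..n})" using x(1) by (simp add: E_def)
    fix j y assume y: "y \<in> perp (e ` {1..n})"
    show "cinner (B j x) y = w $ j * cinner x y \<and> cinner (B j y) x = w $ j * cinner y x"
      by (rule reducing_on_perp[where B=B and j=j, OF B x(1)[unfolded E_def] y U''(2,3) le[unfolded E_def]]) (auto simp: wx x(2))
  qed
  define e' where "e' = e(Suc n := x)"
  define \<mu>' where "\<mu>' = \<mu>(Suc n := w)"
  have summ: "(\<Sum>i=1..Suc n. \<mu>' i) = v"
  proof -
    have "(\<Sum>i=1..n. \<mu>' i) = m" unfolding m_def by (intro sum.cong refl) (auto simp: \<mu>'_def)
    then show ?thesis by (simp add: \<mu>'_def w_def)
  qed
  have "\<forall>i\<in>{1..Suc n}. reducing_eigenvector B (\<mu>' i) (e' i)"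
    using red redx by (auto simp: e'_def \<mu>'_def le_Suc_eq)
  moreover have "\<forall>a\<in>U''. \<forall>x. orthonormal_family (Suc n) x \<longrightarrow> a \<bullet> (\<Sum>l=1..Suc n. qform B (x l)) \<le> a \<bullet> (\<Sum>i=1..Suc n. \<mu>' i)"
    unfolding summ using hullV joint_numerical_rangeI[of "Suc n" _ B] unfolding W_def by blast
  moreover have "orthonormal_family (Suc n) e'" unfolding e'_def by (rule ext[OF x])
  moreover have "U'' \<subseteq> U" using U' U'' by blast
  ultimately show ?case using U''(2,3) by blast
qed

text \<open>Compactness gives finite nets for the images of the unit ball. In a long family two
  members \<open>e i\<close> and \<open>e i'\<close> have close images under every
  \<open>B j\<close>, and pairing the difference with \<open>e i\<close> isolates the eigenvalue
  \<open>\<mu> i\<close>.\<close>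

lemma no_large_reducing_families:
  fixes B :: "'m::finite \<Rightarrow> 'h::chilbert_space \<Rightarrow> 'h"
  assumes cpt: "\<And>j. compact_operator (B j)" and eps: "\<epsilon> > 0"
  shows "\<exists>k. \<forall>e \<mu>. orthonormal_family k e \<longrightarrow> (\<forall>i\<in>{1..k}. reducing_eigenvector B (\<mu> i) (e i)) \<longrightarrow>
    (\<exists>i\<in>{1..k}. norm (\<mu> i) < \<epsilon>)"
proof -
  \<comment> \<open>Images sharing a centre are less than \<open>2 * r\<close> apart, and
    \<open>2 * r\<close> summed over the coordinates is \<open>\<epsilon>\<close>.\<close>
  define r where "r = \<epsilon> / (2 * CARD('m))"
  have r: "r > 0" using eps by (simp add: r_def)
  have "\<exists>T. finite T \<and> closure (B j ` cball 0 1) \<subseteq> (\<Union>c\<in>T. ball c r)" for j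
  proof -
    have "compact (closure (B j ` cball 0 1))" using cpt by (simp add: compact_operator_def)
    from seq_compact_imp_totally_bounded[OF compact_imp_seq_compact[OF this]] r show ?thesis by blast
  qed
  then obtain T where T: "\<And>j. finite (T j)" "\<And>j. closure (B j ` cball 0 1) \<subseteq> (\<Union>c\<in>T j. ball c r)" by metis
  \<comment> \<open>One more index than there are ways to choose a centre for every
    \<open>j\<close>.\<close>
  define k where "k = Suc (card (PiE UNIV T))"
  have fin: "finite (PiE UNIV T)" by (intro finite_PiE) (use T in auto)
  have "\<exists>i\<in>{1..k}. norm (\<mu> i) < \<epsilon>"
    if e: "orthonormal_family k e" and red: "\<forall>i\<in>{1..k}. reducing_eigenvector B (\<mu> i) (e i)" for e \<mu>
  proof -
    have "\<exists>c\<in>T j. dist c (B j (e i)) < r" if "i \<in> {1..k}" for i j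
    proof -
      have "B j (e i) \<in> B j ` cball 0 1" using orthonormal_family_norm[OF e that] by simp
      then have "B j (e i) \<in> (\<Union>c\<in>T j. ball c r)" by (rule subsetD[OF T(2) subsetD[OF closure_subset]])
      then show ?thesis unfolding UN_iff mem_ball .
    qed
    then obtain c where c: "\<And>i j. i \<in> {1..k} \<Longrightarrow> c i j \<in> T j \<and> dist (c i j) (B j (e i)) < r" by metis
    have "\<not> inj_on c {1..k}"
    proof
      assume "inj_on c {1..k}"
      then have "card {1..k} \<le> card (PiE UNIV T)"
        using c by (intro card_inj_on_le[OF _ _ fin]) (auto simp: PiE_iff)
      then show False by (simp add: k_def)
    qed
    then obtain i i' where i: "i \<in> {1..k}" "i' \<in> {1..k}" "i \<noteq> i'" "c i = c i'" unfolding inj_on_def by blast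
    have "norm (\<mu> i $ j) < 2 * r" for j
    proof -
      have "cinner (B j (e i) - B j (e i')) (e i) = \<mu> i $ j"
        using red i e by (simp add: cinner_simps reducing_eigenvector_def orthonormal_familyD)
      then have "norm (\<mu> i $ j) \<le> norm (B j (e i) - B j (e i'))"
        using cinner_cauchy_schwarz[of "B j (e i) - B j (e i')" "e i"] orthonormal_family_norm[OF e i(1)] by simp
      also have "\<dots> \<le> dist (c i j) (B j (e i)) + dist (c i' j) (B j (e i'))"
        unfolding i(4) by (metis dist_norm dist_triangle3)
      also have "\<dots> < 2 * r" using c i by (smt (verit))
      finally show ?thesis .
    qed
    then have "(\<Sum>j\<in>UNIV. norm (\<mu> i $ j)) < (\<Sum>j\<in>(UNIV::'m set). 2 * r)" by (intro sum_strict_mono) auto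
    also have "\<dots> = \<epsilon>" by (simp add: r_def)
    finally have "norm (\<mu> i) < \<epsilon>" using norm_vec_le_sum[of "\<mu> i"] by linarith
    then show ?thesis using i(1) by blast
  qed
  then show ?thesis by blast
qed

lemma polytope_imp_reducing_total:
  fixes B :: "'m::finite \<Rightarrow> 'h::chilbert_space \<Rightarrow> 'h"
  assumes cpt: "\<And>j. compact_operator (B j)" and null: "infinite_null B"
    and poly: "\<forall>k\<ge>1. polytope (convex hull joint_numerical_range k B)"
    and x: "x \<in> perp {u. \<exists>\<mu>. reducing_eigenvector B \<mu> u}"
  shows "x = 0"
proof -
  define R where "R = {u. \<exists>\<mu>. reducing_eigenvector B \<mu> u}"
  have B: "\<And>j. clinear (B j)" by (rule compact_operator_clinear[OF cpt])
  have q0: "qform B z = 0" if z: "z \<in> perp R" for z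
  proof (rule ccontr)
    assume ne: "qform B z \<noteq> 0"
    then have z0: "z \<noteq> 0" using qform_scaleR[where B=B and r=0 and z=z, OF B] by auto
    define y where "y = inverse (norm z) *\<^sub>R z"
    have y: "y \<in> perp R" "norm y = 1" using z0 z by (auto simp: y_def intro: perp_scaleR)
    have b0: "qform B y \<noteq> 0" using ne z0 by (simp add: y_def qform_scaleR[OF B])
    define b where "b = qform B y"
    \<comment> \<open>\<open>b\<close> lies in \<open>U\<close> because \<open>b \<bullet> b\<close>
      is \<open>2 * d\<close>. For \<open>a\<close> in \<open>U\<close>, an eigenvalue of norm below
      \<open>d / M\<close> scores less than \<open>d\<close>, hence less than \<open>y\<close>;
      exchanging its eigenvector for \<open>y\<close> would improve an optimal family.\<close>
    define d where "d = (norm b)\<^sup>2 / 2"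
    define M where "M = norm b + 1"
    define U where "U = {a. d < a \<bullet> b} \<inter> ball 0 M"
    have d: "d > 0" and M: "M > 0" using b0 by (auto simp: d_def M_def b_def add_nonneg_pos)
    have "b \<in> U" using b0 by (simp add: U_def d_def M_def b_def power2_norm_eq_inner)
    moreover have "open U" unfolding U_def by (intro open_Int open_ball open_Collect_less continuous_intros)
    ultimately have U: "open U" "U \<noteq> {}" by auto
    obtain k where k: "\<And>e \<mu>. orthonormal_family k e \<Longrightarrow> (\<forall>i\<in>{1..k}. reducing_eigenvector B (\<mu> i) (e i)) \<Longrightarrow>
        (\<exists>i\<in>{1..k}. norm (\<mu> i) < d / M)"
      using no_large_reducing_families[where B=B, OF cpt divide_pos_pos[OF d M]] by blast
    obtain U' e \<mu> where U': "U' \<subseteq> U" "U' \<noteq> {}" and e: "orthonormal_family k e"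
      and red: "\<And>i. i \<in> {1..k} \<Longrightarrow> reducing_eigenvector B (\<mu> i) (e i)"
      and opt: "\<And>a x. a \<in> U' \<Longrightarrow> orthonormal_family k x \<Longrightarrow> a \<bullet> (\<Sum>l=1..k. qform B (x l)) \<le> a \<bullet> (\<Sum>i=1..k. \<mu> i)"
      using optimal_reducing_family_exists[where B=B and k=k, OF cpt null poly U] by (elim exE conjE) blast
    obtain a where a: "a \<in> U'" using U'(2) by blast
    obtain i where i: "i \<in> {1..k}" "norm (\<mu> i) < d / M" using k[OF e] red by blast
    have yp: "y \<in> perp (e ` {1..k})" using y(1) red unfolding perp_def R_def by blast
    have "a \<bullet> qform B y \<le> a \<bullet> \<mu> i" by (rule optimal_family_ge[OF e red opt[OF a] yp y(2) i(1)])
    moreover have "d < a \<bullet> qform B y" "norm a < M" using a U'(1) by (auto simp: U_def b_def)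
    moreover have "a \<bullet> \<mu> i \<le> norm a * norm (\<mu> i)" by (rule norm_cauchy_schwarz)
    moreover have "norm a * norm (\<mu> i) \<le> M * (d / M)"
      using i(2) \<open>norm a < M\<close> M by (intro mult_mono) auto
    ultimately show False using M by simp
  qed
  have xR: "x \<in> perp R" using x by (simp add: R_def)
  \<comment> \<open>The forms vanish on \<open>perp R\<close>, so every functional attains its bound
    \<open>r = 0\<close> at \<open>x\<close>, and the open set can be the whole space.\<close>
  have zero: "cinner (B j x) y = 0 \<and> cinner (B j y) x = 0" if "y \<in> perp R" for y j
    using reducing_on_perp[where B=B and w=0 and U=UNIV and j=j, OF B xR that] q0 xR by simp
  define adj where "adj j = cadjoint (B j)" for j
  have adj: "cinner (B j u) v = cinner u (adj j v)" for j u v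
    unfolding adj_def by (intro cinner_cadjoint compact_operator_bounded_linear cpt B)
  \<comment> \<open>\<open>perp R\<close> is invariant under \<open>B j\<close>, so
    \<open>zero\<close> may be applied to \<open>B j x\<close> itself.\<close>
  have Bx: "B j x = 0" for j
  proof -
    have "B j x \<in> perp R"
      using xR unfolding perp_def R_def reducing_eigenvector_def
      by auto (metis adj cinner_commute cinner_eq_zero_commute mult_zero_right)
    then show ?thesis using zero[of "B j x" j] by simp
  qed
  \<comment> \<open>Likewise for the adjoint, with \<open>y = adj j x\<close>. Then \<open>x\<close>
    is reducing with eigenvalue 0, so it belongs to both \<open>R\<close> and
    \<open>perp R\<close>.\<close>
  have Ax: "adj j x = 0" for j
  proof -
    have "cinner (adj j x) u = 0" if uR: "u \<in> R" for u
    proof -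
      obtain \<mu> where "reducing_eigenvector B \<mu> u" using uR by (auto simp: R_def)
      then have "cinner (B j u) x = \<mu> $ j * cinner u x" by (simp add: reducing_eigenvector_def)
      moreover have "cinner u x = 0" using xR uR by (simp add: perp_def cinner_eq_zero_commute[of u])
      ultimately show ?thesis by (simp add: adj cinner_eq_zero_commute[of "adj j x"])
    qed
    then have "cinner (B j (adj j x)) x = 0" using zero by (simp add: perp_def)
    then show ?thesis by (simp add: adj)
  qed
  have "reducing_eigenvector B 0 x"
    unfolding reducing_eigenvector_def by (simp add: Bx adj Ax cinner.zero_left cinner.zero_right)
  then have "x \<in> R" by (auto simp: R_def)
  then show "x = 0" using xR by (auto simp: perp_def)
qed

lemma reducing_eigenvector_imp_eigen:
  assumes "reducing_eigenvector B \<mu> u"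
  shows "B j u = \<mu> $ j *\<^sub>C u"
  by (rule cinner_eqI) (use assms in \<open>simp add: reducing_eigenvector_def cinner_scaleC_left\<close>)

text \<open>Commutators are tested against reducing eigenvectors. On these all operators and
  adjoints act as scalars, and by totality only 0 is orthogonal to all of them.\<close>

lemma polytope_imp_commuting_normal:
  fixes B :: "'m::finite \<Rightarrow> 'h::chilbert_space \<Rightarrow> 'h"
  assumes cpt: "\<And>j. compact_operator (B j)" and null: "infinite_null B"
    and poly: "\<forall>k\<ge>1. polytope (convex hull joint_numerical_range k B)"
  shows "B i \<circ> B j = B j \<circ> B i" and "normal_operator (B j)"
proof -
  have B: "\<And>j. clinear (B j)" by (rule compact_operator_clinear[OF cpt])
  define adj where "adj j = cadjoint (B j)" for j
  have adj: "cinner (B j u) v = cinner u (adj j v)" for j u v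
    unfolding adj_def by (intro cinner_cadjoint compact_operator_bounded_linear cpt B)
  have adj': "cinner (adj j u) v = cinner u (B j v)" for j u v
    by (metis adj cinner_commute)
  have sc: "B j (c *\<^sub>C u) = c *\<^sub>C B j u" for j c u by (rule clinear_scaleC[OF B])
  have ev: "B j u = \<mu> $ j *\<^sub>C u" "adj j u = cnj (\<mu> $ j) *\<^sub>C u" if "reducing_eigenvector B \<mu> u" for \<mu> u j
  proof -
    show "B j u = \<mu> $ j *\<^sub>C u" by (rule reducing_eigenvector_imp_eigen[OF that])
    have "cinner v (adj j u) = cinner v (cnj (\<mu> $ j) *\<^sub>C u)" for v
      using that by (simp add: reducing_eigenvector_def cinner_scaleC_right flip: adj)
    then show "adj j u = cnj (\<mu> $ j) *\<^sub>C u" by (metis cinner_commute cinner_eqI)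
  qed
  have total: "v = 0" if "\<And>\<mu> u. reducing_eigenvector B \<mu> u \<Longrightarrow> cinner v u = 0" for v
    by (rule polytope_imp_reducing_total[where B=B, OF cpt null poly]) (use that in \<open>auto simp: perp_def\<close>)
  have "B i (B j x) - B j (B i x) = 0" for x
  proof (rule total)
    fix \<mu> u assume u: "reducing_eigenvector B \<mu> u"
    show "cinner (B i (B j x) - B j (B i x)) u = 0"
      by (simp add: cinner.diff_left adj ev[OF u] cinner_simps)
  qed
  then show "B i \<circ> B j = B j \<circ> B i" by (auto simp: fun_eq_iff)
  have "B j (adj j x) - adj j (B j x) = 0" for x
  proof (rule total)
    fix \<mu> u assume u: "reducing_eigenvector B \<mu> u"
    show "cinner (B j (adj j x) - adj j (B j x)) u = 0"
      by (simp add: cinner.diff_left adj adj' ev[OF u] cinner_simps)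
  qed
  then show "normal_operator (B j)" unfolding normal_operator_def adj_def by (auto simp: fun_eq_iff)
qed

section \<open>Joint eigenvectors of commuting normal compact operators\<close>

text \<open>An eigenvector of a normal operator is thereby an eigenvector of the adjoint, for the
  conjugate eigenvalue.\<close>

lemma normal_norm_eq:
  fixes T :: "'h::chilbert_space \<Rightarrow> 'h"
  assumes cpt: "compact_operator T" and normal: "normal_operator T"
  shows "norm (T x - \<mu> *\<^sub>C x) = norm (cadjoint T x - cnj \<mu> *\<^sub>C x)"
proof -
  have adj: "cinner (T u) v = cinner u (cadjoint T v)" for u v
    by (intro cinner_cadjoint compact_operator_bounded_linear compact_operator_clinear cpt)
  have adj': "cinner (cadjoint T u) v = cinner u (T v)" for u v
    by (metis adj cinner_commute)
  have comm: "T (cadjoint T u) = cadjoint T (T u)" for u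
    using normal unfolding normal_operator_def by (metis comp_apply)
  have "cinner (T x) (T x) = cinner (cadjoint T x) (cadjoint T x)"
    by (simp add: adj adj' comm)
  then have "cinner (T x - \<mu> *\<^sub>C x) (T x - \<mu> *\<^sub>C x) = cinner (cadjoint T x - cnj \<mu> *\<^sub>C x) (cadjoint T x - cnj \<mu> *\<^sub>C x)"
    by (simp add: cinner_simps adj[of x x] adj'[of x x] algebra_simps)
  then have "(norm (T x - \<mu> *\<^sub>C x))\<^sup>2 = (norm (cadjoint T x - cnj \<mu> *\<^sub>C x))\<^sup>2"
    by (simp add: norm_power2_cinner)
  then show ?thesis by (simp add: power2_eq_iff_nonneg)
qed

lemma common_eigenvector_imp_reducing:
  fixes B :: "'m::finite \<Rightarrow> 'h::chilbert_space \<Rightarrow> 'h"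
  assumes cpt: "\<And>j. compact_operator (B j)" and normal: "\<And>j. normal_operator (B j)"
    and x: "common_eigenvector B \<mu> x"
  shows "reducing_eigenvector B \<mu> x"
  unfolding reducing_eigenvector_def
proof (intro allI)
  fix j y
  have Bx: "B j x = \<mu> $ j *\<^sub>C x" using x by (simp add: common_eigenvector_def)
  then have "cadjoint (B j) x = cnj (\<mu> $ j) *\<^sub>C x"
    using normal_norm_eq[OF cpt normal, of j x "\<mu> $ j"] by simp
  moreover have "cinner (B j y) x = cinner y (cadjoint (B j) x)"
    by (intro cinner_cadjoint compact_operator_bounded_linear compact_operator_clinear cpt)
  ultimately show "cinner (B j x) y = \<mu> $ j * cinner x y \<and> cinner (B j y) x = \<mu> $ j * cinner y x"
    by (simp add: Bx cinner_simps)
qed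

definition reduces :: "('a::complex_inner \<Rightarrow> 'a) \<Rightarrow> 'a set \<Rightarrow> bool" where
  "reduces T M \<longleftrightarrow> (\<forall>x\<in>M. T x \<in> M \<and> cadjoint T x \<in> M)"

text \<open>The direction \<open>y\<close> is the residual of the claimed eigenvalue equation. The
  first-order condition in this direction says that \<open>y\<close> is orthogonal to itself;
  reduction keeps \<open>y\<close> inside \<open>perp S\<close>.\<close>

lemma hermitian_critical_eigen:
  fixes T :: "'h::chilbert_space \<Rightarrow> 'h"
  assumes cpt: "compact_operator T" and S: "reduces T (perp S)" and x: "x \<in> perp S"
    and le: "\<And>z. z \<in> perp S \<Longrightarrow> Re (\<gamma> * cinner (T z) z) \<le> r * (norm z)\<^sup>2"
    and eq: "Re (\<gamma> * cinner (T x) x) = r * (norm x)\<^sup>2"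
  shows "\<gamma> *\<^sub>C T x + cnj \<gamma> *\<^sub>C cadjoint T x = (2 * r) *\<^sub>R x"
proof -
  have adj: "cinner (T u) v = cinner u (cadjoint T v)" for u v
    by (intro cinner_cadjoint compact_operator_bounded_linear compact_operator_clinear cpt)
  \<comment> \<open>A one-member tuple. The coefficient is conjugated because \<open>inner\<close>
    on \<open>complex\<close> conjugates one factor.\<close>
  define a :: "complex^unit" where "a = (\<chi> _. cnj \<gamma>)"
  define B where "B = (\<lambda>_::unit. T)"
  have a: "a \<bullet> v = Re (\<gamma> * v $ ())" for v
    by (simp add: a_def inner_vec_def inner_complex_def UNIV_unit)
  define y where "y = \<gamma> *\<^sub>C T x + cnj \<gamma> *\<^sub>C cadjoint T x - (2 * r) *\<^sub>R x"
  have y: "y \<in> perp S"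
    unfolding y_def using S x unfolding reduces_def by (intro perp_diff perp_add perp_scaleC perp_scaleR) auto
  have "a \<bullet> (\<chi> j. cinner (B j x) y + cinner (B j y) x) = 2 * r * Re (cinner x y)"
  proof (rule qform_critical[OF _ x y])
    show "a \<bullet> qform B z \<le> r * (norm z)\<^sup>2" if "z \<in> perp S" for z
      unfolding a qform_def B_def using le[OF that] by simp
    show "a \<bullet> qform B x = r * (norm x)\<^sup>2"
      unfolding a qform_def B_def using eq by simp
  qed (simp add: B_def compact_operator_clinear[OF cpt])
  then have "Re (\<gamma> * cinner (T x) y) + Re (\<gamma> * cinner (T y) x) - 2 * r * Re (cinner x y) = 0"
    unfolding a B_def by (simp add: distrib_left)
  moreover have "Re (\<gamma> * cinner (T y) x) = Re (cnj \<gamma> * cinner (cadjoint T x) y)"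
  proof -
    have "cinner (T y) x = cnj (cinner (cadjoint T x) y)" using adj[of y x] cinner_commute by metis
    then show ?thesis by simp
  qed
  ultimately have "Re (cinner y y) = 0"
    unfolding y_def[THEN arg_cong[where f="\<lambda>v. cinner v y"]]
    by (simp add: cinner_simps scaleR_conv_of_real)
  then have "y = 0" by (simp add: cinner_self)
  then show ?thesis by (simp add: y_def)
qed

text \<open>A positive maximum of the form or of its negative is attained at a unit vector, which is
  an eigenvector. If neither is positive, the form vanishes on \<open>perp S\<close> and
  \<open>x0\<close> itself is critical with \<open>r = 0\<close>.\<close>

lemma hermitian_part_eigen:
  fixes T :: "'h::chilbert_space \<Rightarrow> 'h"
  assumes cpt: "compact_operator T" and S: "reduces T (perp S)" and x0: "x0 \<in> perp S" "x0 \<noteq> 0"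
  shows "\<exists>t x. x \<in> perp S \<and> x \<noteq> 0 \<and> \<gamma> *\<^sub>C T x + cnj \<gamma> *\<^sub>C cadjoint T x = t *\<^sub>R x"
proof -
  have max: "\<exists>x\<in>perp S. norm x \<le> 1 \<and>
     (\<forall>z\<in>perp S. Re (c * cinner (T z) z) \<le> Re (c * cinner (T x) x) * (norm z)\<^sup>2)" for c
  proof -
    have "(\<chi> _. cnj c :: complex^unit) \<bullet> v = Re (c * v $ ())" for v
      by (simp add: inner_vec_def inner_complex_def UNIV_unit)
    then show ?thesis
      using qform_max[of "\<lambda>_::unit. T" S "\<chi> _. cnj c"] cpt by (simp add: qform_def)
  qed
  have pos: "\<exists>t x. x \<in> perp S \<and> x \<noteq> 0 \<and> c *\<^sub>C T x + cnj c *\<^sub>C cadjoint T x = t *\<^sub>R x"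
    if x: "x \<in> perp S" "norm x \<le> 1" "Re (c * cinner (T x) x) > 0"
      and le: "\<And>z. z \<in> perp S \<Longrightarrow> Re (c * cinner (T z) z) \<le> Re (c * cinner (T x) x) * (norm z)\<^sup>2" for c x
  proof -
    \<comment> \<open>Applying the bound to \<open>x\<close> itself: a positive maximum cannot be
      attained at norm below 1.\<close>
    have "1 \<le> (norm x)\<^sup>2" using le[OF x(1)] x(3) by simp
    moreover have "(norm x)\<^sup>2 \<le> 1" using x(2) by (simp add: power_le_one)
    ultimately have n: "(norm x)\<^sup>2 = 1" by simp
    have "c *\<^sub>C T x + cnj c *\<^sub>C cadjoint T x = (2 * Re (c * cinner (T x) x)) *\<^sub>R x"
      by (rule hermitian_critical_eigen[OF cpt S x(1) le]) (simp_all add: n)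
    moreover have "x \<noteq> 0" using n by auto
    ultimately show ?thesis using x(1) by blast
  qed
  obtain x where x: "x \<in> perp S" "norm x \<le> 1"
    and lex: "\<And>z. z \<in> perp S \<Longrightarrow> Re (\<gamma> * cinner (T z) z) \<le> Re (\<gamma> * cinner (T x) x) * (norm z)\<^sup>2"
    using max[of \<gamma>] by blast
  obtain y where y: "y \<in> perp S" "norm y \<le> 1"
    and ley: "\<And>z. z \<in> perp S \<Longrightarrow> Re (-\<gamma> * cinner (T z) z) \<le> Re (-\<gamma> * cinner (T y) y) * (norm z)\<^sup>2"
    using max[of "-\<gamma>"] by blast
  consider "Re (\<gamma> * cinner (T x) x) > 0" | "Re (-\<gamma> * cinner (T y) y) > 0"
    | "Re (\<gamma> * cinner (T x) x) \<le> 0" "Re (-\<gamma> * cinner (T y) y) \<le> 0" by linarith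
  then show ?thesis
  proof cases
    case 1
    show ?thesis by (rule pos[OF x 1 lex])
  next
    case 2
    obtain t z where z: "z \<in> perp S" "z \<noteq> 0" "(-\<gamma>) *\<^sub>C T z + cnj (-\<gamma>) *\<^sub>C cadjoint T z = t *\<^sub>R z"
      using pos[OF y 2 ley] by blast
    have "\<gamma> *\<^sub>C T z + cnj \<gamma> *\<^sub>C cadjoint T z = - ((-\<gamma>) *\<^sub>C T z + cnj (-\<gamma>) *\<^sub>C cadjoint T z)"
      by (simp add: cvec.scale_minus_left)
    then have "\<gamma> *\<^sub>C T z + cnj \<gamma> *\<^sub>C cadjoint T z = (- t) *\<^sub>R z"
      by (simp only: z(3) scaleR_minus_left)
    then show ?thesis using z(1,2) by blast
  next
    case 3
    have "Re (\<gamma> * cinner (T z) z) = 0" if "z \<in> perp S" for z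
    proof -
      have "Re (\<gamma> * cinner (T x) x) * (norm z)\<^sup>2 \<le> 0" "Re (-\<gamma> * cinner (T y) y) * (norm z)\<^sup>2 \<le> 0"
        using 3 by (simp_all only: mult_nonpos_nonneg zero_le_power2)
      then show ?thesis using lex[OF that] ley[OF that] by simp
    qed
    then have "\<gamma> *\<^sub>C T x0 + cnj \<gamma> *\<^sub>C cadjoint T x0 = (2 * 0) *\<^sub>R x0"
      by (intro hermitian_critical_eigen[OF cpt S x0(1)]) (simp_all add: x0)
    then show ?thesis using x0 by blast
  qed
qed

text \<open>The kernel of an operator is the complement of the range of its adjoint, so cutting down
  to an eigenspace stays within the form \<open>perp S\<close>.\<close>

lemma perp_eigenspace:
  fixes T :: "'h::complex_inner \<Rightarrow> 'h"
  assumes "\<And>u v. cinner (T u) v = cinner u (T' v)"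
  shows "perp (S \<union> range (\<lambda>y. T' y - cnj c *\<^sub>C y)) = {x \<in> perp S. T x = c *\<^sub>C x}"
proof -
  have "(\<forall>y. cinner x (T' y - cnj c *\<^sub>C y) = 0) \<longleftrightarrow> T x = c *\<^sub>C x" for x
  proof -
    have "cinner x (T' y - cnj c *\<^sub>C y) = cinner (T x - c *\<^sub>C x) y" for y
      by (simp add: cinner_simps assms)
    then show ?thesis using cinner_ext[of "T x - c *\<^sub>C x"] by (auto simp: cinner.zero_left)
  qed
  then show ?thesis unfolding perp_Un by (auto simp: perp_def)
qed

text \<open>The cases \<open>\<gamma> = 1\<close> and \<open>\<gamma> = \<i>\<close> of
  \<open>hermitian_part_eigen\<close> treat the real and imaginary parts of \<open>T\<close>. By
  normality the eigenspace of the first still reduces \<open>T\<close>, so the second has an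
  eigenvector in it, and the two equations combine to one for \<open>T\<close>.\<close>

lemma normal_eigenvector_exists:
  fixes T :: "'h::chilbert_space \<Rightarrow> 'h"
  assumes cpt: "compact_operator T" and normal: "normal_operator T"
    and S: "reduces T (perp S)" and x0: "x0 \<in> perp S" "x0 \<noteq> 0"
  shows "\<exists>\<mu> x. x \<in> perp S \<and> x \<noteq> 0 \<and> T x = \<mu> *\<^sub>C x"
proof -
  define T' where "T' = cadjoint T"
  have adj: "cinner (T u) v = cinner u (T' v)" for u v
    unfolding T'_def by (intro cinner_cadjoint compact_operator_bounded_linear compact_operator_clinear cpt)
  have adj': "cinner (T' u) v = cinner u (T v)" for u v
    by (metis adj cinner_commute)
  have comm: "T (T' u) = T' (T u)" for u
    using normal unfolding normal_operator_def T'_def by (metis comp_apply)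
  have lin: "clinear T" by (rule compact_operator_clinear[OF cpt])
  have lin': "clinear T'"
    by (rule clinearI; rule cinner_eqI) (simp_all add: adj' cinner_simps)
  obtain t x1 where x1: "x1 \<in> perp S" "x1 \<noteq> 0" "1 *\<^sub>C T x1 + cnj 1 *\<^sub>C T' x1 = t *\<^sub>R x1"
    using hermitian_part_eigen[OF cpt S x0] unfolding T'_def by blast
  define S1 where "S1 = S \<union> range (\<lambda>y. (T y + T' y) - cnj (of_real t) *\<^sub>C y)"
  have S1: "perp S1 = {x \<in> perp S. T x + T' x = of_real t *\<^sub>C x}"
    unfolding S1_def by (rule perp_eigenspace) (simp add: cinner_simps adj adj' add.commute)
  have "reduces T (perp S1)"
    unfolding reduces_def S1 T'_def[symmetric]
  proof (intro ballI conjI)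
    fix x assume "x \<in> {x \<in> perp S. T x + T' x = of_real t *\<^sub>C x}"
    then have x: "x \<in> perp S" and e: "T x + T' x = of_real t *\<^sub>C x" by auto
    have "T (T x) + T' (T x) = of_real t *\<^sub>C T x"
      using arg_cong[OF e, of T] by (simp add: clinear_add[OF lin] clinear_scaleC[OF lin] comm)
    then show "T x \<in> {x \<in> perp S. T x + T' x = of_real t *\<^sub>C x}" using S x by (simp add: reduces_def)
    have "T (T' x) + T' (T' x) = of_real t *\<^sub>C T' x"
      using arg_cong[OF e, of T'] by (simp add: clinear_add[OF lin'] clinear_scaleC[OF lin'] comm)
    then show "T' x \<in> {x \<in> perp S. T x + T' x = of_real t *\<^sub>C x}" using S x by (simp add: reduces_def T'_def)
  qed
  moreover have "x1 \<in> perp S1" using x1 by (simp add: S1 scaleC_of_real)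
  ultimately obtain s x where x: "x \<in> perp S1" "x \<noteq> 0" "\<i> *\<^sub>C T x + cnj \<i> *\<^sub>C T' x = s *\<^sub>R x"
    using hermitian_part_eigen[OF cpt, of S1 x1 \<i>] x1(2) unfolding T'_def by blast
  have "T' x = of_real t *\<^sub>C x - T x" using x(1) by (simp add: S1 algebra_simps)
  with x(3) have "\<i> *\<^sub>C T x - \<i> *\<^sub>C (of_real t *\<^sub>C x - T x) = of_real s *\<^sub>C x"
    by (simp add: cvec.scale_minus_left scaleC_of_real)
  moreover have "\<i> *\<^sub>C (of_real t *\<^sub>C x - T x) = (\<i> * of_real t) *\<^sub>C x - \<i> *\<^sub>C T x"
    by (simp only: cvec.scale_right_diff_distrib scaleC_scaleC)
  ultimately have "\<i> *\<^sub>C T x + \<i> *\<^sub>C T x = of_real s *\<^sub>C x + (\<i> * of_real t) *\<^sub>C x"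
    by (simp add: algebra_simps)
  then have "(2 * \<i>) *\<^sub>C T x = (of_real s + \<i> * of_real t) *\<^sub>C x"
    by (simp only: mult_2 scaleC_add_left)
  then have "(1 / (2 * \<i>)) *\<^sub>C (2 * \<i>) *\<^sub>C T x = (1 / (2 * \<i>)) *\<^sub>C (of_real s + \<i> * of_real t) *\<^sub>C x" by simp
  then have "T x = (1 / (2 * \<i>) * (of_real s + \<i> * of_real t)) *\<^sub>C x" unfolding scaleC_scaleC by simp
  moreover have "x \<in> perp S" using x(1) S1 by simp
  ultimately show ?thesis using x(2) by blast
qed

text \<open>The induction carries a whole reducing subspace instead of one eigenvector, because the
  next operator needs room in which to find its own eigenvector.\<close>

lemma joint_eigenspace_exists:
  fixes B :: "'m::finite \<Rightarrow> 'h::chilbert_space \<Rightarrow> 'h"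
  assumes cpt: "\<And>j. compact_operator (B j)" and normal: "\<And>j. normal_operator (B j)"
    and comm: "\<And>i j. B i \<circ> B j = B j \<circ> B i" and S: "\<And>j. reduces (B j) (perp S)" "\<exists>x\<in>perp S. x \<noteq> 0"
    and J: "finite J"
  shows "\<exists>S'. perp S' \<subseteq> perp S \<and> (\<exists>x\<in>perp S'. x \<noteq> 0) \<and> (\<forall>j. reduces (B j) (perp S')) \<and>
    (\<forall>j\<in>J. \<exists>\<mu>. \<forall>x\<in>perp S'. B j x = \<mu> *\<^sub>C x)"
  using J
proof induction
  case empty
  show ?case using S by (intro exI[of _ S]) auto
next
  case (insert i J)
  then obtain S1 where S1: "perp S1 \<subseteq> perp S" "\<exists>x\<in>perp S1. x \<noteq> 0" "\<And>j. reduces (B j) (perp S1)"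
    "\<forall>j\<in>J. \<exists>\<mu>. \<forall>x\<in>perp S1. B j x = \<mu> *\<^sub>C x" by blast
  obtain x1 where x1: "x1 \<in> perp S1" "x1 \<noteq> 0" using S1(2) by blast
  obtain \<mu> x where x: "x \<in> perp S1" "x \<noteq> 0" "B i x = \<mu> *\<^sub>C x"
    using normal_eigenvector_exists[OF cpt normal S1(3) x1] by blast
  define adj where "adj j = cadjoint (B j)" for j
  have adj: "cinner (B j u) v = cinner u (adj j v)" for j u v
    unfolding adj_def by (intro cinner_cadjoint compact_operator_bounded_linear compact_operator_clinear cpt)
  have adj': "cinner (adj j u) v = cinner u (B j v)" for j u v
    by (metis adj cinner_commute)
  define S2 where "S2 = S1 \<union> range (\<lambda>y. adj i y - cnj \<mu> *\<^sub>C y)"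
  have S2: "perp S2 = {x \<in> perp S1. B i x = \<mu> *\<^sub>C x}"
    unfolding S2_def by (rule perp_eigenspace) (rule adj)
  have comm': "B i (B j x) = B j (B i x)" for i j x using comm by (metis comp_apply)
  have sc: "B j (c *\<^sub>C u) = c *\<^sub>C B j u" for j c u by (rule clinear_scaleC[OF compact_operator_clinear[OF cpt]])
  have "reduces (B j) (perp S2)" for j
    unfolding reduces_def S2
  proof (intro ballI conjI)
    fix x assume "x \<in> {x \<in> perp S1. B i x = \<mu> *\<^sub>C x}"
    then have x: "x \<in> perp S1" and e: "B i x = \<mu> *\<^sub>C x" by auto
    show "B j x \<in> {x \<in> perp S1. B i x = \<mu> *\<^sub>C x}"
      using x e S1(3)[of j] comm'[of i j x] by (simp add: reduces_def sc)
    have a: "adj i x = cnj \<mu> *\<^sub>C x"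
      using normal_norm_eq[OF cpt normal, of i x \<mu>] e by (simp add: adj_def)
    \<comment> \<open>Adjoints commute because the operators do, and \<open>adj i\<close> is a
      scalar on the eigenspace. Normality then leads back from \<open>adj i\<close> to
      \<open>B i\<close>.\<close>
    have "adj i (adj j x) = cnj \<mu> *\<^sub>C adj j x"
    proof (rule cinner_eqI)
      fix y
      have "cinner (adj i (adj j x)) y = cinner (adj i x) (B j y)"
        by (simp only: adj' comm'[of j i y])
      then show "cinner (adj i (adj j x)) y = cinner (cnj \<mu> *\<^sub>C adj j x) y"
        by (simp add: a cinner_scaleC_left adj')
    qed
    then have "B i (adj j x) = \<mu> *\<^sub>C adj j x"
      using normal_norm_eq[OF cpt normal, of i "adj j x" \<mu>] by (simp add: adj_def)
    then show "cadjoint (B j) x \<in> {x \<in> perp S1. B i x = \<mu> *\<^sub>C x}"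
      using x S1(3)[of j] by (simp add: reduces_def adj_def)
  qed
  moreover have "perp S2 \<subseteq> perp S" using S1(1) by (auto simp: S2)
  moreover have "\<exists>x\<in>perp S2. x \<noteq> 0" using x by (auto simp: S2)
  moreover have "\<forall>j\<in>insert i J. \<exists>\<mu>. \<forall>x\<in>perp S2. B j x = \<mu> *\<^sub>C x"
    using S1(4) unfolding S2 by blast
  ultimately show ?case by blast
qed

text \<open>The complement of all common eigenvectors reduces every \<open>B j\<close>; were it
  nonzero, it would contain a common eigenvector.\<close>

lemma common_eigenvectors_total:
  fixes B :: "'m::finite \<Rightarrow> 'h::chilbert_space \<Rightarrow> 'h"
  assumes cpt: "\<And>j. compact_operator (B j)" and normal: "\<And>j. normal_operator (B j)"
    and comm: "\<And>i j. B i \<circ> B j = B j \<circ> B i" and x: "x \<noteq> 0"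
  shows "\<exists>\<mu> u. common_eigenvector B \<mu> u \<and> cinner x u \<noteq> 0"
proof (rule ccontr)
  assume c: "\<nexists>\<mu> u. common_eigenvector B \<mu> u \<and> cinner x u \<noteq> 0"
  define S where "S = {u. \<exists>\<mu>. common_eigenvector B \<mu> u}"
  have xS: "x \<in> perp S" using c by (auto simp: S_def perp_def)
  define adj where "adj j = cadjoint (B j)" for j
  have adj: "cinner (B j u) v = cinner u (adj j v)" for j u v
    unfolding adj_def by (intro cinner_cadjoint compact_operator_bounded_linear compact_operator_clinear cpt)
  have adj': "cinner (adj j u) v = cinner u (B j v)" for j u v
    by (metis adj cinner_commute)
  have red: "reduces (B j) (perp S)" for j
    unfolding reduces_def
  proof (intro ballI conjI)
    fix y assume y: "y \<in> perp S"
    have "cinner (B j y) u = 0 \<and> cinner (adj j y) u = 0" if u: "u \<in> S" for u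
    proof -
      obtain \<mu> where \<mu>: "common_eigenvector B \<mu> u" using u unfolding S_def by blast
      have yu: "cinner y u = 0" using y u by (simp add: perp_def)
      have "cinner (B j y) u = \<mu> $ j * cinner y u"
        using common_eigenvector_imp_reducing[OF cpt normal \<mu>] by (simp add: reducing_eigenvector_def)
      moreover have "B j u = \<mu> $ j *\<^sub>C u" using \<mu> by (simp add: common_eigenvector_def)
      ultimately show ?thesis by (simp add: adj' cinner_simps yu)
    qed
    then show "B j y \<in> perp S" "cadjoint (B j) y \<in> perp S" by (auto simp: perp_def adj_def)
  qed
  obtain S' where S': "perp S' \<subseteq> perp S" "\<exists>x\<in>perp S'. x \<noteq> 0" "\<forall>j\<in>UNIV. \<exists>\<mu>. \<forall>x\<in>perp S'. B j x = \<mu> *\<^sub>C x"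
    using joint_eigenspace_exists[where B=B and S=S, OF cpt normal comm red _ finite[of "UNIV :: 'm set"]] x xS by blast
  obtain m where m: "\<And>j x. x \<in> perp S' \<Longrightarrow> B j x = m j *\<^sub>C x" using S'(3) by (metis UNIV_I)
  obtain u where u: "u \<in> perp S'" "u \<noteq> 0" using S'(2) by blast
  have "common_eigenvector B (\<chi> j. m j) u" using m u by (simp add: common_eigenvector_def)
  then have "u \<in> S" by (auto simp: S_def)
  moreover have "u \<in> perp S" using u(1) S'(1) by blast
  ultimately have "cinner u u = 0" by (auto simp: perp_def)
  then show False using u(2) by simp
qed

text \<open>The maximizer \<open>x\<close> on the complement need not be a common eigenvector, as
  one functional may take equal values at different joint eigenvalues. But some common eigenvector
  is not orthogonal to \<open>x\<close>, and its component in the complement attains the same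
  maximum.\<close>

lemma optimal_eigenvector_family_exists:
  fixes B :: "'m::finite \<Rightarrow> 'h::chilbert_space \<Rightarrow> 'h"
  assumes cpt: "\<And>j. compact_operator (B j)" and null: "infinite_null B"
    and normal: "\<And>j. normal_operator (B j)" and comm: "\<And>i j. B i \<circ> B j = B j \<circ> B i"
  shows "\<exists>e \<mu>. orthonormal_family k e \<and> (\<forall>i\<in>{1..k}. common_eigenvector B (\<mu> i) (e i)) \<and>
    (\<forall>x. orthonormal_family k x \<longrightarrow> a \<bullet> (\<Sum>l=1..k. qform B (x l)) \<le> a \<bullet> (\<Sum>i=1..k. \<mu> i))"
proof (induction k)
  case 0
  show ?case by (simp add: orthonormal_family_def)
next
  case (Suc n)
  then obtain e \<mu> where e: "orthonormal_family n e" and ev: "\<And>i. i \<in> {1..n} \<Longrightarrow> common_eigenvector B (\<mu> i) (e i)"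
    and opt: "\<And>x. orthonormal_family n x \<Longrightarrow> a \<bullet> (\<Sum>l=1..n. qform B (x l)) \<le> a \<bullet> (\<Sum>i=1..n. \<mu> i)"
    by blast
  have B: "\<And>j. clinear (B j)" by (rule compact_operator_clinear[OF cpt])
  have red: "reducing_eigenvector B (\<mu> i) (e i)" if "i \<in> {1..n}" for i
    by (rule common_eigenvector_imp_reducing[OF cpt normal ev[OF that]])
  obtain x where x: "x \<in> perp (e ` {1..n})" "norm x = 1"
    and top: "\<And>z. z \<in> perp (e ` {1..n}) \<Longrightarrow> a \<bullet> qform B z \<le> (a \<bullet> qform B x) * (norm z)\<^sup>2"
    using qform_max_unit[where B=B and F="e ` {1..n}" and a=a, OF cpt null] by auto
  define r where "r = a \<bullet> qform B x"
  have "x \<noteq> 0" using x(2) by auto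
  then obtain \<nu> u where u: "common_eigenvector B \<nu> u" "cinner x u \<noteq> 0"
    using common_eigenvectors_total[where B=B, OF cpt normal comm] by blast
  define p where "p = (\<Sum>i=1..n. cinner u (e i) *\<^sub>C e i)"
  define v where "v = u - p"
  have v: "v \<in> perp (e ` {1..n})" unfolding v_def p_def by (rule orthonormal_decomposition(1)[OF e])
  have "cinner x p = 0"
    unfolding p_def cinner.sum_right
    by (intro sum.neutral ballI) (use x(1) in \<open>auto simp: cinner_simps perp_def\<close>)
  then have xv: "cinner x v \<noteq> 0" using u(2) by (simp add: v_def cinner_simps)
  then have v0: "v \<noteq> 0" by (auto simp: cinner.zero_right)
  have redu: "reducing_eigenvector B \<nu> u" by (rule common_eigenvector_imp_reducing[OF cpt normal u(1)])
  \<comment> \<open>Reducing eigenvectors for different eigenvalues are orthogonal, so only those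
    \<open>e i\<close> with the eigenvalue \<open>\<nu>\<close> occur in \<open>p\<close>, and
    subtracting \<open>p\<close> leaves an eigenvector.\<close>
  have "B j p = \<nu> $ j *\<^sub>C p" for j
    unfolding p_def clinear_sum_scaleC[OF B] cvec.scale_sum_right
  proof (intro sum.cong refl)
    fix i assume i: "i \<in> {1..n}"
    have "\<mu> i $ j * cinner u (e i) = \<nu> $ j * cinner u (e i)"
      using red[OF i] redu unfolding reducing_eigenvector_def by metis
    moreover have "B j (e i) = \<mu> i $ j *\<^sub>C e i" using ev[OF i] by (simp add: common_eigenvector_def)
    ultimately show "cinner u (e i) *\<^sub>C B j (e i) = \<nu> $ j *\<^sub>C cinner u (e i) *\<^sub>C e i"
      by (simp add: scaleC_scaleC mult.commute)
  qed
  then have Bv: "B j v = \<nu> $ j *\<^sub>C v" for j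
    using u(1) unfolding v_def
    by (simp add: linear_diff[OF clinear_imp_linear[OF B]] common_eigenvector_def cvec.scale_right_diff_distrib)
  then have redv: "reducing_eigenvector B \<nu> v"
    using v0 by (intro common_eigenvector_imp_reducing[OF cpt normal]) (simp add: common_eigenvector_def)
  have a\<nu>: "a \<bullet> \<nu> = r"
  proof -
    \<comment> \<open>A multiple of \<open>v\<close> whose inner product with \<open>x\<close> is
      real and positive, so that the first-order condition determines
      \<open>a \<bullet> \<nu>\<close>.\<close>
    define y where "y = cinner x v *\<^sub>C v"
    define c where "c = (cmod (cinner x v))\<^sup>2"
    have c: "cinner x y = of_real c" "cinner y x = of_real c" "c > 0"
      using xv complex_norm_square[of "cinner x v"]
      by (simp_all add: y_def c_def cinner_simps mult.commute flip: cinner_commute[of v x])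
    have By: "cinner (B j x) y + cinner (B j y) x = \<nu> $ j * (2 * of_real c)" for j
    proof -
      have "cinner (B j x) y = \<nu> $ j * cinner x y"
        using redv by (simp add: y_def cinner_simps reducing_eigenvector_def)
      moreover have "cinner (B j y) x = \<nu> $ j * cinner y x"
        using Bv by (simp add: y_def clinear_scaleC[OF B] cinner_simps)
      ultimately show ?thesis by (simp add: c)
    qed
    have "(\<chi> j. cinner (B j x) y + cinner (B j y) x) = (2 * c) *\<^sub>R \<nu>"
      unfolding By vec_eq_iff by (simp add: scaleR_conv_of_real[where 'a=complex])
    moreover have "a \<bullet> (\<chi> j. cinner (B j x) y + cinner (B j y) x) = 2 * r * Re (cinner x y)"
    proof (rule qform_critical[OF B x(1)])
      show "y \<in> perp (e ` {1..n})" unfolding y_def by (rule perp_scaleC[OF v])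
    qed (use top x(2) in \<open>simp_all add: r_def\<close>)
    ultimately show ?thesis using c by simp
  qed
  define w where "w = inverse (norm v) *\<^sub>R v"
  have w: "w \<in> perp (e ` {1..n})" "norm w = 1" using v v0 by (auto simp: w_def intro: perp_scaleR)
  have evw: "common_eigenvector B \<nu> w"
    using v0 Bv unfolding common_eigenvector_def w_def
    by (simp add: clinear_scaleC[OF B] scaleC_scaleC mult.commute flip: scaleC_of_real)
  have qw: "qform B w = \<nu>"
    using qform_reducing[OF common_eigenvector_imp_reducing[OF cpt normal evw]] w(2) by simp
  define e' where "e' = e(Suc n := w)"
  define \<mu>' where "\<mu>' = \<mu>(Suc n := \<nu>)"
  have "(\<Sum>i=1..n. \<mu>' i) = (\<Sum>i=1..n. \<mu> i)" by (intro sum.cong refl) (auto simp: \<mu>'_def)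
  then have summ: "(\<Sum>i=1..Suc n. \<mu>' i) = (\<Sum>i=1..n. \<mu> i) + qform B w" by (simp add: \<mu>'_def qw)
  have topw: "a \<bullet> qform B z \<le> (a \<bullet> qform B w) * (norm z)\<^sup>2" if "z \<in> perp (e ` {1..n})" for z
    using top[OF that] by (simp add: qw a\<nu> r_def)
  have "orthonormal_family (Suc n) e'" unfolding e'_def by (rule orthonormal_family_Suc[OF e w(2,1)])
  moreover have "\<forall>i\<in>{1..Suc n}. common_eigenvector B (\<mu>' i) (e' i)"
    using ev evw by (auto simp: e'_def \<mu>'_def le_Suc_eq)
  moreover have "a \<bullet> (\<Sum>l=1..Suc n. qform B (y l)) \<le> a \<bullet> (\<Sum>i=1..Suc n. \<mu>' i)" if y: "orthonormal_family (Suc n) y" for y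
    unfolding summ by (rule optimal_family_step[OF B e red opt w topw y])
  ultimately show ?case by blast
qed

lemma orthonormal_eigenvalue_sums:
  assumes e: "orthonormal_family k e" and ev: "\<And>i. i \<in> {1..k} \<Longrightarrow> common_eigenvector B (\<mu> i) (e i)"
  shows "(\<Sum>l=1..k. \<mu> l) \<in> eigenvalue_sums k B"
proof -
  have inj: "inj_on e {1..k}"
  proof (rule inj_onI)
    fix i j assume ij: "i \<in> {1..k}" "j \<in> {1..k}" "e i = e j"
    then show "i = j"
      using orthonormal_familyD[OF e ij(1,2)] orthonormal_familyD[OF e ij(2,2)] by (auto split: if_splits)
  qed
  moreover have "cvec.independent (e ` {1..k})"
    unfolding cvec.dependent_def
  proof
    assume "\<exists>a\<in>e ` {1..k}. a \<in> cvec.span (e ` {1..k} - {a})"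
    then obtain i where i: "i \<in> {1..k}" "e i \<in> cvec.span (e ` {1..k} - {e i})" by blast
    have "e i \<in> perp (e ` {1..k} - {e i})"
      using orthonormal_familyD[OF e i(1)] by (auto simp: perp_def split: if_splits)
    then have "cinner (e i) (e i) = 0" using i(2) by (rule perp_span)
    then show False using orthonormal_familyD[OF e i(1,1)] by simp
  qed
  ultimately show ?thesis unfolding eigenvalue_sums_def using ev by blast
qed

section \<open>Convexity: the Schur-Horn theorem for projections\<close>

text \<open>Rotating in the plane of \<open>e i\<close> and \<open>e j\<close> moves the two diagonal entries of the projection
  onto the span of \<open>x\<close> continuously until they are swapped.\<close>

lemma orthonormal_family_rotate:
  fixes e x :: "nat \<Rightarrow> 'h::complex_inner"
  assumes e: "orthonormal_family n e" and ij: "i \<in> {1..n}" "j \<in> {1..n}" "i \<noteq> j"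
    and x: "orthonormal_family k x"
    and \<beta>: "(\<Sum>l=1..k. (cmod (cinner (x l) (e j)))\<^sup>2) \<le> \<beta>"
    and \<alpha>: "\<beta> \<le> (\<Sum>l=1..k. (cmod (cinner (x l) (e i)))\<^sup>2)"
  shows "\<exists>y. orthonormal_family k y \<and>
    (\<Sum>l=1..k. (cmod (cinner (y l) (e i)))\<^sup>2) = \<beta> \<and>
    (\<Sum>l=1..k. (cmod (cinner (y l) (e i)))\<^sup>2) + (\<Sum>l=1..k. (cmod (cinner (y l) (e j)))\<^sup>2)
     = (\<Sum>l=1..k. (cmod (cinner (x l) (e i)))\<^sup>2) + (\<Sum>l=1..k. (cmod (cinner (x l) (e j)))\<^sup>2) \<and>
    (\<forall>m\<in>{1..n} - {i, j}. \<forall>l. cinner (y l) (e m) = cinner (x l) (e m))"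
proof -
  define p where "p l = cinner (x l) (e i)" for l
  define q where "q l = cinner (x l) (e j)" for l
  have ee: "cinner (e i) (e i) = 1" "cinner (e j) (e j) = 1" "cinner (e i) (e j) = 0" "cinner (e j) (e i) = 0"
    using e ij by (simp_all add: orthonormal_familyD)
  have pq: "cinner (e i) (x l) = cnj (p l)" "cinner (e j) (x l) = cnj (q l)" for l
    by (simp_all add: p_def q_def flip: cinner_commute)
  \<comment> \<open>Diagonal entry \<open>i\<close> after rotation by the angle \<open>t\<close>; at
    \<open>pi / 2\<close> it has become entry \<open>j\<close>.\<close>
  define \<phi> where "\<phi> t = (\<Sum>l=1..k. (cmod (of_real (cos t) * p l - of_real (sin t) * q l))\<^sup>2)" for t
  have "\<exists>t. 0 \<le> t \<and> t \<le> pi / 2 \<and> \<phi> t = \<beta>"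
  proof (rule IVT2')
    show "\<phi> (pi / 2) \<le> \<beta>" "\<beta> \<le> \<phi> 0" using \<alpha> \<beta> by (simp_all add: \<phi>_def p_def q_def)
    show "continuous_on {0..pi / 2} \<phi>" unfolding \<phi>_def by (intro continuous_intros)
  qed simp
  then obtain t where t: "\<phi> t = \<beta>" by blast
  define c where "c = complex_of_real (cos t)"
  define s where "s = complex_of_real (sin t)"
  have cs: "c * c = 1 - s * s"
    unfolding c_def s_def using sin_cos_squared_add3[of t]
    by (metis add_diff_cancel_right' of_real_1 of_real_diff of_real_mult)
  have cn: "cnj c = c" "cnj s = s" by (simp_all add: c_def s_def)
  define a where "a l = c * p l - s * q l" for l
  define b where "b l = s * p l + c * q l" for l
  \<comment> \<open>Only the coordinates along \<open>e i\<close> and \<open>e j\<close> change, by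
    a rotation, so all inner products within the family survive.\<close>
  define y where "y l = x l + (a l - p l) *\<^sub>C e i + (b l - q l) *\<^sub>C e j" for l
  have yi: "cinner (y l) (e i) = a l" for l by (simp add: y_def cinner_simps ee p_def[symmetric])
  have yj: "cinner (y l) (e j) = b l" for l by (simp add: y_def cinner_simps ee q_def[symmetric])
  have rot: "a l * cnj (a m) + b l * cnj (b m) = p l * cnj (p m) + q l * cnj (q m)" for l m
  proof -
    have "a l * cnj (a m) + b l * cnj (b m) = (c * c + s * s) * (p l * cnj (p m) + q l * cnj (q m))"
      by (simp add: a_def b_def cn algebra_simps)
    then show ?thesis by (simp add: cs)
  qed
  have "cinner (y l) (y m) = cinner (x l) (x m)" for l m
  proof -
    have "cinner (y l) (y m) = cinner (x l) (x m) + (a l * cnj (a m) + b l * cnj (b m))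
       - (p l * cnj (p m) + q l * cnj (q m))"
      by (simp add: y_def cinner_simps ee pq p_def[symmetric] q_def[symmetric] algebra_simps)
    then show ?thesis by (simp add: rot)
  qed
  then have "orthonormal_family k y" using x by (simp add: orthonormal_family_def)
  moreover have "(\<Sum>l=1..k. (cmod (cinner (y l) (e i)))\<^sup>2) = \<beta>"
    using t by (simp add: yi a_def c_def s_def \<phi>_def)
  moreover have "(\<Sum>l=1..k. (cmod (cinner (y l) (e i)))\<^sup>2) + (\<Sum>l=1..k. (cmod (cinner (y l) (e j)))\<^sup>2)
     = (\<Sum>l=1..k. (cmod (cinner (x l) (e i)))\<^sup>2) + (\<Sum>l=1..k. (cmod (cinner (x l) (e j)))\<^sup>2)"
  proof -
    have "(cmod (a l))\<^sup>2 + (cmod (b l))\<^sup>2 = (cmod (p l))\<^sup>2 + (cmod (q l))\<^sup>2" for l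
    proof -
      have "complex_of_real ((cmod (a l))\<^sup>2 + (cmod (b l))\<^sup>2) = of_real ((cmod (p l))\<^sup>2 + (cmod (q l))\<^sup>2)"
        using rot[of l l] by (simp only: of_real_add complex_norm_square)
      then show ?thesis by (simp only: of_real_eq_iff)
    qed
    then show ?thesis unfolding yi yj p_def[symmetric] q_def[symmetric] sum.distrib[symmetric] by simp
  qed
  moreover have "cinner (y l) (e m) = cinner (x l) (e m)" if "m \<in> {1..n} - {i, j}" for l m
    using that e ij by (simp add: y_def cinner_simps orthonormal_familyD)
  ultimately show ?thesis by blast
qed

lemma sum_zero_one:
  fixes d :: "'a \<Rightarrow> real"
  assumes "finite S" "\<And>i. i \<in> S \<Longrightarrow> d i = 0 \<or> d i = 1"
  shows "sum d S = card {i \<in> S. d i = 1}"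
proof -
  have "sum d S = (\<Sum>i\<in>S. if d i = 1 then 1 else 0)" using assms(2) by (intro sum.cong) auto
  also have "\<dots> = card {i \<in> S. d i = 1}" using assms(1) by (simp add: sum.If_cases Int_def)
  finally show ?thesis .
qed

text \<open>The Schur-Horn theorem for projections, by induction on the number of fractional entries.\<close>

lemma projection_with_diagonal:
  fixes e :: "nat \<Rightarrow> 'h::complex_inner" and d :: "nat \<Rightarrow> real"
  assumes e: "orthonormal_family n e"
    and d: "\<And>i. i \<in> {1..n} \<Longrightarrow> 0 \<le> d i \<and> d i \<le> 1" and sum: "(\<Sum>i=1..n. d i) = real k"
  shows "\<exists>x. orthonormal_family k x \<and> (\<forall>i\<in>{1..n}. (\<Sum>l=1..k. (cmod (cinner (x l) (e i)))\<^sup>2) = d i)"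
  using d sum
proof (induction "card {i \<in> {1..n}. d i \<noteq> 0 \<and> d i \<noteq> 1}" arbitrary: d rule: less_induct)
  case less
  define Fr where "Fr d = {i \<in> {1..n}. d i \<noteq> 0 \<and> d i \<noteq> (1::real)}" for d
  have finF: "finite (Fr d)" for d by (simp add: Fr_def)
  note d = less.prems(1) and sum = less.prems(2)
  show ?case
  proof (cases "Fr d = {}")
    case True
    define T where "T = {i \<in> {1..n}. d i = 1}"
    have zo: "d i = 0 \<or> d i = 1" if "i \<in> {1..n}" for i using True that by (auto simp: Fr_def)
    have "real (card T) = real k"
      using sum_zero_one[of "{1..n}" d] zo sum unfolding T_def by simp
    then obtain h where h: "bij_betw h {1..k} T"
      using ex_bij_betw_nat_finite_1[of T] by (auto simp: T_def)
    have hT: "h l \<in> T" if "l \<in> {1..k}" for l using h that by (auto simp: bij_betw_def)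
    have hn: "h l \<in> {1..n}" if "l \<in> {1..k}" for l using hT[OF that] by (simp add: T_def)
    have "orthonormal_family k (\<lambda>l. e (h l))"
      unfolding orthonormal_family_def
    proof (intro ballI)
      fix l l' assume l: "l \<in> {1..k}" "l' \<in> {1..k}"
      then show "cinner (e (h l)) (e (h l')) = (if l = l' then 1 else 0)"
        using orthonormal_familyD[OF e hn hn, OF l] inj_on_eq_iff[OF bij_betw_imp_inj_on[OF h] l] by simp
    qed
    moreover have "(\<Sum>l=1..k. (cmod (cinner (e (h l)) (e i)))\<^sup>2) = d i" if i: "i \<in> {1..n}" for i
    proof -
      have "(\<Sum>l=1..k. (cmod (cinner (e (h l)) (e i)))\<^sup>2) = (\<Sum>l=1..k. if h l = i then 1 else 0)"
        using hn i by (intro sum.cong refl) (simp add: orthonormal_familyD[OF e])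
      also have "\<dots> = (\<Sum>m\<in>T. if m = i then 1 else 0)"
        by (rule sum.reindex_bij_betw[OF h])
      also have "\<dots> = d i" using zo[OF i] i by (auto simp: T_def)
      finally show ?thesis .
    qed
    ultimately show ?thesis by blast
  next
    case False
    then obtain u where u: "u \<in> Fr d" by blast
    \<comment> \<open>A lone fractional entry would make the sum of all entries, the integer
      \<open>k\<close>, fractional.\<close>
    have "\<exists>v\<in>Fr d. v \<noteq> u"
    proof (rule ccontr)
      assume "\<not> ?thesis"
      then have zo: "d i = 0 \<or> d i = 1" if "i \<in> {1..n} - {u}" for i using that by (auto simp: Fr_def)
      have u1: "u \<in> {1..n}" "0 < d u" "d u < 1" using u d[of u] by (auto simp: Fr_def)
      have "real k = d u + card {i \<in> {1..n} - {u}. d i = 1}"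
        using sum.remove[of "{1..n}" u d] u1 sum sum_zero_one[of "{1..n} - {u}" d] zo by simp
      then have "real k - real (card {i \<in> {1..n} - {u}. d i = 1}) = d u" by simp
      then have "d u = of_int (int k - int (card {i \<in> {1..n} - {u}. d i = 1}))" by simp
      then obtain z :: int where "d u = of_int z" by blast
      then show False using u1 by simp
    qed
    then obtain v where v: "v \<in> Fr d" "v \<noteq> u" by blast
    obtain i j where ij: "i \<in> Fr d" "j \<in> Fr d" "i \<noteq> j" "d j \<le> d i"
    proof (cases "d v \<le> d u")
      case True
      then show ?thesis using that[of u v] u v by blast
    next
      case False
      then show ?thesis using that[of v u] u v by auto
    qed
    have i: "i \<in> {1..n}" "0 < d i" "d i < 1" and j: "j \<in> {1..n}" "0 < d j" "d j < 1"
      using ij d[of i] d[of j] by (auto simp: Fr_def)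
    \<comment> \<open>The largest transfer from entry \<open>j\<close> to entry \<open>i\<close>
      that keeps both in the unit interval; it makes at least one of them 0 or 1.\<close>
    define t where "t = min (1 - d i) (d j)"
    have t: "t > 0" "d i + t \<le> 1" "0 \<le> d j - t" "d i + t = 1 \<or> d j - t = 0" using i j by (auto simp: t_def)
    define d' where "d' = d(i := d i + t, j := d j - t)"
    have d'ij: "d' i = d i + t" "d' j = d j - t" using ij(3) by (auto simp: d'_def)
    have d'o: "d' m = d m" if "m \<noteq> i" "m \<noteq> j" for m using that by (simp add: d'_def)
    have "Fr d' \<subset> Fr d"
    proof
      show "Fr d' \<subseteq> Fr d"
      proof
        fix m assume "m \<in> Fr d'"
        then show "m \<in> Fr d" using ij d'o[of m] by (cases "m = i \<or> m = j") (auto simp: Fr_def)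
      qed
      have "i \<notin> Fr d' \<or> j \<notin> Fr d'" using t(4) d'ij by (auto simp: Fr_def)
      then show "Fr d' \<noteq> Fr d" using ij by auto
    qed
    then have "card (Fr d') < card (Fr d)" by (rule psubset_card_mono[OF finF])
    moreover have "0 \<le> d' m \<and> d' m \<le> 1" if "m \<in> {1..n}" for m
      using d[OF that] i j t d'ij d'o[of m] by (cases "m = i"; cases "m = j") auto
    moreover have "(\<Sum>m=1..n. d' m) = real k"
    proof -
      have s: "sum f {1..n} = f i + f j + sum f ({1..n} - {i, j})" for f :: "nat \<Rightarrow> real"
        using sum.remove[of "{1..n}" i f] sum.remove[of "{1..n} - {i}" j f] i j ij(3)
        by (simp add: Diff_insert2[symmetric] insert_commute)
      have "sum d' ({1..n} - {i, j}) = sum d ({1..n} - {i, j})" by (intro sum.cong refl) (auto simp: d'o)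
      then show ?thesis using s[of d] s[of d'] sum d'ij by simp
    qed
    ultimately obtain x where x: "orthonormal_family k x"
      and xd: "\<And>m. m \<in> {1..n} \<Longrightarrow> (\<Sum>l=1..k. (cmod (cinner (x l) (e m)))\<^sup>2) = d' m"
      using less.hyps[of d'] unfolding Fr_def by blast
    \<comment> \<open>Since \<open>d' j < d j \<le> d i < d' i\<close>, a rotation undoes the
      transfer: it brings entry \<open>i\<close> back to \<open>d i\<close>, and the preserved sum
      restores entry \<open>j\<close>.\<close>
    obtain y where y: "orthonormal_family k y" "(\<Sum>l=1..k. (cmod (cinner (y l) (e i)))\<^sup>2) = d i"
      "(\<Sum>l=1..k. (cmod (cinner (y l) (e i)))\<^sup>2) + (\<Sum>l=1..k. (cmod (cinner (y l) (e j)))\<^sup>2) = d' i + d' j"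
      and yo: "\<And>m l. m \<in> {1..n} - {i, j} \<Longrightarrow> cinner (y l) (e m) = cinner (x l) (e m)"
      using orthonormal_family_rotate[OF e i(1) j(1) ij(3) x, of "d i"] ij(4) t(1)
      unfolding xd[OF i(1)] xd[OF j(1)] d'ij by auto
    have "(\<Sum>l=1..k. (cmod (cinner (y l) (e m)))\<^sup>2) = d m" if m: "m \<in> {1..n}" for m
    proof (cases "m = i \<or> m = j")
      case True
      then show ?thesis using y d'ij by auto
    next
      case False
      then have m': "m \<in> {1..n} - {i, j}" using m by simp
      show ?thesis unfolding yo[OF m'] using xd[OF m] d'o[of m] False by simp
    qed
    then show ?thesis using y(1) by blast
  qed
qed

lemma weighted_eigenvalues_in_range:
  fixes B :: "'m::finite \<Rightarrow> 'h::complex_inner \<Rightarrow> 'h"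
  assumes B: "\<And>j. clinear (B j)" and e: "orthonormal_family n e"
    and red: "\<And>i. i \<in> {1..n} \<Longrightarrow> reducing_eigenvector B (\<mu> i) (e i)"
    and d: "\<And>i. i \<in> {1..n} \<Longrightarrow> 0 \<le> d i \<and> d i \<le> 1" and sum: "(\<Sum>i=1..n. d i) = real k"
  shows "(\<Sum>i=1..n. d i *\<^sub>R \<mu> i) \<in> joint_numerical_range k B"
proof -
  obtain x where x: "orthonormal_family k x"
    and xd: "\<And>i. i \<in> {1..n} \<Longrightarrow> (\<Sum>l=1..k. (cmod (cinner (x l) (e i)))\<^sup>2) = d i"
    using projection_with_diagonal[OF e d sum] by blast
  define r where "r l = x l - (\<Sum>i=1..n. cinner (x l) (e i) *\<^sub>C e i)" for l
  have "(\<Sum>l=1..k. (norm (x l))\<^sup>2) = (\<Sum>l=1..k. \<Sum>i=1..n. (cmod (cinner (x l) (e i)))\<^sup>2) + (\<Sum>l=1..k. (norm (r l))\<^sup>2)"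
    unfolding sum.distrib[symmetric] r_def by (intro sum.cong refl orthonormal_decomposition(2)[OF e])
  also have "(\<Sum>l=1..k. \<Sum>i=1..n. (cmod (cinner (x l) (e i)))\<^sup>2) = (\<Sum>i=1..n. d i)"
    by (subst sum.swap) (intro sum.cong refl xd)
  also have "(\<Sum>l=1..k. (norm (x l))\<^sup>2) = real k" using orthonormal_family_norm[OF x] by simp
  \<comment> \<open>The prescribed entries already account for the total squared norm
    \<open>k\<close>, so the family lies in the span of \<open>e\<close>.\<close>
  finally have "(\<Sum>l=1..k. (norm (r l))\<^sup>2) = 0" using sum by simp
  then have r0: "r l = 0" if "l \<in> {1..k}" for l using that by (subst (asm) sum_nonneg_eq_0_iff) auto
  have q0: "qform B 0 = 0" using qform_scaleR[where B=B and r=0 and z=0, OF B] by simp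
  have "(\<Sum>l=1..k. qform B (x l)) = (\<Sum>l=1..k. \<Sum>i=1..n. (cmod (cinner (x l) (e i)))\<^sup>2 *\<^sub>R \<mu> i)"
  proof (intro sum.cong refl)
    fix l assume l: "l \<in> {1..k}"
    have "qform B (x l) = (\<Sum>i=1..n. (cmod (cinner (x l) (e i)))\<^sup>2 *\<^sub>R \<mu> i) + qform B (r l)"
      unfolding r_def by (rule qform_orthonormal_decomposition[OF B e red])
    then show "qform B (x l) = (\<Sum>i=1..n. (cmod (cinner (x l) (e i)))\<^sup>2 *\<^sub>R \<mu> i)"
      by (simp add: r0[OF l] q0)
  qed
  also have "\<dots> = (\<Sum>i=1..n. d i *\<^sub>R \<mu> i)"
    by (subst sum.swap) (intro sum.cong refl, simp add: xd flip: scaleR_left.sum)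
  finally show ?thesis using joint_numerical_rangeI[OF x, of B] by simp
qed

text \<open>Multiplicity enters as a lower bound, which also covers infinite-dimensional
  eigenspaces; \<open>n = 0\<close> holds for every \<open>\<nu>\<close>.\<close>

definition eigenspace_dim_ge :: "('m::finite \<Rightarrow> 'a::complex_inner \<Rightarrow> 'a) \<Rightarrow> complex^'m \<Rightarrow> nat \<Rightarrow> bool" where
  "eigenspace_dim_ge B \<nu> n \<longleftrightarrow>
     (\<exists>e. orthonormal_family n e \<and> (\<forall>i\<in>{1..n}. common_eigenvector B \<nu> (e i)))"

text \<open>A convex set between the eigenvalue sums and the joint range. Weights belong to
  eigenvalues and not to eigenvectors, since two eigenvalue sums may come from unrelated bases of
  the same eigenspace.\<close>

definition fractional_eigenvalue_sums ::
    "nat \<Rightarrow> ('m::finite \<Rightarrow> 'a::complex_inner \<Rightarrow> 'a) \<Rightarrow> (complex^'m) set" where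
  "fractional_eigenvalue_sums k B =
     {(\<Sum>\<nu>\<in>N. d \<nu> *\<^sub>R \<nu>) | N d. finite N \<and> (\<forall>\<nu>. \<nu> \<notin> N \<longrightarrow> d \<nu> = 0) \<and>
        (\<forall>\<nu>. 0 \<le> d \<nu> \<and> (\<exists>n. eigenspace_dim_ge B \<nu> n \<and> d \<nu> \<le> real n)) \<and> (\<Sum>\<nu>\<in>N. d \<nu>) = real k}"

lemma fractional_eigenvalue_sumsI:
  assumes "finite N" "\<And>\<nu>. \<nu> \<notin> N \<Longrightarrow> d \<nu> = 0" "\<And>\<nu>. 0 \<le> d \<nu>"
    "\<And>\<nu>. \<exists>n. eigenspace_dim_ge B \<nu> n \<and> d \<nu> \<le> real n" "(\<Sum>\<nu>\<in>N. d \<nu>) = real k"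
  shows "(\<Sum>\<nu>\<in>N. d \<nu> *\<^sub>R \<nu>) \<in> fractional_eigenvalue_sums k B"
  unfolding fractional_eigenvalue_sums_def using assms by blast

lemma convex_fractional_eigenvalue_sums: "convex (fractional_eigenvalue_sums k B)"
proof (rule convexI)
  fix p q :: "complex^'a" and s t :: real
  assume st: "0 \<le> s" "0 \<le> t" "s + t = 1"
  assume "p \<in> fractional_eigenvalue_sums k B"
  then obtain N d where p: "p = (\<Sum>\<nu>\<in>N. d \<nu> *\<^sub>R \<nu>)" and N: "finite N" "\<And>\<nu>. \<nu> \<notin> N \<Longrightarrow> d \<nu> = 0"
    and d: "\<And>\<nu>. 0 \<le> d \<nu>" "\<And>\<nu>. \<exists>n. eigenspace_dim_ge B \<nu> n \<and> d \<nu> \<le> real n" "(\<Sum>\<nu>\<in>N. d \<nu>) = real k"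
    unfolding fractional_eigenvalue_sums_def by blast
  assume "q \<in> fractional_eigenvalue_sums k B"
  then obtain M c where q: "q = (\<Sum>\<nu>\<in>M. c \<nu> *\<^sub>R \<nu>)" and M: "finite M" "\<And>\<nu>. \<nu> \<notin> M \<Longrightarrow> c \<nu> = 0"
    and c: "\<And>\<nu>. 0 \<le> c \<nu>" "\<And>\<nu>. \<exists>n. eigenspace_dim_ge B \<nu> n \<and> c \<nu> \<le> real n" "(\<Sum>\<nu>\<in>M. c \<nu>) = real k"
    unfolding fractional_eigenvalue_sums_def by blast
  define f where "f \<nu> = s * d \<nu> + t * c \<nu>" for \<nu>
  have p': "p = (\<Sum>\<nu>\<in>N \<union> M. d \<nu> *\<^sub>R \<nu>)" and d': "(\<Sum>\<nu>\<in>N \<union> M. d \<nu>) = real k"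
    using N M(1) d(3) sum.mono_neutral_left[of "N \<union> M" N d] sum.mono_neutral_left[of "N \<union> M" N "\<lambda>\<nu>. d \<nu> *\<^sub>R \<nu>"]
    by (auto simp: p)
  have q': "q = (\<Sum>\<nu>\<in>N \<union> M. c \<nu> *\<^sub>R \<nu>)" and c': "(\<Sum>\<nu>\<in>N \<union> M. c \<nu>) = real k"
    using M N(1) c(3) sum.mono_neutral_left[of "N \<union> M" M c] sum.mono_neutral_left[of "N \<union> M" M "\<lambda>\<nu>. c \<nu> *\<^sub>R \<nu>"]
    by (auto simp: q)
  have "(\<Sum>\<nu>\<in>N \<union> M. f \<nu> *\<^sub>R \<nu>) \<in> fractional_eigenvalue_sums k B"
  proof (rule fractional_eigenvalue_sumsI)
    fix \<nu>
    show "0 \<le> f \<nu>" using st d(1) c(1) by (simp add: f_def)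
    obtain n where n: "eigenspace_dim_ge B \<nu> n" "d \<nu> \<le> real n" using d(2) by blast
    obtain m where m: "eigenspace_dim_ge B \<nu> m" "c \<nu> \<le> real m" using c(2) by blast
    \<comment> \<open>A convex combination is at most the larger weight, so the dimension bound for
      that weight serves the combination too.\<close>
    have le: "f \<nu> \<le> max (d \<nu>) (c \<nu>)"
      unfolding f_def using st by (intro convex_bound_le) auto
    show "\<exists>n. eigenspace_dim_ge B \<nu> n \<and> f \<nu> \<le> real n"
      using n m le by (cases "d \<nu> \<le> c \<nu>") (auto simp: max_def intro: order_trans)
  next
    have "(\<Sum>\<nu>\<in>N \<union> M. f \<nu>) = s * real k + t * real k"
      by (simp add: f_def sum.distrib d' c' flip: sum_distrib_left)
    then show "(\<Sum>\<nu>\<in>N \<union> M. f \<nu>) = real k" using st(3) by (simp flip: distrib_right)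
  qed (use N M in \<open>auto simp: f_def\<close>)
  also have "(\<Sum>\<nu>\<in>N \<union> M. f \<nu> *\<^sub>R \<nu>) = s *\<^sub>R p + t *\<^sub>R q"
    unfolding p' q' f_def by (simp add: scaleR_left_distrib sum.distrib scaleR_sum_right)
  finally show "s *\<^sub>R p + t *\<^sub>R q \<in> fractional_eigenvalue_sums k B" .
qed

text \<open>Orthonormal families in the finitely many eigenspaces are joined into one orthonormal
  family, and the weight of each eigenvalue is spread evenly over its members. The Schur-Horn
  theorem then applies.\<close>

lemma fractional_eigenvalue_sums_subset_range:
  fixes B :: "'m::finite \<Rightarrow> 'h::chilbert_space \<Rightarrow> 'h"
  assumes cpt: "\<And>j. compact_operator (B j)" and normal: "\<And>j. normal_operator (B j)"
  shows "fractional_eigenvalue_sums k B \<subseteq> joint_numerical_range k B"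
proof
  fix p assume "p \<in> fractional_eigenvalue_sums k B"
  then obtain N d where p: "p = (\<Sum>\<nu>\<in>N. d \<nu> *\<^sub>R \<nu>)" and N: "finite N"
    and d: "\<And>\<nu>. 0 \<le> d \<nu>" "\<And>\<nu>. \<exists>n. eigenspace_dim_ge B \<nu> n \<and> d \<nu> \<le> real n" "(\<Sum>\<nu>\<in>N. d \<nu>) = real k"
    unfolding fractional_eigenvalue_sums_def by blast
  obtain n f where f: "\<And>\<nu>. orthonormal_family (n \<nu>) (f \<nu>)" "\<And>\<nu> i. i \<in> {1..n \<nu>} \<Longrightarrow> common_eigenvector B \<nu> (f \<nu> i)"
    and dn: "\<And>\<nu>. d \<nu> \<le> real (n \<nu>)"
    using d(2) unfolding eigenspace_dim_ge_def by metis
  define I where "I = (SIGMA \<nu>:N. {1..n \<nu>})"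
  have finI: "finite I" using N by (simp add: I_def)
  obtain h where h: "bij_betw h {1..card I} I" using ex_bij_betw_nat_finite_1[OF finI] by blast
  define e where "e l = f (fst (h l)) (snd (h l))" for l
  define \<mu> where "\<mu> l = fst (h l)" for l
  \<comment> \<open>At most 1 because \<open>d \<nu> \<le> n \<nu>\<close>. If
    \<open>n \<nu> = 0\<close>, then \<open>d \<nu> = 0\<close> and no index belongs to
    \<open>\<nu>\<close>.\<close>
  define w where "w l = d (fst (h l)) / n (fst (h l))" for l
  have hI: "fst (h l) \<in> N \<and> snd (h l) \<in> {1..n (fst (h l))}" if "l \<in> {1..card I}" for l
    using h that unfolding bij_betw_def I_def by (auto simp: mem_Sigma_iff image_subset_iff set_eq_iff) (metis mem_Sigma_iff prod.collapse imageI atLeastAtMost_iff)+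
  have ev: "common_eigenvector B (\<mu> l) (e l)" if "l \<in> {1..card I}" for l
    unfolding \<mu>_def e_def using hI[OF that] f(2) by blast
  have red: "reducing_eigenvector B (\<mu> l) (e l)" if "l \<in> {1..card I}" for l
    by (rule common_eigenvector_imp_reducing[OF cpt normal ev[OF that]])
  have on: "orthonormal_family (card I) e"
    unfolding orthonormal_family_def
  proof (intro ballI)
    fix l l' assume l: "l \<in> {1..card I}" "l' \<in> {1..card I}"
    show "cinner (e l) (e l') = (if l = l' then 1 else 0)"
    proof (cases "\<mu> l = \<mu> l'")
      case True
      have "h l = h l' \<longleftrightarrow> l = l'" using inj_on_eq_iff[OF bij_betw_imp_inj_on[OF h] l] .
      then have "snd (h l) = snd (h l') \<longleftrightarrow> l = l'" using True by (auto simp: \<mu>_def prod_eq_iff)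
      then show ?thesis
        using orthonormal_familyD[OF f(1), of "snd (h l)" "fst (h l)" "snd (h l')"] hI[OF l(1)] hI[OF l(2)] True
        by (simp add: e_def \<mu>_def)
    next
      case False
      then obtain j where j: "\<mu> l $ j \<noteq> \<mu> l' $ j" by (auto simp: vec_eq_iff)
      have "\<mu> l $ j * cinner (e l) (e l') = \<mu> l' $ j * cinner (e l) (e l')"
        using red[OF l(1)] red[OF l(2)] unfolding reducing_eigenvector_def by metis
      then show ?thesis using j False by auto
    qed
  qed
  have flat: "(\<Sum>l=1..card I. g (fst (h l))) = (\<Sum>\<nu>\<in>N. real (n \<nu>) *\<^sub>R g \<nu>)" for g :: "_ \<Rightarrow> 'v::real_vector"
  proof -
    have "(\<Sum>l=1..card I. g (fst (h l))) = (\<Sum>z\<in>I. g (fst z))" by (rule sum.reindex_bij_betw[OF h])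
    also have "\<dots> = (\<Sum>\<nu>\<in>N. \<Sum>i=1..n \<nu>. g \<nu>)"
      unfolding I_def using N by (subst sum.Sigma) (auto simp: case_prod_beta)
    also have "\<dots> = (\<Sum>\<nu>\<in>N. real (n \<nu>) *\<^sub>R g \<nu>)" by (simp add: scaleR_conv_of_real sum_constant_scaleR)
    finally show ?thesis .
  qed
  have nd: "real (n \<nu>) * (d \<nu> / real (n \<nu>)) = d \<nu>" for \<nu> using dn[of \<nu>] d(1)[of \<nu>] by (cases "n \<nu> = 0") auto
  have "(\<Sum>l=1..card I. w l *\<^sub>R \<mu> l) \<in> joint_numerical_range k B"
  proof (rule weighted_eigenvalues_in_range[OF compact_operator_clinear[OF cpt] on red])
    fix l assume "l \<in> {1..card I}"
    show "0 \<le> w l \<and> w l \<le> 1" using d(1) dn by (cases "n (fst (h l)) = 0") (auto simp: w_def divide_le_eq_1)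
  next
    have "(\<Sum>l=1..card I. w l) = (\<Sum>\<nu>\<in>N. d \<nu>)"
      unfolding w_def using flat[of "\<lambda>\<nu>. d \<nu> / n \<nu>"] nd by simp
    then show "(\<Sum>l=1..card I. w l) = real k" using d(3) by simp
  qed
  also have "(\<Sum>l=1..card I. w l *\<^sub>R \<mu> l) = p"
    unfolding w_def \<mu>_def p using flat[of "\<lambda>\<nu>. (d \<nu> / n \<nu>) *\<^sub>R \<nu>"] nd by simp
  finally show "p \<in> joint_numerical_range k B" .
qed

text \<open>Orthonormalization by counting: fewer than \<open>card X\<close> vectors cannot span
  \<open>X\<close>, so some member of \<open>X\<close> always supplies a new direction.\<close>

lemma independent_imp_orthonormal_family:
  fixes X F :: "'a::complex_inner set"
  assumes X: "finite X" "cvec.independent X" "X \<subseteq> F" and F: "cvec.subspace F" and m: "m \<le> card X"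
  shows "\<exists>e. orthonormal_family m e \<and> (\<forall>i\<in>{1..m}. e i \<in> F)"
  using m
proof (induction m)
  case 0
  show ?case by (simp add: orthonormal_family_def)
next
  case (Suc m)
  then obtain e where e: "orthonormal_family m e" "\<And>i. i \<in> {1..m} \<Longrightarrow> e i \<in> F" by auto
  have "\<not> X \<subseteq> cvec.span (e ` {1..m})"
  proof
    assume "X \<subseteq> cvec.span (e ` {1..m})"
    then have "card X \<le> card (e ` {1..m})"
      using cvec.independent_span_bound[OF _ X(2)] by auto
    also have "\<dots> \<le> m" using card_image_le[of "{1..m}" e] by simp
    finally show False using Suc.prems by simp
  qed
  then obtain x where x: "x \<in> X" "x \<notin> cvec.span (e ` {1..m})" by blast
  obtain z where z: "z \<in> cvec.span (insert x (e ` {1..m}))" "norm z = 1" "z \<in> perp (e ` {1..m})"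
    using exists_unit_perp_in_span[OF finite_imageI[OF finite_atLeastAtMost] x(2)] by blast
  have "cvec.span (insert x (e ` {1..m})) \<subseteq> F"
    by (rule cvec.span_minimal[OF _ F]) (use x(1) X(3) e(2) in auto)
  then have "z \<in> F" using z(1) by blast
  then have "\<forall>i\<in>{1..Suc m}. (e(Suc m := z)) i \<in> F" using e(2) by (auto simp: le_Suc_eq)
  then show ?case using orthonormal_family_Suc[OF e(1) z(2,3)] by blast
qed

text \<open>The weight of \<open>\<nu>\<close> is the number of its occurrences; linear independence
  bounds that number by the dimension of the eigenspace.\<close>

lemma eigenvalue_sums_subset_fractional:
  fixes B :: "'m::finite \<Rightarrow> 'a::complex_inner \<Rightarrow> 'a"
  assumes B: "\<And>j. clinear (B j)"
  shows "eigenvalue_sums k B \<subseteq> fractional_eigenvalue_sums k B"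
proof
  fix p assume "p \<in> eigenvalue_sums k B"
  then obtain \<mu> x where p: "p = (\<Sum>l=1..k. \<mu> l)" and ev: "\<And>l. l \<in> {1..k} \<Longrightarrow> common_eigenvector B (\<mu> l) (x l)"
    and inj: "inj_on x {1..k}" and ind: "cvec.independent (x ` {1..k})"
    unfolding eigenvalue_sums_def by blast
  define L where "L \<nu> = {l \<in> {1..k}. \<mu> l = \<nu>}" for \<nu>
  define d where "d \<nu> = real (card (L \<nu>))" for \<nu>
  have "(\<Sum>\<nu>\<in>\<mu> ` {1..k}. d \<nu> *\<^sub>R \<nu>) \<in> fractional_eigenvalue_sums k B"
  proof (rule fractional_eigenvalue_sumsI)
    fix \<nu>
    define F where "F = {x. \<forall>j. B j x = \<nu> $ j *\<^sub>C x}"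
    have F: "cvec.subspace F"
      unfolding cvec.subspace_def F_def
      by (simp add: clinear_add[OF B] clinear_scaleC[OF B] scaleC_add_right scaleC_scaleC mult.commute
          linear_0[OF clinear_imp_linear[OF B]])
    have "x ` L \<nu> \<subseteq> F" using ev by (auto simp: L_def F_def common_eigenvector_def)
    moreover have "cvec.independent (x ` L \<nu>)"
      by (rule cvec.independent_mono[OF ind]) (auto simp: L_def)
    moreover have "card (x ` L \<nu>) = card (L \<nu>)"
      by (intro card_image inj_on_subset[OF inj]) (auto simp: L_def)
    moreover have "finite (x ` L \<nu>)" by (simp add: L_def)
    ultimately obtain e where e: "orthonormal_family (card (L \<nu>)) e" "\<And>i. i \<in> {1..card (L \<nu>)} \<Longrightarrow> e i \<in> F"
      using independent_imp_orthonormal_family[of "x ` L \<nu>" F "card (L \<nu>)"] F by auto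
    have "common_eigenvector B \<nu> (e i)" if "i \<in> {1..card (L \<nu>)}" for i
      using e(2)[OF that] orthonormal_family_norm[OF e(1) that] by (auto simp: common_eigenvector_def F_def)
    then show "\<exists>n. eigenspace_dim_ge B \<nu> n \<and> d \<nu> \<le> real n"
      using e(1) unfolding eigenspace_dim_ge_def d_def by blast
  next
    have "(\<Sum>l=1..k. (1::real)) = (\<Sum>\<nu>\<in>\<mu> ` {1..k}. \<Sum>l | l \<in> {1..k} \<and> \<mu> l = \<nu>. 1)"
      by (rule sum.image_gen) simp
    then show "sum d (\<mu> ` {1..k}) = real k" by (simp add: d_def L_def)
  qed (auto simp: d_def L_def)
  also have "(\<Sum>\<nu>\<in>\<mu> ` {1..k}. d \<nu> *\<^sub>R \<nu>) = (\<Sum>\<nu>\<in>\<mu> ` {1..k}. \<Sum>l | l \<in> {1..k} \<and> \<mu> l = \<nu>. \<mu> l)"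
  proof (intro sum.cong refl)
    fix \<nu>
    have "(\<Sum>l | l \<in> {1..k} \<and> \<mu> l = \<nu>. \<mu> l) = (\<Sum>l | l \<in> {1..k} \<and> \<mu> l = \<nu>. \<nu>)"
      by (intro sum.cong refl) simp
    then show "d \<nu> *\<^sub>R \<nu> = (\<Sum>l | l \<in> {1..k} \<and> \<mu> l = \<nu>. \<mu> l)"
      by (simp only: sum_constant_scaleR d_def L_def)
  qed
  also have "\<dots> = p" unfolding p by (rule sum.image_gen[symmetric]) simp
  finally show "p \<in> fractional_eigenvalue_sums k B" .
qed

lemma convex_hull_eigenvalue_sums_subset_range:
  fixes B :: "'m::finite \<Rightarrow> 'h::chilbert_space \<Rightarrow> 'h"
  assumes cpt: "\<And>j. compact_operator (B j)" and normal: "\<And>j. normal_operator (B j)"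
  shows "convex hull eigenvalue_sums k B \<subseteq> joint_numerical_range k B"
proof -
  have "convex hull eigenvalue_sums k B \<subseteq> fractional_eigenvalue_sums k B"
    by (intro hull_minimal eigenvalue_sums_subset_fractional compact_operator_clinear cpt
        convex_fractional_eigenvalue_sums)
  then show ?thesis using fractional_eigenvalue_sums_subset_range[where B=B, OF cpt normal] by blast
qed

lemma eigenvalue_sum_maximizes:
  fixes B :: "'m::finite \<Rightarrow> 'h::chilbert_space \<Rightarrow> 'h"
  assumes cpt: "\<And>j. compact_operator (B j)" and null: "infinite_null B"
    and normal: "\<And>j. normal_operator (B j)" and comm: "\<And>i j. B i \<circ> B j = B j \<circ> B i"
  shows "\<exists>s\<in>eigenvalue_sums k B. \<forall>p\<in>joint_numerical_range k B. a \<bullet> p \<le> a \<bullet> s"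
proof -
  obtain e \<mu> where e: "orthonormal_family k e" "\<And>i. i \<in> {1..k} \<Longrightarrow> common_eigenvector B (\<mu> i) (e i)"
    and opt: "\<And>x. orthonormal_family k x \<Longrightarrow> a \<bullet> (\<Sum>l=1..k. qform B (x l)) \<le> a \<bullet> (\<Sum>i=1..k. \<mu> i)"
    using optimal_eigenvector_family_exists[where B=B and k=k and a=a, OF cpt null normal comm] by blast
  have "\<forall>p\<in>joint_numerical_range k B. a \<bullet> p \<le> a \<bullet> (\<Sum>i=1..k. \<mu> i)"
    unfolding joint_numerical_range_altdef using opt by blast
  then show ?thesis using orthonormal_eigenvalue_sums[OF e] by blast
qed

text \<open>A polytope is closed, so a point outside is strictly separated from it, against the
  eigenvalue sum that maximizes the separating functional over the range.\<close>

lemma polytope_eigenvalue_sums_imp_range_eq: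
  fixes B :: "'m::finite \<Rightarrow> 'h::chilbert_space \<Rightarrow> 'h"
  assumes cpt: "\<And>j. compact_operator (B j)" and null: "infinite_null B"
    and normal: "\<And>j. normal_operator (B j)" and comm: "\<And>i j. B i \<circ> B j = B j \<circ> B i"
    and poly: "polytope (convex hull eigenvalue_sums k B)"
  shows "joint_numerical_range k B = convex hull eigenvalue_sums k B"
proof
  show "convex hull eigenvalue_sums k B \<subseteq> joint_numerical_range k B"
    by (rule convex_hull_eigenvalue_sums_subset_range[OF cpt normal])
  show "joint_numerical_range k B \<subseteq> convex hull eigenvalue_sums k B"
  proof (rule ccontr)
    assume "\<not> ?thesis"
    then obtain p where p: "p \<in> joint_numerical_range k B" "p \<notin> convex hull eigenvalue_sums k B" by blast
    obtain a b where ab: "a \<bullet> p < b" "\<And>s. s \<in> convex hull eigenvalue_sums k B \<Longrightarrow> b < a \<bullet> s"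
      using separating_hyperplane_closed_point[OF convex_convex_hull polytope_imp_closed[OF poly] p(2)] by blast
    obtain s where s: "s \<in> eigenvalue_sums k B" "\<forall>p\<in>joint_numerical_range k B. (- a) \<bullet> p \<le> (- a) \<bullet> s"
      using eigenvalue_sum_maximizes[where B=B and k=k and a="- a", OF cpt null normal comm] by blast
    have "a \<bullet> s \<le> a \<bullet> p" using s(2) p(1) by (auto simp: inner_minus_left)
    moreover have "b < a \<bullet> s" using ab(2) s(1) by (simp add: hull_inc)
    ultimately show False using ab(1) by simp
  qed
qed

text \<open>Each vertex of a polytope is exposed, hence the only maximizer of some functional. As an
  eigenvalue sum also maximizes that functional, it is the vertex.\<close>

lemma polytope_range_imp_hull_eq:
  fixes B :: "'m::finite \<Rightarrow> 'h::chilbert_space \<Rightarrow> 'h"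
  assumes cpt: "\<And>j. compact_operator (B j)" and null: "infinite_null B"
    and normal: "\<And>j. normal_operator (B j)" and comm: "\<And>i j. B i \<circ> B j = B j \<circ> B i"
    and poly: "polytope (convex hull joint_numerical_range k B)"
  shows "convex hull eigenvalue_sums k B = convex hull joint_numerical_range k B"
proof
  define P where "P = convex hull joint_numerical_range k B"
  have sub: "convex hull eigenvalue_sums k B \<subseteq> joint_numerical_range k B"
    by (rule convex_hull_eigenvalue_sums_subset_range[OF cpt normal])
  then show "convex hull eigenvalue_sums k B \<subseteq> convex hull joint_numerical_range k B"
    using hull_subset[of "joint_numerical_range k B" convex] by blast
  have "v \<in> eigenvalue_sums k B" if v: "v extreme_point_of P" for v
  proof -
    have "{v} face_of P" using v by (simp add: face_of_singleton)
    then have "{v} exposed_face_of P"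
      using exposed_face_of_polyhedron[OF polytope_imp_polyhedron[OF poly]] by (simp add: P_def)
    then obtain a b where ab: "P \<subseteq> {x. a \<bullet> x \<le> b}" "{v} = P \<inter> {x. a \<bullet> x = b}"
      unfolding exposed_face_of_def by blast
    obtain s where s: "s \<in> eigenvalue_sums k B" "\<forall>p\<in>joint_numerical_range k B. a \<bullet> p \<le> a \<bullet> s"
      using eigenvalue_sum_maximizes[where B=B and k=k and a=a, OF cpt null normal comm] by blast
    have "s \<in> P" using s(1) sub hull_subset[of "joint_numerical_range k B" convex]
        hull_subset[of "eigenvalue_sums k B" convex] unfolding P_def by blast
    have "P \<subseteq> {p. a \<bullet> p \<le> a \<bullet> s}"
      unfolding P_def by (rule hull_minimal) (use s(2) in \<open>auto simp: convex_halfspace_le\<close>)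
    moreover have "v \<in> P" "a \<bullet> v = b" using ab(2) by auto
    ultimately have "a \<bullet> s = b" using \<open>s \<in> P\<close> ab(1) by force
    then have "s = v" using \<open>s \<in> P\<close> ab(2) by blast
    then show ?thesis using s(1) by simp
  qed
  then have "convex hull {v. v extreme_point_of P} \<subseteq> convex hull eigenvalue_sums k B"
    by (intro hull_mono) auto
  moreover have "P = convex hull {v. v extreme_point_of P}"
    using poly Krein_Milman_polytope unfolding P_def polytope_def by metis
  ultimately show "convex hull joint_numerical_range k B \<subseteq> convex hull eigenvalue_sums k B"
    unfolding P_def by simp
qed

section \<open>Passing to the direct sum\<close>

lemma compact_operator_dsum_zero:
  fixes A :: "'m \<Rightarrow> 'a::complex_inner \<Rightarrow> 'a"
  assumes "compact_operator (A j)"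
  shows "compact_operator ((A \<oplus> zero_tuple TYPE('c::complex_inner)) j)"
proof -
  have eq: "(A \<oplus> zero_tuple TYPE('c)) j w = (A j (fst w), 0)" for w
    by (simp add: tuple_dsum_def zero_tuple_def map_prod_def case_prod_beta)
  have lin: "clinear (A j)" by (rule compact_operator_clinear[OF assms])
  have "clinear ((A \<oplus> zero_tuple TYPE('c)) j)"
    by (rule clinearI) (simp_all add: eq clinear_add[OF lin] clinear_scaleC[OF lin] scaleC_prod_def)
  moreover have "compact (closure ((A \<oplus> zero_tuple TYPE('c)) j ` cball 0 1))"
  proof -
    have K: "compact (closure (A j ` cball 0 1) \<times> {0 :: 'c})"
      using assms by (auto simp: compact_operator_def intro: compact_Times)
    have "norm (fst w) \<le> 1" if "norm w \<le> 1" for w :: "'a \<times> 'c"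
      using norm_fst_le[of "fst w" "snd w"] that by simp
    then have "(A \<oplus> zero_tuple TYPE('c)) j ` cball 0 1 \<subseteq> A j ` cball 0 1 \<times> {0}"
      by (auto simp: eq intro!: imageI)
    then have "(A \<oplus> zero_tuple TYPE('c)) j ` cball 0 1 \<subseteq> closure (A j ` cball 0 1) \<times> {0}"
      by (rule order_trans[OF _ Sigma_mono[OF closure_subset order_refl]])
    then have "closure ((A \<oplus> zero_tuple TYPE('c)) j ` cball 0 1) \<subseteq> closure (A j ` cball 0 1) \<times> {0}"
      by (rule closure_minimal[OF _ compact_imp_closed[OF K]])
    then show ?thesis using compact_Int_closed[OF K closed_closure] by (metis inf.absorb_iff2)
  qed
  ultimately show ?thesis by (simp add: compact_operator_def)
qed

lemma infinite_null_dsum_zero: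
  fixes A :: "'m::finite \<Rightarrow> 'a::complex_inner \<Rightarrow> 'a"
  assumes "\<nexists>S :: 'b::complex_inner set. finite S \<and> cvec.span S = UNIV"
    and "\<And>j. clinear (A j)"
  shows "infinite_null (A \<oplus> zero_tuple TYPE('b))"
  unfolding infinite_null_def
proof (intro allI impI)
  fix F :: "('a \<times> 'b) set" assume "finite F"
  then obtain z :: 'b where z: "norm z = 1" "z \<in> perp (snd ` F)"
    using infinite_dim_unit_perp[OF assms(1)] by blast
  have A0: "A j 0 = 0" for j using linear_0[OF clinear_imp_linear[OF assms(2)]] .
  have "reducing_eigenvector (A \<oplus> zero_tuple TYPE('b)) 0 (0, z)"
    unfolding reducing_eigenvector_def
    by (simp add: tuple_dsum_def zero_tuple_def map_prod_def case_prod_beta cinner_prod_def A0 cinner_simps)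
  moreover have "(0, z) \<in> perp F" using z(2) by (auto simp: perp_def cinner_prod_def cinner_simps)
  moreover have "norm ((0 :: 'a), z) = 1" using z(1) by simp
  ultimately show "\<exists>w\<in>perp F. norm w = 1 \<and> reducing_eigenvector (A \<oplus> zero_tuple TYPE('b)) 0 w" by blast
qed

text \<open>The adjoint of the sum is exhibited explicitly, since the second summand carries no
  completeness assumption under which Riesz would provide it.\<close>

lemma normal_operator_dsum_zero:
  fixes A :: "'m \<Rightarrow> 'a::chilbert_space \<Rightarrow> 'a"
  assumes "compact_operator (A j)"
  shows "normal_operator ((A \<oplus> zero_tuple TYPE('c::complex_inner)) j) \<longleftrightarrow> normal_operator (A j)"
proof -
  have eq: "(A \<oplus> zero_tuple TYPE('c)) j w = (A j (fst w), 0)" for w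
    by (simp add: tuple_dsum_def zero_tuple_def map_prod_def case_prod_beta)
  have "cadjoint ((A \<oplus> zero_tuple TYPE('c)) j) = (\<lambda>w. (cadjoint (A j) (fst w), 0))"
    by (rule cadjoint_eqI)
      (simp add: eq cinner_prod_def cinner_simps cinner_cadjoint[OF compact_operator_bounded_linear compact_operator_clinear, OF assms assms])
  then show ?thesis
    unfolding normal_operator_def fun_eq_iff by (simp add: eq)
qed

lemma commute_dsum_zero:
  "(A \<oplus> zero_tuple TYPE('c::complex_inner)) i \<circ> (A \<oplus> zero_tuple TYPE('c)) j
    = (A \<oplus> zero_tuple TYPE('c)) j \<circ> (A \<oplus> zero_tuple TYPE('c)) i \<longleftrightarrow> A i \<circ> A j = A j \<circ> A i"
  by (simp add: fun_eq_iff tuple_dsum_def zero_tuple_def map_prod_def case_prod_beta)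

lemma bounded_joint_numerical_range:
  fixes A :: "'m::finite \<Rightarrow> 'a::complex_inner \<Rightarrow> 'a"
  assumes "\<And>j. compact_operator (A j)"
  shows "bounded (joint_numerical_range k A)"
proof -
  obtain K where K: "\<And>z. norm z \<le> 1 \<Longrightarrow> norm (qform A z) \<le> K"
    using qform_bounded[of A] assms by blast
  have "norm (\<Sum>l=1..k. qform A (x l)) \<le> (\<Sum>l=1..k. K)" if "orthonormal_family k x" for x
    by (rule sum_norm_le) (use K orthonormal_family_norm[OF that] in simp)
  then show ?thesis unfolding bounded_iff joint_numerical_range_altdef by blast
qed

text \<open>In finite dimension the convex hull of a compact set is compact, hence closed.\<close>

lemma closure_convex_hull_bounded:
  fixes S :: "'a::euclidean_space set"
  assumes "bounded S"
  shows "closure (convex hull S) = convex hull (closure S)"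
proof
  have "compact (convex hull (closure S))"
    using assms by (intro compact_convex_hull) (simp add: compact_closure)
  then show "closure (convex hull S) \<subseteq> convex hull (closure S)"
    by (intro closure_minimal hull_mono closure_subset compact_imp_closed)
  show "convex hull (closure S) \<subseteq> closure (convex hull S)"
    by (intro hull_minimal closure_mono hull_subset convex_closure convex_convex_hull)
qed

theorem theorem6p3:
  fixes A :: "'m::finite \<Rightarrow> 'a::chilbert_space \<Rightarrow> 'a"
  assumes "\<nexists>S :: 'a set. finite S \<and> cvec.span S = UNIV"
    and "\<nexists>S :: 'b::chilbert_space set. finite S \<and> cvec.span S = UNIV"
    and "\<And>j. compact_operator (A j)"
  shows
    "(closure (joint_numerical_range CARD('k) A)
        = joint_numerical_range CARD('k) (A \<oplus> zero_tuple TYPE(complex^'k)) \<and>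
      joint_numerical_range CARD('k) (A \<oplus> zero_tuple TYPE(complex^'k))
        = joint_numerical_range CARD('k) (A \<oplus> zero_tuple TYPE('b))) \<and>
     (closure (convex hull joint_numerical_range CARD('k) A)
        = convex hull joint_numerical_range CARD('k) (A \<oplus> zero_tuple TYPE(complex^'k)) \<and>
      convex hull joint_numerical_range CARD('k) (A \<oplus> zero_tuple TYPE(complex^'k))
        = convex hull joint_numerical_range CARD('k) (A \<oplus> zero_tuple TYPE('b))) \<and>
     ((\<forall>k\<ge>1. polytope (closure (joint_numerical_range k A))) \<longleftrightarrow>
      (\<forall>k\<ge>1. polytope (closure (convex hull joint_numerical_range k A)))) \<and>
     ((\<forall>k\<ge>1. polytope (closure (convex hull joint_numerical_range k A))) \<longleftrightarrow>
      (\<forall>i j. A i \<circ> A j = A j \<circ> A i) \<and> (\<forall>j. normal_operator (A j)) \<and>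
      (\<forall>k\<ge>1. polytope (convex hull eigenvalue_sums k (A \<oplus> zero_tuple TYPE('b)))))"
proof -
  define B where "B = A \<oplus> zero_tuple TYPE('b)"
  note inf = assms(1) and inf' = assms(2) and cptA = assms(3)
  have cpt: "compact_operator (B j)" for j
    unfolding B_def by (rule compact_operator_dsum_zero[OF cptA])
  have null: "infinite_null B"
    unfolding B_def by (rule infinite_null_dsum_zero[OF inf' compact_operator_clinear[OF cptA]])
  have normal_iff: "normal_operator (B j) \<longleftrightarrow> normal_operator (A j)" for j
    unfolding B_def by (rule normal_operator_dsum_zero[OF cptA])
  have comm_iff: "B i \<circ> B j = B j \<circ> B i \<longleftrightarrow> A i \<circ> A j = A j \<circ> A i" for i j
    unfolding B_def by (rule commute_dsum_zero)
  have clB: "closure (joint_numerical_range k A) = joint_numerical_range k B" for k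
  proof -
    obtain v :: "nat \<Rightarrow> 'b" where "orthonormal_family k v"
      using infinite_dim_orthonormal_family[OF inf'] by blast
    then show ?thesis
      unfolding B_def by (rule closure_joint_numerical_range_eq_dsum[where A=A, OF inf cptA])
  qed
  have clC: "closure (joint_numerical_range CARD('k) A)
      = joint_numerical_range CARD('k) (A \<oplus> zero_tuple TYPE(complex^'k))"
  proof -
    obtain v :: "nat \<Rightarrow> complex^'k" where "orthonormal_family CARD('k) v"
      using vec_orthonormal_family by blast
    then show ?thesis by (rule closure_joint_numerical_range_eq_dsum[where A=A, OF inf cptA])
  qed
  have hullB: "closure (convex hull joint_numerical_range k A) = convex hull joint_numerical_range k B" for k
    using closure_convex_hull_bounded[OF bounded_joint_numerical_range[where A=A, OF cptA]] by (simp add: clB)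
  \<comment> \<open>With the closures expressed through \<open>B\<close>, (a) implies (b) because a
    polytope is its own convex hull.\<close>
  have ab: "polytope (convex hull joint_numerical_range k B)" if "polytope (joint_numerical_range k B)" for k
    using that by (simp add: hull_same[of convex] polytope_imp_convex)
  have bc: "(\<forall>i j. B i \<circ> B j = B j \<circ> B i) \<and> (\<forall>j. normal_operator (B j)) \<and>
      (\<forall>k\<ge>1. polytope (convex hull eigenvalue_sums k B))"
    if b: "\<forall>k\<ge>1. polytope (convex hull joint_numerical_range k B)"
  proof -
    have comm: "B i \<circ> B j = B j \<circ> B i" for i j
      by (rule polytope_imp_commuting_normal(1)[where B=B, OF cpt null b])
    have normal: "normal_operator (B j)" for j
      by (rule polytope_imp_commuting_normal(2)[where B=B, OF cpt null b])
    have "polytope (convex hull eigenvalue_sums k B)" if "k \<ge> 1" for k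
      using polytope_range_imp_hull_eq[where B=B, OF cpt null normal comm b[rule_format, OF that]]
        b that by simp
    then show ?thesis using comm normal by blast
  qed
  have ca: "polytope (joint_numerical_range k B)"
    if "\<forall>i j. B i \<circ> B j = B j \<circ> B i" "\<forall>j. normal_operator (B j)"
      "polytope (convex hull eigenvalue_sums k B)" for k
    using polytope_eigenvalue_sums_imp_range_eq[where B=B and k=k, OF cpt null] that by simp
  show ?thesis
  proof (intro conjI)
    show "closure (joint_numerical_range CARD('k) A)
        = joint_numerical_range CARD('k) (A \<oplus> zero_tuple TYPE(complex^'k))" by (rule clC)
    show "joint_numerical_range CARD('k) (A \<oplus> zero_tuple TYPE(complex^'k))
        = joint_numerical_range CARD('k) (A \<oplus> zero_tuple TYPE('b))"
      using clC clB[of "CARD('k)"] by (simp add: B_def)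
    show "closure (convex hull joint_numerical_range CARD('k) A)
        = convex hull joint_numerical_range CARD('k) (A \<oplus> zero_tuple TYPE(complex^'k))"
      using hullB[of "CARD('k)"] clC clB[of "CARD('k)"] by simp
    show "convex hull joint_numerical_range CARD('k) (A \<oplus> zero_tuple TYPE(complex^'k))
        = convex hull joint_numerical_range CARD('k) (A \<oplus> zero_tuple TYPE('b))"
      using clC clB[of "CARD('k)"] by (simp add: B_def)
    show "(\<forall>k\<ge>1. polytope (closure (joint_numerical_range k A))) \<longleftrightarrow>
        (\<forall>k\<ge>1. polytope (closure (convex hull joint_numerical_range k A)))"
      unfolding clB hullB using ab bc ca by blast
    show "(\<forall>k\<ge>1. polytope (closure (convex hull joint_numerical_range k A))) \<longleftrightarrow>
        (\<forall>i j. A i \<circ> A j = A j \<circ> A i) \<and> (\<forall>j. normal_operator (A j)) \<and>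
        (\<forall>k\<ge>1. polytope (convex hull eigenvalue_sums k (A \<oplus> zero_tuple TYPE('b))))"
      unfolding hullB B_def[symmetric] comm_iff[symmetric] normal_iff[symmetric]
      using ab bc ca by blast
  qed
qed

end
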